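(* Let $h_0=-d^2/dx^2+V_0(x)$ on $(a,b)$ with zero boundary conditions, let $h_1=-d^2/dx^2+V_1(x)$ be its SUSY partner obtained from a transformation function $u$ with factorization constant $\alpha$, and let $L=-d/dx+w(x)$, $w=u'/u$, be the corresponding transformation operator, the transformation being of one of the types (i), (ii), (iii) described in the context. Let $G_0(x,y,E)$ be the Green function of $h_0$. Then in all three cases the Green function $G_1(x,y,E)$ of $h_1$ is given, for $E\notin\mathrm{spec}\,h_0$, $E\neq\alpha$, by $$G_1(x,y,E)=\frac{1}{E-\alpha}\left[L_xL_yG_0(x,y,E)-\delta(x-y)\right],$$ where $\delta$ is the Dirac delta function. In case (ii), $G_1$ has a simple pole at $E=\alpha$. In cases (i) and (iii), $G_1$ is regular at $E=\alpha$ and $$G_1(x,y,\alpha)=\left[L_xL_y\frac{\partial G_0(x,y,E)}{\partial E}\right]_{E=\alpha}.$$ Here $L_x$ is the operator $L$ acting in the variable $x$, and $L_y$ is the same operator with $x$ replaced by $y$.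
   Context: **Spectral problem.** Let $-\infty\le a<b\le\infty$ (mostly $(a,b)=(-\infty,\infty)$ or $(0,\infty)$), let $V_0$ be a real potential and $h_0=-d^2/dx^2+V_0(x)$ on $(a,b)$ with boundary conditions $\psi(a)=\psi(b)=0$. It is assumed that $h_0$ is essentially self-adjoint in $L^2(a,b)$ and that its spectrum $\mathrm{spec}\,h_0$ consists of (finitely many, infinitely many, or no) discrete eigenvalues $E_0<E_1<\dots$ with orthonormal eigenfunctions $\psi_n$, and possibly a continuous part filling the positive semiaxis, with eigenfunctions $\psi_k$, $h_0\psi_k=k^2\psi_k$, $\langle\psi_k|\psi_{k'}\rangle=\delta(k-k')$, $\langle\psi_n|\psi_k\rangle=0$. The $\psi_n$ and $\psi_k$ together form a complete set: $\sum_n\psi_n(x)\psi_n^*(y)+\int dk\,\psi_k(x)\psi_k^*(y)=\delta(x-y)$ (the $k$-integral runs over $\mathbb R$ on the whole line, over $(0,\infty)$ on the half line). **Green function.** For $E\notin\mathrm{spec}\,h_0$, $G_0(x,y,E)$ is the integral kernel of $(h_0-E)^{-1}$, i.e. $$G_0(x,y,E)=\sum_n\frac{\psi_n(x)\psi_n^*(y)}{E_n-E}+\int\frac{\psi_k(x)\psi_k^*(y)}{k^2-E}\,dk .$$ Similarly $G_1(x,y,E)$ is the kernel of $(h_1-E)^{-1}$, $h_1$ being considered on $(a,b)$ with zero boundary conditions. **SUSY partner.** Let $u$ be a real nodeless solution on $(a,b)$ of $-u''+V_0u=\alpha u$, where the real factorization constant $\alpha$ is less than or equal to the ground state energy of $h_0$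 if $h_0$ has a discrete spectrum, and lower than the continuum threshold otherwise. Put $w=(\log u)'=u'/u$, $V_1=V_0-2w'$, $h_1=-d^2/dx^2+V_1$, $L=-d/dx+w$, $L^+=d/dx+w$. Then $Lu=0$, $Lh_0=h_1L$, $L^+L=h_0-\alpha$. SUSY transformations are required to preserve the zero boundary conditions: for $E\ne\alpha$, $L$ maps solutions of $h_0f=Ef$ vanishing at $a$ (resp. $b$) to solutions of $h_1f=Ef$ vanishing at $a$ (resp. $b$). **The three types.** (i) Deleting the ground state level of $h_0$: $\alpha=E_0$, $u=\psi_0$, $\mathrm{spec}\,h_1=\mathrm{spec}\,h_0\setminus\{E_0\}$. (ii) Creating a new ground state level: $\alpha$ lies below $\mathrm{spec}\,h_0$, $1/u$ is (up to normalization) the ground state eigenfunction of $h_1$ at energy $\alpha$, $\mathrm{spec}\,h_1=\mathrm{spec}\,h_0\cup\{\alpha\}$. (iii) Isospectral: $\alpha$ lies below $\mathrm{spec}\,h_0$ and $\mathrm{spec}\,h_1=\mathrm{spec}\,h_0$. **Conventions.** Derivatives of kernels are taken in the distributional sense. In case (i), $G_0$ has a pole at $E=\alpha$; the expression evaluated at $E=\alpha$ is understood after $L_xL_y$ has been applied (and extended to $E=\alpha$ by continuity). *)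

theory Defs
  imports "HOL-Complex_Analysis.Complex_Analysis"
begin

subsection \<open>Functions of one real variable\<close>

definition vderiv :: "(real \<Rightarrow> 'a::real_normed_vector) \<Rightarrow> real \<Rightarrow> 'a" where
  "vderiv f = (\<lambda>x. vector_derivative f (at x))"

definition C2_on :: "real set \<Rightarrow> (real \<Rightarrow> 'a::real_normed_vector) \<Rightarrow> bool" where
  "C2_on I f \<longleftrightarrow>
     (\<forall>x\<in>I. f differentiable (at x)) \<and> (\<forall>x\<in>I. vderiv f differentiable (at x)) \<and>
     continuous_on I (vderiv (vderiv f))"

text \<open>Zero boundary conditions at a possibly infinite left or right end point.\<close>

definition vanishes_left :: "ereal \<Rightarrow> (real \<Rightarrow> 'a::real_normed_vector) \<Rightarrow> bool" where
  "vanishes_left a f \<longleftrightarrow> ((f \<circ> real_of_ereal) \<longlongrightarrow> 0) (at_right a)"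

definition vanishes_right :: "ereal \<Rightarrow> (real \<Rightarrow> 'a::real_normed_vector) \<Rightarrow> bool" where
  "vanishes_right b f \<longleftrightarrow> ((f \<circ> real_of_ereal) \<longlongrightarrow> 0) (at_left b)"

definition compactly_supported_in :: "real set \<Rightarrow> (real \<Rightarrow> complex) \<Rightarrow> bool" where
  "compactly_supported_in I f \<longleftrightarrow>
     (\<exists>S. compact S \<and> S \<subseteq> I \<and> (\<forall>x. x \<notin> S \<longrightarrow> f x = 0))"

definition test_functions :: "real set \<Rightarrow> (real \<Rightarrow> complex) set" where
  "test_functions I =
     {f. (\<forall>n x. (vderiv ^^ n) f differentiable (at x)) \<and> compactly_supported_in I f}"


subsection \<open>Kernels and distributions on the square\<close>

definition deriv_x :: "(real \<Rightarrow> real \<Rightarrow> complex) \<Rightarrow> real \<Rightarrow> real \<Rightarrow> complex" where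
  "deriv_x \<phi> = (\<lambda>x y. vderiv (\<lambda>s. \<phi> s y) x)"

definition deriv_y :: "(real \<Rightarrow> real \<Rightarrow> complex) \<Rightarrow> real \<Rightarrow> real \<Rightarrow> complex" where
  "deriv_y \<phi> = (\<lambda>x y. vderiv (\<lambda>t. \<phi> x t) y)"

primrec Ck_plane :: "nat \<Rightarrow> (real \<Rightarrow> real \<Rightarrow> complex) \<Rightarrow> bool" where
  "Ck_plane 0 = (\<lambda>\<phi>. continuous_on UNIV (\<lambda>(x, y). \<phi> x y))"
| "Ck_plane (Suc n) = (\<lambda>\<phi>.
     (\<forall>x y. (\<lambda>s. \<phi> s y) differentiable (at x) \<and> (\<lambda>t. \<phi> x t) differentiable (at y)) \<and>
     Ck_plane n (deriv_x \<phi>) \<and> Ck_plane n (deriv_y \<phi>))"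

definition test_functions2 :: "real set \<Rightarrow> (real \<Rightarrow> real \<Rightarrow> complex) set" where
  "test_functions2 I =
     {\<phi>. (\<forall>n. Ck_plane n \<phi>) \<and>
         (\<exists>S. compact S \<and> S \<subseteq> I \<times> I \<and> (\<forall>x y. (x, y) \<notin> S \<longrightarrow> \<phi> x y = 0))}"

text \<open>The regular distribution of a kernel, and the distribution \<open>\<delta>(x - y)\<close>.\<close>

definition kernel_dist ::
  "real set \<Rightarrow> (real \<Rightarrow> real \<Rightarrow> complex) \<Rightarrow> (real \<Rightarrow> real \<Rightarrow> complex) \<Rightarrow> complex" where
  "kernel_dist I K \<phi> = (LINT p:I \<times> I|lborel. K (fst p) (snd p) * \<phi> (fst p) (snd p))"

definition delta_dist :: "real set \<Rightarrow> (real \<Rightarrow> real \<Rightarrow> complex) \<Rightarrow> complex" where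
  "delta_dist I \<phi> = (LINT x:I|lborel. \<phi> x x)"

text \<open>The operator \<open>L = -d/dx + w\<close>, and its formal transposes \<open>d/dx + w\<close> and \<open>d/dy + w\<close> acting on
  test functions.  The distribution \<open>L\<^sub>x L\<^sub>y K\<close> is obtained by moving \<open>L\<^sub>x\<close> and \<open>L\<^sub>y\<close> onto the test
  function.\<close>

definition L_op :: "(real \<Rightarrow> real) \<Rightarrow> (real \<Rightarrow> complex) \<Rightarrow> real \<Rightarrow> complex" where
  "L_op w f = (\<lambda>x. - vderiv f x + w x *\<^sub>R f x)"

definition Lt_x :: "(real \<Rightarrow> real) \<Rightarrow> (real \<Rightarrow> real \<Rightarrow> complex) \<Rightarrow> real \<Rightarrow> real \<Rightarrow> complex" where
  "Lt_x w \<phi> = (\<lambda>x y. deriv_x \<phi> x y + w x *\<^sub>R \<phi> x y)"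

definition Lt_y :: "(real \<Rightarrow> real) \<Rightarrow> (real \<Rightarrow> real \<Rightarrow> complex) \<Rightarrow> real \<Rightarrow> real \<Rightarrow> complex" where
  "Lt_y w \<phi> = (\<lambda>x y. deriv_y \<phi> x y + w y *\<^sub>R \<phi> x y)"

definition LL_dist :: "real set \<Rightarrow> (real \<Rightarrow> real) \<Rightarrow>
    (real \<Rightarrow> real \<Rightarrow> complex) \<Rightarrow> (real \<Rightarrow> real \<Rightarrow> complex) \<Rightarrow> complex" where
  "LL_dist I w K \<phi> = kernel_dist I K (Lt_x w (Lt_y w \<phi>))"


subsection \<open>Unbounded operators in \<open>L\<^sup>2\<close>\<close>

text \<open>Elements of \<open>L\<^sup>2(I)\<close> are represented by functions whose values outside \<open>I\<close> are irrelevant;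
  operators are represented by their graphs.\<close>

definition L2 :: "real set \<Rightarrow> (real \<Rightarrow> complex) set" where
  "L2 I = {f. set_borel_measurable lborel I f \<and>
              set_integrable lborel I (\<lambda>x. (cmod (f x))\<^sup>2)}"

definition L2_inner :: "real set \<Rightarrow> (real \<Rightarrow> complex) \<Rightarrow> (real \<Rightarrow> complex) \<Rightarrow> complex" where
  "L2_inner I f g = (LINT x:I|lborel. cnj (f x) * g x)"

definition L2_norm :: "real set \<Rightarrow> (real \<Rightarrow> complex) \<Rightarrow> real" where
  "L2_norm I f = sqrt (LINT x:I|lborel. (cmod (f x))\<^sup>2)"

type_synonym operator_graph = "((real \<Rightarrow> complex) \<times> (real \<Rightarrow> complex)) set"

definition densely_defined :: "real set \<Rightarrow> operator_graph \<Rightarrow> bool" where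
  "densely_defined I T \<longleftrightarrow>
     (\<forall>f\<in>L2 I. \<forall>e>0. \<exists>g\<in>Domain T. L2_norm I (\<lambda>x. f x - g x) < e)"

definition op_closure :: "real set \<Rightarrow> operator_graph \<Rightarrow> operator_graph" where
  "op_closure I T =
     {(f, h). f \<in> L2 I \<and> h \<in> L2 I \<and>
        (\<exists>F H. (\<forall>n::nat. (F n, H n) \<in> T) \<and>
               (\<lambda>n. L2_norm I (\<lambda>x. F n x - f x)) \<longlonglongrightarrow> 0 \<and>
               (\<lambda>n. L2_norm I (\<lambda>x. H n x - h x)) \<longlonglongrightarrow> 0)}"

definition op_adjoint :: "real set \<Rightarrow> operator_graph \<Rightarrow> operator_graph" where
  "op_adjoint I T =
     {(g, k). g \<in> L2 I \<and> k \<in> L2 I \<and> (\<forall>(f, h)\<in>T. L2_inner I h g = L2_inner I f k)}"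

definition essentially_self_adjoint :: "real set \<Rightarrow> operator_graph \<Rightarrow> bool" where
  "essentially_self_adjoint I T \<longleftrightarrow>
     densely_defined I T \<and> op_adjoint I (op_closure I T) = op_closure I T"

definition resolvent_set :: "real set \<Rightarrow> operator_graph \<Rightarrow> complex set" where
  "resolvent_set I T =
     {E. (\<forall>k\<in>L2 I. \<exists>(f, h)\<in>T. AE x in lborel. x \<in> I \<longrightarrow> h x - E * f x = k x) \<and>
         (\<exists>C. \<forall>(f, h)\<in>T. L2_norm I f \<le> C * L2_norm I (\<lambda>x. h x - E * f x))}"


subsection \<open>Schroedinger operators with zero boundary conditions\<close>

definition schroedinger :: "(real \<Rightarrow> real) \<Rightarrow> (real \<Rightarrow> 'a::real_normed_vector) \<Rightarrow> real \<Rightarrow> 'a" where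
  "schroedinger V f = (\<lambda>x. - vderiv (vderiv f) x + V x *\<^sub>R f x)"

definition dirichlet_op :: "ereal \<Rightarrow> ereal \<Rightarrow> (real \<Rightarrow> real) \<Rightarrow> operator_graph" where
  "dirichlet_op a b V =
     {(f, h). C2_on (einterval a b) f \<and> (\<forall>x\<in>einterval a b. h x = schroedinger V f x) \<and>
        f \<in> L2 (einterval a b) \<and> h \<in> L2 (einterval a b) \<and>
        vanishes_left a f \<and> vanishes_right b f}"

text \<open>The spectrum of an operator that need not be closed is the spectrum of its closure.\<close>

definition spec :: "ereal \<Rightarrow> ereal \<Rightarrow> (real \<Rightarrow> real) \<Rightarrow> complex set" where
  "spec a b V = - resolvent_set (einterval a b) (op_closure (einterval a b) (dirichlet_op a b V))"

text \<open>\<open>G x y E\<close> is the (continuous) integral kernel of the inverse of \<open>h - E\<close>: for every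
  continuous \<open>f\<close> of compact support, the function \<open>\<integral> G x y E f(y) dy\<close> belongs to the domain of \<open>h\<close>, hence obeys the zero
  boundary conditions, and is mapped to \<open>f\<close> by \<open>h - E\<close>.  Such \<open>f\<close> are dense in \<open>L\<^sup>2\<close> and the inverse
  is bounded, so this determines the resolvent.  The values of \<open>G\<close> for \<open>E\<close> in the spectrum
  are irrelevant.\<close>

definition green_function ::
  "ereal \<Rightarrow> ereal \<Rightarrow> (real \<Rightarrow> real) \<Rightarrow> (real \<Rightarrow> real \<Rightarrow> complex \<Rightarrow> complex) \<Rightarrow> bool" where
  "green_function a b V G \<longleftrightarrow>
     (\<forall>E. E \<notin> spec a b V \<longrightarrow>
        continuous_on (einterval a b \<times> einterval a b) (\<lambda>(x, y). G x y E) \<and>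
        (\<forall>f. continuous_on UNIV f \<longrightarrow> compactly_supported_in (einterval a b) f \<longrightarrow>
           (let g = (\<lambda>x. LINT y:einterval a b|lborel. G x y E * f y)
            in (g, \<lambda>x. E * g x + f x) \<in> dirichlet_op a b V)))"


subsection \<open>The unperturbed spectral problem\<close>

text \<open>The flag \<open>cont\<close> tells whether there is a continuous spectrum; \<open>N\<close> is the index set of the
  discrete levels \<open>En n\<close> with eigenfunctions \<open>\<psi> n\<close>; the \<open>\<eta> k\<close> are the continuum eigenfunctions,
  labelled by the momentum \<open>k\<close> (on the whole line both \<open>k\<close> and \<open>-k\<close> have energy \<open>k\<^sup>2\<close>).\<close>

definition momenta :: "ereal \<Rightarrow> ereal \<Rightarrow> bool \<Rightarrow> real set" where
  "momenta a b cont =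
     (if \<not> cont then {} else if a = -\<infinity> \<and> b = \<infinity> then UNIV else {0<..})"

definition discrete_eigensystem :: "ereal \<Rightarrow> ereal \<Rightarrow> (real \<Rightarrow> real) \<Rightarrow>
    nat set \<Rightarrow> (nat \<Rightarrow> real) \<Rightarrow> (nat \<Rightarrow> real \<Rightarrow> complex) \<Rightarrow> bool" where
  "discrete_eigensystem a b V N En \<psi> \<longleftrightarrow>
     (\<forall>n\<in>N. \<forall>m<n. m \<in> N) \<and> strict_mono_on N En \<and>
     (\<forall>n\<in>N. (\<psi> n, \<lambda>x. En n *\<^sub>R \<psi> n x) \<in> dirichlet_op a b V) \<and>
     (\<forall>n\<in>N. \<forall>m\<in>N. L2_inner (einterval a b) (\<psi> n) (\<psi> m) = (if n = m then 1 else 0))"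

text \<open>A superposition of continuum eigenfunctions with weight \<open>c\<close>.  The relations
  \<open>\<langle>\<psi>\<^sub>k | \<psi>\<^sub>k'\<rangle> = \<delta>(k - k')\<close> and \<open>\<langle>\<psi>\<^sub>n | \<psi>\<^sub>k\<rangle> = 0\<close> are read as distributions in \<open>k\<close> and \<open>k'\<close>.\<close>

definition wave_packet :: "real set \<Rightarrow> (real \<Rightarrow> real \<Rightarrow> complex) \<Rightarrow> (real \<Rightarrow> complex) \<Rightarrow>
    real \<Rightarrow> complex" where
  "wave_packet K \<eta> c = (\<lambda>x. LINT k:K|lborel. c k * \<eta> k x)"

definition continuum_eigensystem :: "ereal \<Rightarrow> ereal \<Rightarrow> (real \<Rightarrow> real) \<Rightarrow>
    nat set \<Rightarrow> (nat \<Rightarrow> real \<Rightarrow> complex) \<Rightarrow> real set \<Rightarrow> (real \<Rightarrow> real \<Rightarrow> complex) \<Rightarrow> bool" where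
  "continuum_eigensystem a b V N \<psi> K \<eta> \<longleftrightarrow>
     set_borel_measurable lborel (K \<times> einterval a b) (\<lambda>(k, x). \<eta> k x) \<and>
     (\<forall>k\<in>K. C2_on (einterval a b) (\<eta> k) \<and>
            (\<forall>x\<in>einterval a b. schroedinger V (\<eta> k) x = k\<^sup>2 *\<^sub>R \<eta> k x) \<and>
            (a \<noteq> -\<infinity> \<longrightarrow> vanishes_left a (\<eta> k)) \<and> (b \<noteq> \<infinity> \<longrightarrow> vanishes_right b (\<eta> k))) \<and>
     (\<forall>c\<in>test_functions K.
        (\<forall>x\<in>einterval a b. set_integrable lborel K (\<lambda>k. c k * \<eta> k x)) \<and>
        wave_packet K \<eta> c \<in> L2 (einterval a b) \<and>
        (\<forall>d\<in>test_functions K.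
           L2_inner (einterval a b) (wave_packet K \<eta> c) (wave_packet K \<eta> d) = L2_inner K c d) \<and>
        (\<forall>n\<in>N. L2_inner (einterval a b) (\<psi> n) (wave_packet K \<eta> c) = 0))"

text \<open>The completeness relation
  \<open>\<Sum>\<^sub>n \<psi>\<^sub>n(x) \<psi>\<^sub>n\<^sup>*(y) + \<integral> \<psi>\<^sub>k(x) \<psi>\<^sub>k\<^sup>*(y) dk = \<delta>(x - y)\<close>, smeared with \<open>f\<^sup>*(x) g(y)\<close>.\<close>

definition complete_eigensystem :: "real set \<Rightarrow>
    nat set \<Rightarrow> (nat \<Rightarrow> real \<Rightarrow> complex) \<Rightarrow> real set \<Rightarrow> (real \<Rightarrow> real \<Rightarrow> complex) \<Rightarrow> bool" where
  "complete_eigensystem I N \<psi> K \<eta> \<longleftrightarrow>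
     (\<forall>f\<in>test_functions I. \<forall>g\<in>test_functions I.
        set_integrable lborel K (\<lambda>k. L2_inner I f (\<eta> k) * L2_inner I (\<eta> k) g) \<and>
        ((\<lambda>n. L2_inner I f (\<psi> n) * L2_inner I (\<psi> n) g) has_sum
          (L2_inner I f g - (LINT k:K|lborel. L2_inner I f (\<eta> k) * L2_inner I (\<eta> k) g))) N)"

definition spectral_problem :: "ereal \<Rightarrow> ereal \<Rightarrow> (real \<Rightarrow> real) \<Rightarrow> bool \<Rightarrow>
    nat set \<Rightarrow> (nat \<Rightarrow> real) \<Rightarrow> (nat \<Rightarrow> real \<Rightarrow> complex) \<Rightarrow> (real \<Rightarrow> real \<Rightarrow> complex) \<Rightarrow> bool" where
  "spectral_problem a b V cont N En \<psi> \<eta> \<longleftrightarrow>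
     a < b \<and> continuous_on (einterval a b) V \<and>
     essentially_self_adjoint (einterval a b) (dirichlet_op a b V) \<and>
     spec a b V = complex_of_real ` (En ` N \<union> (if cont then {0..} else {})) \<and>
     (cont \<longrightarrow> (\<forall>n\<in>N. En n < 0)) \<and>
     discrete_eigensystem a b V N En \<psi> \<and>
     continuum_eigensystem a b V N \<psi> (momenta a b cont) \<eta> \<and>
     complete_eigensystem (einterval a b) N \<psi> (momenta a b cont) \<eta>"


subsection \<open>SUSY transformations\<close>

definition superpotential :: "(real \<Rightarrow> real) \<Rightarrow> real \<Rightarrow> real" where
  "superpotential u = (\<lambda>x. vderiv u x / u x)"

definition partner :: "(real \<Rightarrow> real) \<Rightarrow> (real \<Rightarrow> real) \<Rightarrow> real \<Rightarrow> real" where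
  "partner V u = (\<lambda>x. V x - 2 * vderiv (superpotential u) x)"

definition preserves_boundary_conditions ::
  "ereal \<Rightarrow> ereal \<Rightarrow> (real \<Rightarrow> real) \<Rightarrow> real \<Rightarrow> (real \<Rightarrow> real) \<Rightarrow> bool" where
  "preserves_boundary_conditions a b V \<alpha> w \<longleftrightarrow>
     (\<forall>E f. E \<noteq> complex_of_real \<alpha> \<longrightarrow> C2_on (einterval a b) f \<longrightarrow>
        (\<forall>x\<in>einterval a b. schroedinger V f x = E * f x) \<longrightarrow>
        (vanishes_left a f \<longrightarrow> vanishes_left a (L_op w f)) \<and>
        (vanishes_right b f \<longrightarrow> vanishes_right b (L_op w f)))"

definition susy_transformation :: "ereal \<Rightarrow> ereal \<Rightarrow> (real \<Rightarrow> real) \<Rightarrow>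
    nat set \<Rightarrow> (nat \<Rightarrow> real) \<Rightarrow> real \<Rightarrow> (real \<Rightarrow> real) \<Rightarrow> bool" where
  "susy_transformation a b V N En \<alpha> u \<longleftrightarrow>
     C2_on (einterval a b) u \<and>
     (\<forall>x\<in>einterval a b. schroedinger V u x = \<alpha> * u x \<and> u x \<noteq> 0) \<and>
     (if N \<noteq> {} then \<alpha> \<le> En 0 else \<alpha> < 0) \<and>
     preserves_boundary_conditions a b V \<alpha> (superpotential u)"

definition below_spec :: "real \<Rightarrow> complex set \<Rightarrow> bool" where
  "below_spec \<alpha> S \<longleftrightarrow> (\<forall>E\<in>S. \<alpha> < Re E)"

definition deletes_ground_state :: "ereal \<Rightarrow> ereal \<Rightarrow> (real \<Rightarrow> real) \<Rightarrow>
    nat set \<Rightarrow> (nat \<Rightarrow> real) \<Rightarrow> (nat \<Rightarrow> real \<Rightarrow> complex) \<Rightarrow> real \<Rightarrow> (real \<Rightarrow> real) \<Rightarrow> bool" where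
  "deletes_ground_state a b V N En \<psi> \<alpha> u \<longleftrightarrow>
     0 \<in> N \<and> \<alpha> = En 0 \<and> (\<forall>x\<in>einterval a b. complex_of_real (u x) = \<psi> 0 x) \<and>
     spec a b (partner V u) = spec a b V - {complex_of_real \<alpha>}"

definition creates_ground_state :: "ereal \<Rightarrow> ereal \<Rightarrow> (real \<Rightarrow> real) \<Rightarrow>
    real \<Rightarrow> (real \<Rightarrow> real) \<Rightarrow> bool" where
  "creates_ground_state a b V \<alpha> u \<longleftrightarrow>
     below_spec \<alpha> (spec a b V) \<and>
     (\<lambda>x. complex_of_real (1 / u x), \<lambda>x. \<alpha> *\<^sub>R complex_of_real (1 / u x))
        \<in> dirichlet_op a b (partner V u) \<and>
     spec a b (partner V u) = spec a b V \<union> {complex_of_real \<alpha>}"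

definition isospectral :: "ereal \<Rightarrow> ereal \<Rightarrow> (real \<Rightarrow> real) \<Rightarrow>
    real \<Rightarrow> (real \<Rightarrow> real) \<Rightarrow> bool" where
  "isospectral a b V \<alpha> u \<longleftrightarrow>
     below_spec \<alpha> (spec a b V) \<and> spec a b (partner V u) = spec a b V"

definition has_simple_pole :: "(complex \<Rightarrow> complex) \<Rightarrow> complex \<Rightarrow> bool" where
  "has_simple_pole f z \<longleftrightarrow> isolated_singularity_at f z \<and> is_pole f z \<and> zorder f z = -1"

end

theory Submission
  imports Defs
begin

text \<open>At an energy \<open>E\<close> in the resolvent set, \<open>G\<^sub>0(x, y, E) = F(min x y) R(max x y)\<close>, where \<open>F\<close> and \<open>R\<close> solve
  \<open>h\<^sub>0 f = E f\<close>, are square integrable near \<open>a\<close> resp. \<open>b\<close>, vanish there, and have Wronskian \<open>F R' - F' R = -1\<close>; essential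
  self-adjointness guarantees that both exist. For \<open>E \<noteq> \<alpha>\<close> the functions \<open>L F / (E - \<alpha>)\<close> and \<open>L R\<close> play
  the same role for \<open>h\<^sub>1\<close>: they vanish at the end points by hypothesis, and they are square integrable because
  \<open>(f\<^sup>* L f)' = (E - \<alpha>)|f|\<^sup>2 - |L f|\<^sup>2\<close>. So \<open>(E - \<alpha>) G\<^sub>1\<close> is \<open>L\<^sub>x L\<^sub>y G\<^sub>0\<close> off the diagonal, and the jump on the
  diagonal contributes \<open>\<delta>(x - y)\<close>.

  For the behaviour near \<open>\<alpha>\<close>, the jump of \<open>\<partial>\<^sub>x G\<close> on the diagonal does not depend on \<open>E\<close>. Hence
  \<open>d = G(\<sqdot>, y, E) - G(\<sqdot>, y, E')\<close> lies in the domain of \<open>h\<close> and satisfies \<open>(h - E) d = (E - E') G(\<sqdot>, y, E')\<close>. The bound on the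
  resolvent and a local Sobolev inequality turn this into locally uniform Lipschitz bounds in \<open>E\<close>, also for
  divided differences, hence into holomorphy.\<close>

section \<open>Calculus on an open interval\<close>

text \<open>A Green function is given only through its action on continuous functions, one energy at
  a time. Nothing is assumed about its dependence on \<open>E\<close>, and Weyl solutions are chosen
  separately for each energy, so that only products such as \<open>F E x * R E y\<close> are
  meaningful.

  The operator \<open>h\<^sub>1\<close> is not assumed to be essentially self-adjoint. Its Weyl
  solutions are therefore inherited from \<open>h\<^sub>0\<close> through \<open>L\<close>, which
  works neither at \<open>E = \<alpha>\<close> nor at points of the spectrum of
  \<open>h\<^sub>0\<close>. Around \<alpha> this leaves a punctured disc, and in cases (i) and (iii)
  the kernel at the centre, known only as some continuous inverse of
  \<open>h\<^sub>1 - \<alpha>\<close>, has to be matched with the limit from the disc.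

  In case (ii) the residue at \<alpha> is the product of \<open>L F\<close> at
  \<open>min x y\<close> and \<open>L R\<close> at \<open>max x y\<close>, taken at
  \<open>E = \<alpha>\<close>. If a factor vanished, \<open>F\<close> or \<open>R\<close> would be a
  multiple of \<open>u\<close>, while it tends to 0 together with \<open>1 / u\<close> at its end
  point; the product of the two would then be a nonzero constant with limit 0.\<close>

lemma einterval_Icc_subset:
  assumes "c \<in> einterval a b" "d \<in> einterval a b"
  shows "{c..d} \<subseteq> einterval a b"
  using assms by (auto simp: einterval_iff) (metis ereal_less_eq(3) order.strict_trans2, metis ereal_less_eq(3) order.strict_trans1)

lemma einterval_between:
  assumes "c \<in> einterval a b" "d \<in> einterval a b" "c \<le> x" "x \<le> d"
  shows "x \<in> einterval a b"
  using einterval_Icc_subset[OF assms(1,2)] assms(3,4) by auto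

lemma connected_einterval: "connected (einterval a b)"
  using einterval_between by (metis is_interval_1 is_interval_connected_1)

lemma einterval_less_ex:
  assumes "x \<in> einterval a b" shows "\<exists>c\<in>einterval a b. c < x"
proof -
  have "a < ereal x" "ereal x < b" using assms by (auto simp: einterval_iff)
  then obtain c where "c \<in> einterval a (ereal x)" using einterval_nonempty by blast
  then show ?thesis using \<open>ereal x < b\<close>
    by (intro bexI[of _ c]) (auto simp: einterval_iff intro: less_trans[of "ereal c" "ereal x"])
qed

lemma einterval_greater_ex:
  assumes "x \<in> einterval a b" shows "\<exists>c\<in>einterval a b. x < c"
proof -
  have "a < ereal x" "ereal x < b" using assms by (auto simp: einterval_iff)
  then obtain c where "c \<in> einterval (ereal x) b" using einterval_nonempty by blast
  then show ?thesis using \<open>a < ereal x\<close>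
    by (intro bexI[of _ c]) (auto simp: einterval_iff intro: less_trans[of _ "ereal x" "ereal c"])
qed

lemma compact_in_einterval:
  assumes "compact S" "S \<subseteq> einterval a b" "a < b"
  obtains c d where "c \<in> einterval a b" "d \<in> einterval a b" "c < d" "S \<subseteq> {c<..<d}"
proof -
  obtain x0 where x0: "x0 \<in> einterval a b" using einterval_nonempty[OF assms(3)] by blast
  \<comment> \<open>The extra point provides a minimum and a maximum when \<open>S\<close> is
    empty.\<close>
  let ?S = "insert x0 S"
  have S: "compact ?S" "?S \<noteq> {}" "?S \<subseteq> einterval a b" using assms x0 by auto
  obtain m where m: "m \<in> ?S" "\<And>x. x \<in> ?S \<Longrightarrow> m \<le> x" using compact_attains_inf[OF S(1,2)] by blast
  obtain M where M: "M \<in> ?S" "\<And>x. x \<in> ?S \<Longrightarrow> x \<le> M" using compact_attains_sup[OF S(1,2)] by blast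
  obtain c where c: "c \<in> einterval a b" "c < m" using einterval_less_ex[of m a b] m(1) S(3) by blast
  obtain d where d: "d \<in> einterval a b" "M < d" using einterval_greater_ex[of M a b] M(1) S(3) by blast
  show thesis
    by (rule that[OF c(1) d(1)]) (use c d m M in \<open>fastforce intro: less_le_trans le_less_trans\<close>)+
qed

lemma has_vector_derivative_cong_open:
  assumes "open S" "x \<in> S" "\<And>s. s \<in> S \<Longrightarrow> f s = g s"
  shows "(f has_vector_derivative D) (at x) \<longleftrightarrow> (g has_vector_derivative D) (at x)"
  by (metis assms has_vector_derivative_transform_within_open)

lemma vderivD: "f differentiable (at x) \<Longrightarrow> (f has_vector_derivative vderiv f x) (at x)"
  by (simp add: vderiv_def vector_derivative_works)

lemma vderivI: "(f has_vector_derivative D) (at x) \<Longrightarrow> vderiv f x = D"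
  by (simp add: vderiv_def vector_derivative_at)

lemma vderiv_cong_open:
  assumes "open S" "x \<in> S" "\<And>s. s \<in> S \<Longrightarrow> f s = g s"
  shows "vderiv f x = vderiv g x"
  unfolding vderiv_def vector_derivative_def
  using has_vector_derivative_cong_open[OF assms] by simp

lemma C2_onD:
  assumes "C2_on I f" "x \<in> I"
  shows "(f has_vector_derivative vderiv f x) (at x)"
    "(vderiv f has_vector_derivative vderiv (vderiv f) x) (at x)"
  using assms vderivD unfolding C2_on_def by blast+

lemma C2_onI:
  assumes I: "open I"
    and 1: "\<And>x. x \<in> I \<Longrightarrow> (f has_vector_derivative f' x) (at x)"
    and 2: "\<And>x. x \<in> I \<Longrightarrow> (f' has_vector_derivative f'' x) (at x)"
    and 3: "continuous_on I f''"
  shows "C2_on I f" "\<And>x. x \<in> I \<Longrightarrow> vderiv f x = f' x" "\<And>x. x \<in> I \<Longrightarrow> vderiv (vderiv f) x = f'' x"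
proof -
  show v1: "\<And>x. x \<in> I \<Longrightarrow> vderiv f x = f' x" using 1 vderivI by blast
  have d2: "\<And>x. x \<in> I \<Longrightarrow> (vderiv f has_vector_derivative f'' x) (at x)"
    using has_vector_derivative_cong_open[OF I, of _ "vderiv f" f'] v1 2 by blast
  then show v2: "\<And>x. x \<in> I \<Longrightarrow> vderiv (vderiv f) x = f'' x" using vderivI by blast
  show "C2_on I f"
    unfolding C2_on_def using 1 d2 3 v2
    by (auto intro: differentiableI_vector cong: continuous_on_cong)
qed

lemma has_vector_derivative_continuous_on:
  "(\<And>x. x \<in> I \<Longrightarrow> (f has_vector_derivative f' x) (at x)) \<Longrightarrow> continuous_on I f"
  by (meson continuous_at_imp_continuous_on has_vector_derivative_continuous)

lemma C2_on_continuous: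
  assumes "C2_on I f" shows "continuous_on I f" "continuous_on I (vderiv f)"
  using C2_onD[OF assms] has_vector_derivative_continuous_on by blast+

text \<open>A solution of \<open>-f'' + V f = E f + g\<close> together with its derivative.\<close>

definition schroedinger_sol ::
  "real set \<Rightarrow> (real \<Rightarrow> real) \<Rightarrow> complex \<Rightarrow> (real \<Rightarrow> complex) \<Rightarrow> (real \<Rightarrow> complex) \<Rightarrow> (real \<Rightarrow> complex) \<Rightarrow> bool" where
  "schroedinger_sol I V E g f f' \<longleftrightarrow>
     (\<forall>x\<in>I. (f has_vector_derivative f' x) (at x) \<and>
        (f' has_vector_derivative ((of_real (V x) - E) * f x - g x)) (at x))"

lemma schroedinger_sol_continuous:
  assumes "schroedinger_sol I V E g f f'"
  shows "continuous_on I f" "continuous_on I f'"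
  using assms unfolding schroedinger_sol_def
  by (auto intro!: has_vector_derivative_continuous_on)

lemma schroedinger_sol_C2:
  assumes "schroedinger_sol I V E g f f'" "open I" "continuous_on I V" "continuous_on I g"
  shows "C2_on I f" "\<And>x. x \<in> I \<Longrightarrow> vderiv f x = f' x"
    "\<And>x. x \<in> I \<Longrightarrow> schroedinger V f x = E * f x + g x"
proof -
  have c: "continuous_on I (\<lambda>x. (of_real (V x) - E) * f x - g x)"
    by (intro continuous_intros schroedinger_sol_continuous[OF assms(1)] assms)
  note * = C2_onI[OF assms(2), where f=f and f'=f', OF _ _ c]
  show "C2_on I f" by (rule *(1)) (use assms(1) in \<open>auto simp: schroedinger_sol_def\<close>)
  show "\<And>x. x \<in> I \<Longrightarrow> vderiv f x = f' x" by (rule *(2)) (use assms(1) in \<open>auto simp: schroedinger_sol_def\<close>)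
  have "\<And>x. x \<in> I \<Longrightarrow> vderiv (vderiv f) x = (of_real (V x) - E) * f x - g x"
    by (rule *(3)) (use assms(1) in \<open>auto simp: schroedinger_sol_def\<close>)
  then show "\<And>x. x \<in> I \<Longrightarrow> schroedinger V f x = E * f x + g x"
    by (simp add: schroedinger_def scaleR_conv_of_real algebra_simps)
qed

lemma schroedinger_solI:
  assumes "C2_on I f" "\<And>x. x \<in> I \<Longrightarrow> schroedinger V f x = E * f x + g x"
  shows "schroedinger_sol I V E g f (vderiv f)"
proof -
  have "vderiv (vderiv f) x = (of_real (V x) - E) * f x - g x" if "x \<in> I" for x
    using assms(2)[OF that] by (simp add: schroedinger_def scaleR_conv_of_real algebra_simps)
  then show ?thesis
    using C2_onD[OF assms(1)] unfolding schroedinger_sol_def by metis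
qed

lemma schroedinger_sol_subset:
  "schroedinger_sol I V E g f f' \<Longrightarrow> J \<subseteq> I \<Longrightarrow> schroedinger_sol J V E g f f'"
  by (auto simp: schroedinger_sol_def)

lemma schroedinger_sol_cong:
  assumes "\<And>x. x \<in> I \<Longrightarrow> g x = k x"
  shows "schroedinger_sol I V E g f f' \<longleftrightarrow> schroedinger_sol I V E k f f'"
  using assms by (simp add: schroedinger_sol_def)

lemma schroedinger_sol_lincomb:
  assumes "schroedinger_sol I V E g1 f1 f1'" "schroedinger_sol I V E g2 f2 f2'"
  shows "schroedinger_sol I V E (\<lambda>x. c1 * g1 x + c2 * g2 x) (\<lambda>x. c1 * f1 x + c2 * f2 x) (\<lambda>x. c1 * f1' x + c2 * f2' x)"
  using assms unfolding schroedinger_sol_def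
  by (auto intro!: derivative_eq_intros simp: algebra_simps)

abbreviation wronskian :: "(real \<Rightarrow> complex) \<Rightarrow> (real \<Rightarrow> complex) \<Rightarrow> (real \<Rightarrow> complex) \<Rightarrow> (real \<Rightarrow> complex) \<Rightarrow> real \<Rightarrow> complex" where
  "wronskian f f' g g' x \<equiv> f x * g' x - f' x * g x"

lemma wronskian_derivative:
  assumes "schroedinger_sol I V E k1 f f'" "schroedinger_sol I V E k2 g g'" "x \<in> I"
  shows "(wronskian f f' g g' has_vector_derivative (k1 x * g x - f x * k2 x)) (at x)"
  using assms unfolding schroedinger_sol_def
  by (auto intro!: derivative_eq_intros simp: algebra_simps)

lemma wronskian_constant:
  assumes "schroedinger_sol (einterval a b) V E (\<lambda>_. 0) f f'" "schroedinger_sol (einterval a b) V E (\<lambda>_. 0) g g'"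
    and "x \<in> einterval a b" "y \<in> einterval a b"
  shows "wronskian f f' g g' x = wronskian f f' g g' y"
proof (rule has_derivative_zero_unique_connected[of "einterval a b" "wronskian f f' g g'"])
  show "connected (einterval a b)" by (rule connected_einterval)
  fix z assume "z \<in> einterval a b"
  then show "(wronskian f f' g g' has_derivative (\<lambda>h. 0)) (at z)"
    using wronskian_derivative[OF assms(1,2)] by (simp add: has_vector_derivative_def)
qed (use assms in auto)

section \<open>Existence of solutions of linear second order equations\<close>

text \<open>The bounds \<open>N\<close> make the series of derivatives converge uniformly, and the
  bounds \<open>M\<close> make the series itself converge at one point; this is what termwise
  differentiation of the Picard series requires.\<close>

lemma has_vector_derivative_suminf:
  fixes f :: "nat \<Rightarrow> real \<Rightarrow> 'a::banach"
  assumes f: "\<And>n x. x \<in> {c<..<d} \<Longrightarrow> (f n has_vector_derivative f' n x) (at x)"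
    and M: "\<And>n x. x \<in> {c<..<d} \<Longrightarrow> norm (f n x) \<le> M n" "summable M"
    and N: "\<And>n x. x \<in> {c<..<d} \<Longrightarrow> norm (f' n x) \<le> N n" "summable N"
    and x: "x \<in> {c<..<d}"
  shows "((\<lambda>x. \<Sum>n. f n x) has_vector_derivative (\<Sum>n. f' n x)) (at x)"
proof -
  have lim: "uniform_limit {c<..<d} (\<lambda>n x. \<Sum>i<n. f' i x) (\<lambda>x. \<Sum>i. f' i x) sequentially"
    by (rule Weierstrass_m_test[OF N])
  have "\<exists>g. \<forall>x\<in>{c<..<d}. (\<lambda>n. f n x) sums g x \<and>
         (g has_derivative (\<lambda>h. h *\<^sub>R (\<Sum>n. f' n x))) (at x within {c<..<d})"
  proof (rule has_derivative_series[where f' = "\<lambda>n x h. h *\<^sub>R f' n x"])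
    show "(f n has_derivative (\<lambda>h. h *\<^sub>R f' n x)) (at x within {c<..<d})" if "x \<in> {c<..<d}" for n x
      using f[OF that] by (auto simp: has_vector_derivative_def intro: has_derivative_at_withinI)
    show "\<forall>\<^sub>F n in sequentially. \<forall>x\<in>{c<..<d}. \<forall>h.
        norm ((\<Sum>i<n. h *\<^sub>R f' i x) - h *\<^sub>R (\<Sum>n. f' n x)) \<le> e * norm h" if "e > 0" for e
    proof -
      have "\<forall>\<^sub>F n in sequentially. \<forall>x\<in>{c<..<d}. dist (\<Sum>i<n. f' i x) (\<Sum>n. f' n x) < e"
        using lim that by (simp add: uniform_limit_iff)
      then show ?thesis
      proof (eventually_elim, intro ballI allI)
        fix n x h assume "\<forall>x\<in>{c<..<d}. dist (\<Sum>i<n. f' i x) (\<Sum>n. f' n x) < e" "x \<in> {c<..<d}"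
        then have "norm ((\<Sum>i<n. f' i x) - (\<Sum>n. f' n x)) \<le> e" by (auto simp: dist_norm intro: less_imp_le)
        then have "\<bar>h\<bar> * norm ((\<Sum>i<n. f' i x) - (\<Sum>n. f' n x)) \<le> e * \<bar>h\<bar>"
          by (metis abs_ge_zero mult.commute mult_left_mono)
        then show "norm ((\<Sum>i<n. h *\<^sub>R f' i x) - h *\<^sub>R (\<Sum>n. f' n x)) \<le> e * norm h"
          by (simp flip: scaleR_sum_right scaleR_diff_right)
      qed
    qed
    show "(\<lambda>n. f n x) sums (\<Sum>n. f n x)"
      by (rule summable_sums, rule summable_comparison_test'[OF M(2)]) (use M(1) x in auto)
  qed (use x in auto)
  then obtain g where g: "\<And>x. x \<in> {c<..<d} \<Longrightarrow> (\<lambda>n. f n x) sums g x"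
    "(g has_derivative (\<lambda>h. h *\<^sub>R (\<Sum>n. f' n x))) (at x within {c<..<d})" using x by blast
  have "(g has_vector_derivative (\<Sum>n. f' n x)) (at x)"
    using g(2) x at_within_open[of x "{c<..<d}"] by (auto simp: has_vector_derivative_def)
  moreover have "g s = (\<Sum>n. f n s)" if "s \<in> {c<..<d}" for s using g(1)[OF that] sums_unique by blast
  ultimately show ?thesis
    using has_vector_derivative_cong_open[of "{c<..<d}" x g] x by auto
qed

text \<open>One integration turns a bound of order \<open>n\<close> into one of order
  \<open>Suc n\<close>; iterated, this produces the factorials in the Picard series. The two sides
  of \<open>x0\<close> are separate cases because the comparison function has to be differentiable
  without an absolute value.\<close>

lemma antiderivative_monomial_bound:
  fixes F :: "real \<Rightarrow> 'a::real_normed_vector"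
  assumes F: "\<And>x. x \<in> {c..d} \<Longrightarrow> (F has_vector_derivative f x) (at x)"
    and f: "\<And>x. x \<in> {c..d} \<Longrightarrow> norm (f x) \<le> K * \<bar>x - x0\<bar> ^ n / fact n"
    and x0: "x0 \<in> {c..d}" "F x0 = 0" and x: "x \<in> {c..d}"
  shows "norm (F x) \<le> K * \<bar>x - x0\<bar> ^ Suc n / fact (Suc n)"
proof -
  have cF: "continuous_on {c..d} F" using F by (rule has_vector_derivative_continuous_on)
  consider "x = x0" | "x0 < x" | "x < x0" by linarith
  then show ?thesis
  proof cases
    case 1 then show ?thesis using x0 by simp
  next
    case 2
    have "norm (F x - F x0) \<le> K * (x - x0) ^ Suc n / fact (Suc n) - K * (x0 - x0) ^ Suc n / fact (Suc n)"
    proof (rule differentiable_bound_general[OF 2, where \<phi>' = "\<lambda>x. K * (x - x0) ^ n / fact n"])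
      show "continuous_on {x0..x} F" using cF x x0 by (auto intro: continuous_on_subset)
      show "continuous_on {x0..x} (\<lambda>x. K * (x - x0) ^ Suc n / fact (Suc n))" by (intro continuous_intros) auto
      fix s assume "x0 < s" "s < x"
      then show "(F has_vector_derivative f s) (at s)" "norm (f s) \<le> K * (s - x0) ^ n / fact n"
        using F[of s] f[of s] x x0 by auto
      have "((\<lambda>x. K * (x - x0) ^ Suc n / fact (Suc n)) has_real_derivative K * (s - x0) ^ n / fact n) (at s)"
        by (auto intro!: derivative_eq_intros simp: fact_Suc divide_simps simp del: power_Suc of_nat_Suc)
      then show "((\<lambda>x. K * (x - x0) ^ Suc n / fact (Suc n)) has_vector_derivative K * (s - x0) ^ n / fact n) (at s)"
        by (simp add: has_real_derivative_iff_has_vector_derivative)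
    qed
    then show ?thesis using 2 x0 by simp
  next
    case 3
    \<comment> \<open>To the left of \<open>x0\<close> the power decreases, so its negative serves
      as the comparison function.\<close>
    have "norm (F x0 - F x) \<le> - (K * (x0 - x0) ^ Suc n / fact (Suc n)) - - (K * (x0 - x) ^ Suc n / fact (Suc n))"
    proof (rule differentiable_bound_general[OF 3, where \<phi>' = "\<lambda>x. K * (x0 - x) ^ n / fact n"])
      show "continuous_on {x..x0} F" using cF x x0 by (auto intro: continuous_on_subset)
      show "continuous_on {x..x0} (\<lambda>x. - (K * (x0 - x) ^ Suc n / fact (Suc n)))" by (intro continuous_intros) auto
      fix s assume "x < s" "s < x0"
      then show "(F has_vector_derivative f s) (at s)" "norm (f s) \<le> K * (x0 - s) ^ n / fact n"
        using F[of s] f[of s] x x0 by auto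
      have "((\<lambda>x. - (K * (x0 - x) ^ Suc n / fact (Suc n))) has_real_derivative K * (x0 - s) ^ n / fact n) (at s)"
        by (auto intro!: derivative_eq_intros simp: fact_Suc divide_simps simp del: power_Suc of_nat_Suc)
      then show "((\<lambda>x. - (K * (x0 - x) ^ Suc n / fact (Suc n))) has_vector_derivative K * (x0 - s) ^ n / fact n) (at s)"
        by (simp add: has_real_derivative_iff_has_vector_derivative)
    qed
    then show ?thesis using 3 x0 by simp
  qed
qed

text \<open>Picard iteration with two integrations per step: \<open>T (Suc n)\<close> has second
  derivative \<open>q * T n\<close>, and \<open>T 0\<close> is the affine function with the initial
  data. Since \<open>q\<close> is bounded on each compact subinterval, the series converges on the
  whole interval and solutions need not be continued from piece to piece.\<close>

lemma linear_ode2_exists: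
  fixes q :: "real \<Rightarrow> complex" and A B :: complex
  assumes q: "continuous_on (einterval a b) q" and x0: "x0 \<in> einterval a b"
  obtains f f' where "f x0 = A" "f' x0 = B"
    "\<And>x. x \<in> einterval a b \<Longrightarrow> (f has_vector_derivative f' x) (at x)"
    "\<And>x. x \<in> einterval a b \<Longrightarrow> (f' has_vector_derivative q x * f x) (at x)"
proof -
  let ?I = "einterval a b"
  have ab: "a < b" using x0 by (auto simp: einterval_iff intro: less_trans)
  \<comment> \<open>Choosing one antiderivative on all of \<open>?I\<close> makes the terms
    independent of the compact subinterval on which convergence is estimated below.\<close>
  define P :: "(real \<Rightarrow> complex) \<Rightarrow> real \<Rightarrow> complex"
    where "P g = (SOME G. (\<forall>x\<in>?I. (G has_vector_derivative g x) (at x)) \<and> G x0 = 0)" for g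
  have P: "(\<forall>x\<in>?I. (P g has_vector_derivative g x) (at x)) \<and> P g x0 = 0" if "continuous_on ?I g" for g
  proof -
    have "\<exists>G. \<forall>x. a < ereal x \<longrightarrow> ereal x < b \<longrightarrow> (G has_vector_derivative g x) (at x)"
      by (rule einterval_antiderivative[OF ab])
        (use that in \<open>auto simp: continuous_on_eq_continuous_at einterval_iff\<close>)
    then obtain G where G: "\<And>x. x \<in> ?I \<Longrightarrow> (G has_vector_derivative g x) (at x)" by (auto simp: einterval_iff)
    have "(\<forall>x\<in>?I. ((\<lambda>x. G x - G x0) has_vector_derivative g x) (at x)) \<and> G x0 - G x0 = 0"
      using G by (auto intro!: derivative_eq_intros)
    then show ?thesis unfolding P_def by (rule someI[where P="\<lambda>G. (\<forall>x\<in>?I. (G has_vector_derivative g x) (at x)) \<and> G x0 = 0"])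
  qed
  \<comment> \<open>the terms of the Picard series, with their first two derivatives \<open>S n\<close> and \<open>R n\<close>\<close>
  define T where "T = rec_nat (\<lambda>x. A + B * of_real (x - x0)) (\<lambda>_ t. P (P (\<lambda>x. q x * t x)))"
  define S where "S n = (case n of 0 \<Rightarrow> (\<lambda>x. B) | Suc n \<Rightarrow> P (\<lambda>x. q x * T n x))" for n
  define R where "R n = (case n of 0 \<Rightarrow> (\<lambda>x. 0) | Suc n \<Rightarrow> (\<lambda>x. q x * T n x))" for n
  have T0: "T 0 = (\<lambda>x. A + B * of_real (x - x0))" and TS: "\<And>n. T (Suc n) = P (S (Suc n))"
    by (simp_all add: T_def S_def)
  have S0: "S 0 = (\<lambda>x. B)" and SS: "\<And>n. S (Suc n) = P (\<lambda>x. q x * T n x)"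
    by (simp_all add: S_def)
  have R0: "R 0 = (\<lambda>x. 0)" and RS: "\<And>n. R (Suc n) = (\<lambda>x. q x * T n x)"
    by (simp_all add: R_def)
  have contP: "continuous_on ?I (P g)" if "continuous_on ?I g" for g
    using P[OF that] has_vector_derivative_continuous_on by blast
  have contT: "continuous_on ?I (T n)" for n
  proof (induction n)
    case 0 then show ?case unfolding T0 by (intro continuous_intros)
  next
    case (Suc n)
    then show ?case unfolding TS SS by (intro contP continuous_intros q)
  qed
  have contS: "continuous_on ?I (S n)" for n
    by (cases n) (auto simp: S0 SS intro!: contP continuous_intros q contT)
  have dT: "(T n has_vector_derivative S n x) (at x)" if "x \<in> ?I" for n x
  proof (cases n)
    case 0 then show ?thesis unfolding 0 T0 S0
      by (auto intro!: derivative_eq_intros simp: has_vector_derivative_def scaleR_conv_of_real)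
  next
    case (Suc m) then show ?thesis using P[OF contS] that by (simp add: TS)
  qed
  have dS: "(S n has_vector_derivative R n x) (at x)" if "x \<in> ?I" for n x
  proof (cases n)
    case 0 then show ?thesis by (simp add: S0 R0)
  next
    case (Suc m)
    have "continuous_on ?I (\<lambda>x. q x * T m x)" by (intro continuous_intros q contT)
    from P[OF this] that show ?thesis by (simp add: Suc SS RS)
  qed
  have TS0: "T (Suc n) x0 = 0" "S (Suc n) x0 = 0" for n
    using P[OF contS[of "Suc n"]] P[of "\<lambda>x. q x * T n x"] contT q by (auto simp: TS SS continuous_on_mult)
  have main: "((\<lambda>x. \<Sum>n. T n x) has_vector_derivative (\<Sum>n. S n x)) (at x) \<and>
     ((\<lambda>x. \<Sum>n. S n x) has_vector_derivative q x * (\<Sum>n. T n x)) (at x)" if x: "x \<in> ?I" for x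
  proof -
    have "compact {x, x0}" "{x, x0} \<subseteq> ?I" using x x0 by auto
    then obtain c d where cd: "c \<in> ?I" "d \<in> ?I" "c < d" "{x, x0} \<subseteq> {c<..<d}"
      using compact_in_einterval ab by metis
    have sub: "{c..d} \<subseteq> ?I" using cd einterval_Icc_subset by blast
    have "compact (q ` {c..d})" using q sub by (intro compact_continuous_image) (auto intro: continuous_on_subset)
    then obtain M where "\<forall>z\<in>q ` {c..d}. norm z \<le> M" using compact_imp_bounded bounded_iff by metis
    then have M: "\<And>z. z \<in> {c..d} \<Longrightarrow> norm (q z) \<le> M" by auto
    have M0: "0 \<le> M" using M[of c] cd(3) norm_ge_zero[of "q c"] by (meson atLeastAtMost_iff less_imp_le order_refl order_trans)
    define l where "l = d - c"
    have l0: "0 < l" using cd by (simp add: l_def)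
    \<comment> \<open>\<open>K\<close> bounds the affine start \<open>T 0\<close> on
      \<open>{c..d}\<close>.\<close>
    define K where "K = norm A + norm B * l"
    have K0: "0 \<le> K" using l0 by (simp add: K_def)
    have x0in: "x0 \<in> {c..d}" using cd by auto
    have leI: "\<bar>z - x0\<bar> \<le> l" if "z \<in> {c..d}" for z using that x0in by (auto simp: l_def abs_if)
    \<comment> \<open>Each step costs a factor \<open>M\<close> and gains two powers of the
      distance, one in passing to \<open>S\<close> and one in passing to \<open>T\<close>; hence
      \<open>fact (2 * n)\<close>.\<close>
    have bound: "norm (T n z) \<le> K * M ^ n * \<bar>z - x0\<bar> ^ (2 * n) / fact (2 * n) \<and>
        norm (S (Suc n) z) \<le> K * M ^ Suc n * \<bar>z - x0\<bar> ^ Suc (2 * n) / fact (Suc (2 * n))"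
      if "z \<in> {c..d}" for n z using that
    proof (induction n arbitrary: z)
      case 0
      have T: "norm (T 0 z) \<le> K" if "z \<in> {c..d}" for z
      proof -
        have "norm (T 0 z) \<le> norm A + norm (B * of_real (z - x0))" unfolding T0 by (rule norm_triangle_ineq)
        also have "norm (B * of_real (z - x0)) = norm B * \<bar>z - x0\<bar>" by (simp only: norm_mult norm_of_real)
        also have "\<dots> \<le> norm B * l" using leI[OF that] by (intro mult_left_mono) auto
        finally show ?thesis by (simp add: K_def)
      qed
      have "norm (S (Suc 0) z) \<le> K * M * \<bar>z - x0\<bar> ^ Suc 0 / fact (Suc 0)"
      proof (rule antiderivative_monomial_bound[where F="S (Suc 0)" and f="R (Suc 0)", OF _ _ x0in TS0(2) 0])
        fix s assume s: "s \<in> {c..d}"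
        show "(S (Suc 0) has_vector_derivative R (Suc 0) s) (at s)" using dS s sub by blast
        have "norm (q s) * norm (T 0 s) \<le> M * K" using M[OF s] T[OF s] M0 by (intro mult_mono) auto
        then show "norm (R (Suc 0) s) \<le> K * M * \<bar>s - x0\<bar> ^ 0 / fact 0" by (simp add: RS norm_mult mult.commute)
      qed
      then show ?case using T[OF 0] by simp
    next
      case (Suc n)
      have T: "norm (T (Suc n) z) \<le> K * M ^ Suc n * \<bar>z - x0\<bar> ^ Suc (Suc (2 * n)) / fact (Suc (Suc (2 * n)))"
        if "z \<in> {c..d}" for z
        by (rule antiderivative_monomial_bound[where F="T (Suc n)" and f="S (Suc n)", OF _ _ x0in TS0(1) that])
          (use dT sub Suc.IH in blast)+
      have "norm (S (Suc (Suc n)) z) \<le> K * M ^ Suc (Suc n) * \<bar>z - x0\<bar> ^ Suc (Suc (Suc (2 * n))) / fact (Suc (Suc (Suc (2 * n))))"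
      proof (rule antiderivative_monomial_bound[where F="S (Suc (Suc n))" and f="R (Suc (Suc n))", OF _ _ x0in TS0(2) Suc.prems])
        fix s assume s: "s \<in> {c..d}"
        show "(S (Suc (Suc n)) has_vector_derivative R (Suc (Suc n)) s) (at s)" using dS s sub by blast
        have "norm (q s) * norm (T (Suc n) s) \<le> M * (K * M ^ Suc n * \<bar>s - x0\<bar> ^ Suc (Suc (2 * n)) / fact (Suc (Suc (2 * n))))"
          using M[OF s] T[OF s] M0 by (intro mult_mono) auto
        then show "norm (R (Suc (Suc n)) s) \<le> K * M ^ Suc (Suc n) * \<bar>s - x0\<bar> ^ Suc (Suc (2 * n)) / fact (Suc (Suc (2 * n)))"
          by (simp add: RS norm_mult mult_ac)
      qed
      then show ?case using T[OF Suc.prems] by simp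
    qed
    define Z where "Z n = (M * l\<^sup>2) ^ n / fact n" for n
    have Zs: "summable Z" unfolding Z_def using summable_exp[of "M * l\<^sup>2"] by (simp add: divide_inverse mult.commute)
    \<comment> \<open>Weakening \<open>fact (2 * n)\<close> to \<open>fact n\<close> is affordable:
      the exponential series of \<open>M * l\<^sup>2\<close> remains as a majorant.\<close>
    have fact_le: "(fact n :: real) \<le> fact (2 * n)" "(fact n :: real) \<le> fact (Suc (2 * n))" for n
      by (rule fact_mono; simp)+
    have Tb: "norm (T n z) \<le> K * Z n" if "z \<in> {c..d}" for n z
    proof -
      have "\<bar>z - x0\<bar> ^ (2 * n) \<le> l ^ (2 * n)" using leI[OF that] by (intro power_mono) auto
      then have "K * M ^ n * \<bar>z - x0\<bar> ^ (2 * n) / fact (2 * n) \<le> K * M ^ n * l ^ (2 * n) / fact n"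
        using K0 M0 l0 fact_le(1)[of n] by (intro frac_le mult_left_mono) auto
      also have "\<dots> = K * Z n" by (simp add: Z_def power_mult_distrib power_mult)
      finally show ?thesis using bound[OF that, of n] by linarith
    qed
    have Sb: "norm (S (Suc n) z) \<le> K * M * l * Z n" if "z \<in> {c..d}" for n z
    proof -
      have "\<bar>z - x0\<bar> ^ Suc (2 * n) \<le> l ^ Suc (2 * n)" using leI[OF that] by (intro power_mono) auto
      then have "K * M ^ Suc n * \<bar>z - x0\<bar> ^ Suc (2 * n) / fact (Suc (2 * n)) \<le> K * M ^ Suc n * l ^ Suc (2 * n) / fact n"
        using K0 M0 l0 fact_le(2)[of n] by (intro frac_le mult_left_mono) auto
      also have "\<dots> = K * M * l * Z n" by (simp add: Z_def power_mult_distrib power_mult)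
      finally show ?thesis using bound[OF that, of n] by linarith
    qed
    define NS where "NS n = (case n of 0 \<Rightarrow> norm B | Suc n \<Rightarrow> K * M * l * Z n)" for n
    define NR where "NR n = (case n of 0 \<Rightarrow> 0 | Suc n \<Rightarrow> M * (K * Z n))" for n
    have sT: "summable (\<lambda>n. K * Z n)" using Zs by (rule summable_mult)
    have sS: "summable NS"
      using summable_mult[OF Zs, of "K * M * l"] summable_Suc_iff[of NS] by (simp add: NS_def)
    have sR: "summable NR"
      using summable_mult[OF sT, of M] summable_Suc_iff[of NR] by (simp add: NR_def)
    have S': "norm (S n z) \<le> NS n" if "z \<in> {c..d}" for n z
      using Sb[OF that] by (cases n) (auto simp: NS_def S0)
    have R': "norm (R n z) \<le> NR n" if "z \<in> {c..d}" for n z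
    proof (cases n)
      case (Suc m)
      have "norm (q z) * norm (T m z) \<le> M * (K * Z m)"
        using M[OF that] Tb[OF that] M0 by (intro mult_mono) auto
      then show ?thesis by (simp add: Suc NR_def RS norm_mult)
    qed (simp add: R0 NR_def)
    have xin: "x \<in> {c<..<d}" using cd by auto
    have inI: "z \<in> {c<..<d} \<Longrightarrow> z \<in> ?I" and incc: "z \<in> {c<..<d} \<Longrightarrow> z \<in> {c..d}" for z using sub by auto
    have 1: "((\<lambda>x. \<Sum>n. T n x) has_vector_derivative (\<Sum>n. S n x)) (at x)"
      by (rule has_vector_derivative_suminf[OF dT[OF inI] Tb[OF incc] sT S'[OF incc] sS xin])
    have 2: "((\<lambda>x. \<Sum>n. S n x) has_vector_derivative (\<Sum>n. R n x)) (at x)"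
      by (rule has_vector_derivative_suminf[OF dS[OF inI] S'[OF incc] sS R'[OF incc] sR xin])
    have sTx: "summable (\<lambda>n. T n x)"
      by (rule summable_comparison_test'[OF sT]) (use Tb incc[OF xin] in blast)
    have "summable (\<lambda>n. R n x)"
      by (rule summable_comparison_test'[OF sR]) (use R' incc[OF xin] in blast)
    then have "(\<Sum>n. R n x) = (\<Sum>n. R (Suc n) x)" using suminf_split_head[of "\<lambda>n. R n x"] by (simp add: R0)
    also have "\<dots> = q x * (\<Sum>n. T n x)" using suminf_mult[OF sTx] by (simp add: RS)
    finally show ?thesis using 1 2 by simp
  qed
  have fin: "(\<Sum>n. T n x0) = A" "(\<Sum>n. S n x0) = B"
    using suminf_finite[of "{0}" "\<lambda>n. T n x0"] suminf_finite[of "{0}" "\<lambda>n. S n x0"] TS0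
    by (metis T0 finite.emptyI finite.insertI insertI1 not0_implies_Suc sum.empty sum.insert_if add.right_neutral empty_iff
        diff_self of_real_0 mult_zero_right, metis S0 finite.emptyI finite.insertI insertI1 not0_implies_Suc sum.empty sum.insert_if add.right_neutral empty_iff)
  show thesis
    by (rule that[of "\<lambda>x. \<Sum>n. T n x" "\<lambda>x. \<Sum>n. S n x"]) (use main fin in blast)+
qed

section \<open>Square integrable functions\<close>

lemma continuous_on_set_borel_measurable:
  fixes f :: "real \<Rightarrow> 'a::real_normed_vector"
  assumes "continuous_on I f" "I \<in> sets borel"
  shows "set_borel_measurable lborel I f"
  unfolding set_borel_measurable_def
  using borel_measurable_continuous_on_indicator[OF assms(2,1)] by simp

lemma continuous_on_Icc_set_integrable:
  fixes f :: "real \<Rightarrow> 'a::euclidean_space"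
  assumes "continuous_on {c..d} f"
  shows "set_integrable lborel {c..d} f" "(LINT x:{c..d}|lborel. f x) = integral {c..d} f"
proof -
  show 1: "set_integrable lborel {c..d} f"
    unfolding set_integrable_def using borel_integrable_compact[OF _ assms] by (simp add: scaleR_conv_of_real)
  show "(LINT x:{c..d}|lborel. f x) = integral {c..d} f"
    by (rule set_borel_integral_eq_integral(2)[OF 1])
qed

lemma set_lebesgue_integral_support:
  assumes "A \<subseteq> B" "\<And>x. x \<in> B \<Longrightarrow> x \<notin> A \<Longrightarrow> f x = 0"
  shows "set_lebesgue_integral M B f = set_lebesgue_integral M A f"
  unfolding set_lebesgue_integral_def
  by (rule Bochner_Integration.integral_cong) (use assms in \<open>auto simp: indicator_def\<close>)

lemma set_integrable_support:
  assumes "A \<subseteq> B" "\<And>x. x \<in> B \<Longrightarrow> x \<notin> A \<Longrightarrow> f x = 0"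
  shows "set_integrable M B f \<longleftrightarrow> set_integrable M A f"
  unfolding set_integrable_def
  by (rule Bochner_Integration.integrable_cong) (use assms in \<open>auto simp: indicator_def\<close>)

lemma L2_measurable: "f \<in> L2 I \<Longrightarrow> set_borel_measurable lborel I f"
  and L2_integrable: "f \<in> L2 I \<Longrightarrow> set_integrable lborel I (\<lambda>x. (cmod (f x))\<^sup>2)"
  by (simp_all add: L2_def)

lemma L2_cong:
  assumes "\<And>x. x \<in> I \<Longrightarrow> f x = g x"
  shows "f \<in> L2 I \<longleftrightarrow> g \<in> L2 I"
proof -
  have "(\<lambda>x. indicator I x *\<^sub>R f x) = (\<lambda>x. indicator I x *\<^sub>R g x)"
    "(\<lambda>x. indicator I x *\<^sub>R (cmod (f x))\<^sup>2) = (\<lambda>x. indicator I x *\<^sub>R (cmod (g x))\<^sup>2)"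
    using assms by (auto simp: indicator_def fun_eq_iff)
  then show ?thesis by (simp add: L2_def set_borel_measurable_def set_integrable_def)
qed

lemma L2_subset:
  assumes "f \<in> L2 I" "J \<subseteq> I" "J \<in> sets borel"
  shows "f \<in> L2 J"
  using assms set_integrable_subset[of lborel I _ J] set_borel_measurable_subset[of lborel I f J]
  by (auto simp: L2_def)

lemma L2_lincomb:
  assumes "f \<in> L2 I" "g \<in> L2 I"
  shows "(\<lambda>x. c * f x + d * g x) \<in> L2 I"
    "(LINT x:I|lborel. (cmod (c * f x + d * g x))\<^sup>2) \<le>
      2 * (cmod c)\<^sup>2 * (LINT x:I|lborel. (cmod (f x))\<^sup>2) + 2 * (cmod d)\<^sup>2 * (LINT x:I|lborel. (cmod (g x))\<^sup>2)"
proof -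
  have m: "set_borel_measurable lborel I (\<lambda>x. c * f x + d * g x)"
  proof -
    have "(\<lambda>x. c * (indicator I x *\<^sub>R f x) + d * (indicator I x *\<^sub>R g x)) \<in> borel_measurable lborel"
      using L2_measurable[OF assms(1)] L2_measurable[OF assms(2)] unfolding set_borel_measurable_def by measurable
    then show ?thesis unfolding set_borel_measurable_def by (simp add: algebra_simps)
  qed
  then have m2: "set_borel_measurable lborel I (\<lambda>x. (cmod (c * f x + d * g x))\<^sup>2)"
  proof -
    have "(\<lambda>x. (cmod (indicator I x *\<^sub>R (c * f x + d * g x)))\<^sup>2) \<in> borel_measurable lborel"
      using m unfolding set_borel_measurable_def by measurable
    moreover have "(\<lambda>x. (cmod (indicator I x *\<^sub>R (c * f x + d * g x)))\<^sup>2) = (\<lambda>x. indicator I x *\<^sub>R (cmod (c * f x + d * g x))\<^sup>2)"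
      by (auto simp: indicator_def)
    ultimately show ?thesis unfolding set_borel_measurable_def by simp
  qed
  have le: "(cmod (c * f x + d * g x))\<^sup>2 \<le> 2 * (cmod c)\<^sup>2 * (cmod (f x))\<^sup>2 + 2 * (cmod d)\<^sup>2 * (cmod (g x))\<^sup>2" for x
  proof -
    have "(cmod (c * f x + d * g x))\<^sup>2 \<le> (cmod (c * f x) + cmod (d * g x))\<^sup>2"
      by (intro power_mono norm_triangle_ineq) auto
    also have "\<dots> \<le> 2 * (cmod (c * f x))\<^sup>2 + 2 * (cmod (d * g x))\<^sup>2"
      using sum_squares_bound[of "cmod (c * f x)" "cmod (d * g x)"] by (simp add: power2_sum)
    finally show ?thesis by (simp add: norm_mult power_mult_distrib)
  qed
  have int: "set_integrable lborel I (\<lambda>x. 2 * (cmod c)\<^sup>2 * (cmod (f x))\<^sup>2 + 2 * (cmod d)\<^sup>2 * (cmod (g x))\<^sup>2)"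
    using assms by (intro set_integral_add set_integrable_mult_right) (auto simp: L2_def)
  have int2: "set_integrable lborel I (\<lambda>x. (cmod (c * f x + d * g x))\<^sup>2)"
  proof (rule set_integrable_bound[OF int m2], intro AE_I2 impI)
    fix x show "norm ((cmod (c * f x + d * g x))\<^sup>2) \<le> norm (2 * (cmod c)\<^sup>2 * (cmod (f x))\<^sup>2 + 2 * (cmod d)\<^sup>2 * (cmod (g x))\<^sup>2)"
      using le[of x] unfolding real_norm_def abs_power2 by linarith
  qed
  then show "(\<lambda>x. c * f x + d * g x) \<in> L2 I" using m by (simp add: L2_def)
  have "(LINT x:I|lborel. (cmod (c * f x + d * g x))\<^sup>2) \<le> (LINT x:I|lborel. 2 * (cmod c)\<^sup>2 * (cmod (f x))\<^sup>2 + 2 * (cmod d)\<^sup>2 * (cmod (g x))\<^sup>2)"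
    by (rule set_integral_mono[OF int2 int]) (rule le)
  also have "\<dots> = 2 * (cmod c)\<^sup>2 * (LINT x:I|lborel. (cmod (f x))\<^sup>2) + 2 * (cmod d)\<^sup>2 * (LINT x:I|lborel. (cmod (g x))\<^sup>2)"
    using assms by (subst set_integral_add) (auto simp: L2_def)
  finally show "(LINT x:I|lborel. (cmod (c * f x + d * g x))\<^sup>2) \<le>
      2 * (cmod c)\<^sup>2 * (LINT x:I|lborel. (cmod (f x))\<^sup>2) + 2 * (cmod d)\<^sup>2 * (LINT x:I|lborel. (cmod (g x))\<^sup>2)" .
qed

lemma L2_scale: "f \<in> L2 I \<Longrightarrow> (\<lambda>x. c * f x) \<in> L2 I"
  using L2_lincomb(1)[of f I f c 0] by simp

lemma L2_integral_nonneg: "0 \<le> (LINT x:I|lborel. (cmod (f x))\<^sup>2)"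
  unfolding set_lebesgue_integral_def by (rule Bochner_Integration.integral_nonneg) auto

lemma L2_norm_nonneg: "0 \<le> L2_norm I f"
  by (simp add: L2_norm_def L2_integral_nonneg)

lemma L2_norm_sq: "(L2_norm I f)\<^sup>2 = (LINT x:I|lborel. (cmod (f x))\<^sup>2)"
  by (simp add: L2_norm_def L2_integral_nonneg)

lemma L2_norm_cong: "(\<And>x. x \<in> I \<Longrightarrow> f x = g x) \<Longrightarrow> L2_norm I f = L2_norm I g"
  unfolding L2_norm_def set_lebesgue_integral_def
  by (auto intro!: arg_cong[where f=sqrt] Bochner_Integration.integral_cong simp: indicator_def)

lemma L2_norm_scale: "L2_norm I (\<lambda>x. c * f x) = cmod c * L2_norm I f"
  by (simp add: L2_norm_def norm_mult power_mult_distrib real_sqrt_mult)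

lemma L2_norm_zero: "L2_norm I (\<lambda>x. 0) = 0"
  by (simp add: L2_norm_def)

text \<open>The factor 2 spares us Minkowski's inequality.\<close>

lemma L2_norm_lincomb:
  assumes "f \<in> L2 I" "g \<in> L2 I"
  shows "L2_norm I (\<lambda>x. c * f x + d * g x) \<le> 2 * (cmod c * L2_norm I f + cmod d * L2_norm I g)"
proof (rule power2_le_imp_le)
  have "0 \<le> cmod c * L2_norm I f * (cmod d * L2_norm I g)"
    using L2_norm_nonneg by (metis mult_nonneg_nonneg norm_ge_zero)
  then have "2 * (cmod c)\<^sup>2 * (L2_norm I f)\<^sup>2 + 2 * (cmod d)\<^sup>2 * (L2_norm I g)\<^sup>2 \<le> (2 * (cmod c * L2_norm I f + cmod d * L2_norm I g))\<^sup>2"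
    by (simp add: power2_sum power_mult_distrib algebra_simps)
  then show "(L2_norm I (\<lambda>x. c * f x + d * g x))\<^sup>2 \<le> (2 * (cmod c * L2_norm I f + cmod d * L2_norm I g))\<^sup>2"
    using L2_lincomb(2)[OF assms, of c d] unfolding L2_norm_sq by linarith
qed (simp add: L2_norm_nonneg)

lemma L2_Un:
  assumes "f \<in> L2 A" "f \<in> L2 B" "set_borel_measurable lborel (A \<union> B) f" "A \<in> sets borel" "B \<in> sets borel"
  shows "f \<in> L2 (A \<union> B)"
  using assms set_integrable_Un[of lborel A "\<lambda>x. (cmod (f x))\<^sup>2" B] by (simp add: L2_def)

lemma L2_integral_mono_Icc:
  assumes f: "f \<in> L2 I" and sub: "{x..y} \<subseteq> I" and cont: "continuous_on {x..y} f"
  shows "integral {x..y} (\<lambda>s. (cmod (f s))\<^sup>2) \<le> (LINT s:I|lborel. (cmod (f s))\<^sup>2)"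
proof -
  have c: "continuous_on {x..y} (\<lambda>s. (cmod (f s))\<^sup>2)" by (intro continuous_intros cont)
  have "integral {x..y} (\<lambda>s. (cmod (f s))\<^sup>2) = (LINT s:{x..y}|lborel. (cmod (f s))\<^sup>2)"
    by (rule continuous_on_Icc_set_integrable(2)[OF c, symmetric])
  also have "\<dots> \<le> (LINT s:I|lborel. (cmod (f s))\<^sup>2)"
    unfolding set_lebesgue_integral_def
    by (rule Bochner_Integration.integral_mono)
      (use L2_integrable[OF f] continuous_on_Icc_set_integrable(1)[OF c] sub in \<open>auto simp: set_integrable_def indicator_def\<close>)
  finally show ?thesis .
qed

text \<open>This is Cauchy-Schwarz against the constant 1, obtained from the nonnegative variance of
  \<open>cmod (f s)\<close> about its mean \<open>m\<close>.\<close>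

lemma L1_le_L2_norm:
  assumes f: "f \<in> L2 I" and I: "{x..y} \<subseteq> I" and cont: "continuous_on {x..y} f" and xy: "x < y"
  shows "integral {x..y} (\<lambda>s. cmod (f s)) \<le> sqrt (y - x) * L2_norm I f"
proof -
  define m where "m = integral {x..y} (\<lambda>s. cmod (f s)) / (y - x)"
  have i1: "(\<lambda>s. cmod (f s)) integrable_on {x..y}" and i2: "(\<lambda>s. (cmod (f s))\<^sup>2) integrable_on {x..y}"
    using cont by (auto intro!: integrable_continuous_real continuous_intros)
  have "0 \<le> integral {x..y} (\<lambda>s. (cmod (f s) - m)\<^sup>2)" by (rule integral_nonneg)
      (use cont in \<open>auto intro!: integrable_continuous_real continuous_intros\<close>)
  also have "(\<lambda>s. (cmod (f s) - m)\<^sup>2) = (\<lambda>s. (cmod (f s))\<^sup>2 + m\<^sup>2 - (2 * m) * cmod (f s))"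
    by (auto simp: power2_diff)
  also have "integral {x..y} \<dots> = integral {x..y} (\<lambda>s. (cmod (f s))\<^sup>2) + (y - x) * m\<^sup>2 - 2 * m * integral {x..y} (\<lambda>s. cmod (f s))"
  proof (rule integral_unique, rule has_integral_diff, rule has_integral_add)
    show "((\<lambda>s. (cmod (f s))\<^sup>2) has_integral integral {x..y} (\<lambda>s. (cmod (f s))\<^sup>2)) {x..y}"
      by (rule integrable_integral[OF i2])
    show "((\<lambda>s. m\<^sup>2) has_integral (y - x) * m\<^sup>2) {x..y}"
      using has_integral_const_real[of "m\<^sup>2" x y] xy by simp
    show "((\<lambda>s. 2 * m * cmod (f s)) has_integral 2 * m * integral {x..y} (\<lambda>s. cmod (f s))) {x..y}"
      by (rule has_integral_mult_right[OF integrable_integral[OF i1]])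
  qed
  also have "integral {x..y} (\<lambda>s. cmod (f s)) = m * (y - x)" using xy by (simp add: m_def)
  finally have "(y - x) * m\<^sup>2 \<le> integral {x..y} (\<lambda>s. (cmod (f s))\<^sup>2)" by (simp add: power2_eq_square algebra_simps)
  also have "\<dots> \<le> (LINT s:I|lborel. (cmod (f s))\<^sup>2)" by (rule L2_integral_mono_Icc[OF f I cont])
  finally have *: "(y - x) * m\<^sup>2 \<le> (L2_norm I f)\<^sup>2" by (simp add: L2_norm_sq)
  have "(sqrt (y - x) * m)\<^sup>2 \<le> (L2_norm I f)\<^sup>2" using * xy by (simp add: power_mult_distrib)
  then have "sqrt (y - x) * m \<le> L2_norm I f" using L2_norm_nonneg power2_le_imp_le by blast
  then have "sqrt (y - x) * (sqrt (y - x) * m) \<le> sqrt (y - x) * L2_norm I f" using xy by (intro mult_left_mono) auto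
  moreover have "sqrt (y - x) * (sqrt (y - x) * m) = integral {x..y} (\<lambda>s. cmod (f s))"
    using xy by (simp add: m_def flip: mult.assoc)
  ultimately show ?thesis by simp
qed

lemma L2_norm_eq_0:
  assumes f: "f \<in> L2 (einterval a b)" "continuous_on (einterval a b) f" "L2_norm (einterval a b) f = 0"
    and x: "x \<in> einterval a b"
  shows "f x = 0"
proof -
  obtain y where y: "y \<in> einterval a b" "x < y" using einterval_greater_ex[OF x] by blast
  have sub: "{x..y} \<subseteq> einterval a b" using einterval_Icc_subset x y by blast
  have cont: "continuous_on {x..y} f" using f(2) sub continuous_on_subset by blast
  have "integral {x..y} (\<lambda>s. cmod (f s)) \<le> 0" using L1_le_L2_norm[OF f(1) sub cont y(2)] f(3) by simp
  moreover have c: "continuous_on {x..y} (\<lambda>s. cmod (f s))" using cont by (rule continuous_on_norm)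
  moreover have "0 \<le> integral {x..y} (\<lambda>s. cmod (f s))"
    by (rule integral_nonneg[OF integrable_continuous_real[OF c]]) simp
  ultimately have "\<forall>s\<in>{x..y}. cmod (f s) = 0"
    using integral_eq_0_iff[OF c y(2)] by simp
  then show ?thesis using y(2) by simp
qed

section \<open>Continuous test functions and the fundamental lemma of the calculus of
  variations\<close>

lemma bump_test_function:
  fixes f :: "real \<Rightarrow> complex"
  assumes f: "continuous_on {c..d} f" and cd: "c < d"
  obtains \<eta> where "continuous_on UNIV \<eta>" "\<And>s. s \<notin> {c<..<d} \<Longrightarrow> \<eta> s = 0"
    "(LINT s:{c..d}|lborel. f s * \<eta> s) = 0 \<Longrightarrow> \<forall>s\<in>{c<..<d}. f s = 0"
proof
  \<comment> \<open>\<open>\<beta>\<close> is a parabola cut off at 0 and positive exactly on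
    \<open>{c<..<d}\<close>. The conjugate of \<open>f\<close> turns the integrand into
    \<open>\<beta>\<close> times the squared modulus of \<open>f\<close>, and clamping the argument
    of \<open>f\<close> to \<open>{c..d}\<close> makes \<open>\<eta>\<close> continuous on the whole
    line.\<close>
  define \<beta> where "\<beta> s = max 0 ((s - c) * (d - s))" for s
  define \<eta> where "\<eta> s = of_real (\<beta> s) * cnj (f (max c (min d s)))" for s
  have "continuous_on UNIV (\<lambda>s. f (max c (min d s)))"
    by (rule continuous_on_compose2[OF f]) (use cd in \<open>auto intro!: continuous_intros\<close>)
  then show c\<eta>: "continuous_on UNIV \<eta>" unfolding \<eta>_def \<beta>_def by (intro continuous_intros)
  have \<beta>0: "\<beta> s = 0" if "s \<notin> {c<..<d}" for s
  proof -
    have "(s - c) * (d - s) \<le> 0" using that cd by (cases "s \<le> c") (auto simp: mult_le_0_iff)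
    then show ?thesis by (simp add: \<beta>_def)
  qed
  show "\<And>s. s \<notin> {c<..<d} \<Longrightarrow> \<eta> s = 0" by (simp add: \<eta>_def \<beta>0)
  have \<beta>p: "\<beta> s > 0" if "s \<in> {c<..<d}" for s using that by (simp add: \<beta>_def)
  have eq: "f s * \<eta> s = of_real (\<beta> s * (cmod (f s))\<^sup>2)" if "s \<in> {c..d}" for s
  proof -
    have "max c (min d s) = s" using that by simp
    then show ?thesis by (simp add: \<eta>_def mult_ac complex_norm_square flip: of_real_power)
  qed
  show "\<forall>s\<in>{c<..<d}. f s = 0" if "(LINT s:{c..d}|lborel. f s * \<eta> s) = 0"
  proof -
    have c: "continuous_on {c..d} (\<lambda>s. \<beta> s * (cmod (f s))\<^sup>2)" unfolding \<beta>_def by (intro continuous_intros f)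
    have "(LINT s:{c..d}|lborel. f s * \<eta> s) = (LINT s:{c..d}|lborel. complex_of_real (\<beta> s * (cmod (f s))\<^sup>2))"
      by (rule set_lebesgue_integral_cong) (use eq in auto)
    also have "\<dots> = of_real (LINT s:{c..d}|lborel. \<beta> s * (cmod (f s))\<^sup>2)" by (rule set_integral_complex_of_real)
    finally have "integral {c..d} (\<lambda>s. \<beta> s * (cmod (f s))\<^sup>2) = 0"
      using that continuous_on_Icc_set_integrable(2)[OF c] by simp
    then have "\<forall>s\<in>{c..d}. \<beta> s * (cmod (f s))\<^sup>2 = 0"
      using integral_eq_0_iff[OF c cd] by (auto simp: \<beta>_def)
    then show ?thesis using \<beta>p
      by (metis atLeastAtMost_iff greaterThanLessThan_iff less_imp_le mult_eq_0_iff norm_eq_zero order_less_irrefl power_eq_0_iff)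
  qed
qed

lemma compactly_supported_inI:
  assumes "{c..d} \<subseteq> I" "\<And>s. s \<notin> {c<..<d} \<Longrightarrow> f s = 0"
  shows "compactly_supported_in I f"
  unfolding compactly_supported_in_def
  by (rule exI[of _ "{c..d}"]) (use assms in auto)

text \<open>\<open>f\<close> is continuous only on the open interval, whose end points
  \<open>c\<close> and \<open>d\<close> may be, so the test function is placed on a compact
  neighbourhood of \<open>x\<close>.\<close>

lemma fundamental_lemma_variations:
  fixes f :: "real \<Rightarrow> complex"
  assumes f: "continuous_on (einterval a b) f" and J: "{c<..<d} \<subseteq> einterval a b"
    and 0: "\<And>\<eta>. continuous_on UNIV \<eta> \<Longrightarrow> (\<And>s. s \<notin> {c<..<d} \<Longrightarrow> \<eta> s = 0) \<Longrightarrow> compactly_supported_in (einterval a b) \<eta> \<Longrightarrow>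
        (LINT s:einterval a b|lborel. f s * \<eta> s) = 0"
    and x: "x \<in> {c<..<d}"
  shows "f x = 0"
proof -
  define c' where "c' = (c + x) / 2"
  define d' where "d' = (x + d) / 2"
  have o: "c < c'" "c' < x" "x < d'" "d' < d" using x by (auto simp: c'_def d'_def)
  have sub: "{c'..d'} \<subseteq> einterval a b" using J o by force
  obtain \<eta> where \<eta>: "continuous_on UNIV \<eta>" "\<And>s. s \<notin> {c'<..<d'} \<Longrightarrow> \<eta> s = 0"
    "(LINT s:{c'..d'}|lborel. f s * \<eta> s) = 0 \<Longrightarrow> \<forall>s\<in>{c'<..<d'}. f s = 0"
    by (rule bump_test_function[OF continuous_on_subset[OF f sub]]) (use o in auto)
  have "(LINT s:einterval a b|lborel. f s * \<eta> s) = 0"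
    by (rule 0[OF \<eta>(1)]) (use \<eta>(2) o compactly_supported_inI[OF sub] in auto)
  moreover have "(LINT s:einterval a b|lborel. f s * \<eta> s) = (LINT s:{c'..d'}|lborel. f s * \<eta> s)"
    by (rule set_lebesgue_integral_support) (use sub \<eta>(2) in auto)
  ultimately show ?thesis using \<eta>(3) o by auto
qed

section \<open>Schroedinger operators with zero boundary conditions\<close>

lemma einterval_ereal_iff: "a < x \<Longrightarrow> x < b \<Longrightarrow> real_of_ereal x \<in> einterval a b"
  by (cases x) (auto simp: einterval_iff)

lemma einterval_mono: "a \<le> a' \<Longrightarrow> b' \<le> b \<Longrightarrow> einterval a' b' \<subseteq> einterval a b"
  unfolding einterval_def by (auto dest: le_less_trans less_le_trans)

lemma einterval_half_subset:
  assumes "c \<in> einterval a b"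
  shows "einterval a (ereal c) \<subseteq> einterval a b" "einterval (ereal c) b \<subseteq> einterval a b"
  by (rule einterval_mono; use assms in \<open>simp add: einterval_iff less_imp_le\<close>)+

lemma eventually_at_right_ereal:
  assumes "c \<in> einterval a b" "\<And>x. x \<in> einterval a (ereal c) \<Longrightarrow> P x"
  shows "eventually (\<lambda>x. P (real_of_ereal x)) (at_right a)"
proof -
  have "a < ereal c" using assms(1) by (simp add: einterval_iff)
  moreover have "P (real_of_ereal y)" if "a < y" "y < ereal c" for y using assms(2) einterval_ereal_iff that by blast
  ultimately show ?thesis unfolding eventually_at_right[OF \<open>a < ereal c\<close>] by blast
qed

lemma eventually_at_left_ereal:
  assumes "c \<in> einterval a b" "\<And>x. x \<in> einterval (ereal c) b \<Longrightarrow> P x"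
  shows "eventually (\<lambda>x. P (real_of_ereal x)) (at_left b)"
proof -
  have "ereal c < b" using assms(1) by (simp add: einterval_iff)
  moreover have "P (real_of_ereal y)" if "ereal c < y" "y < b" for y using assms(2) einterval_ereal_iff that by blast
  ultimately show ?thesis unfolding eventually_at_left[OF \<open>ereal c < b\<close>] by blast
qed

lemma eventually_at_rightE_ereal:
  assumes "eventually (\<lambda>x. P (real_of_ereal x)) (at_right a)" "a < b"
  obtains c where "c \<in> einterval a b" "\<And>x. x \<in> einterval a (ereal c) \<Longrightarrow> P x"
proof -
  obtain e where e: "a < e" "\<And>y. a < y \<Longrightarrow> y < e \<Longrightarrow> P (real_of_ereal y)"
    using assms(1) unfolding eventually_at_right[OF assms(2)] by blast
  obtain c where "c \<in> einterval a (min e b)" using einterval_nonempty[of a "min e b"] e assms by auto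
  then have c: "a < ereal c" "ereal c < e" "ereal c < b" by (auto simp: einterval_iff)
  show thesis
  proof (rule that[of c])
    fix x assume "x \<in> einterval a (ereal c)"
    then show "P x" using e(2)[of "ereal x"] less_trans[OF _ c(2), of "ereal x"] by (simp add: einterval_iff)
  qed (use c in \<open>auto simp: einterval_iff\<close>)
qed

lemma eventually_at_leftE_ereal:
  assumes "eventually (\<lambda>x. P (real_of_ereal x)) (at_left b)" "a < b"
  obtains c where "c \<in> einterval a b" "\<And>x. x \<in> einterval (ereal c) b \<Longrightarrow> P x"
proof -
  obtain e where e: "e < b" "\<And>y. e < y \<Longrightarrow> y < b \<Longrightarrow> P (real_of_ereal y)"
    using assms(1) unfolding eventually_at_left[OF assms(2)] by blast
  obtain c where "c \<in> einterval (max e a) b" using einterval_nonempty[of "max e a" b] e assms by auto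
  then have c: "e < ereal c" "a < ereal c" "ereal c < b" by (auto simp: einterval_iff)
  show thesis
  proof (rule that[of c])
    fix x assume "x \<in> einterval (ereal c) b"
    then show "P x" using e(2)[of "ereal x"] less_trans[OF c(1), of "ereal x"] by (simp add: einterval_iff)
  qed (use c in \<open>auto simp: einterval_iff\<close>)
qed

lemma at_right_ereal_nontrivial: "a < (b::ereal) \<Longrightarrow> at_right a \<noteq> bot"
  using dense[of a] by (fastforce simp: trivial_limit_def eventually_at_right)

lemma at_left_ereal_nontrivial: "a < (b::ereal) \<Longrightarrow> at_left b \<noteq> bot"
  using dense[of _ b] by (fastforce simp: trivial_limit_def eventually_at_left)

text \<open>Membership in \<open>dirichlet_op\<close> asks for the limit 0 and for square
  integrability. Here both are demanded at one end point only, because a Weyl solution meets them at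
  one end but in general not at the other.\<close>

definition adm_left :: "ereal \<Rightarrow> ereal \<Rightarrow> (real \<Rightarrow> complex) \<Rightarrow> bool" where
  "adm_left a b f \<longleftrightarrow> vanishes_left a f \<and> (\<forall>c\<in>einterval a b. f \<in> L2 (einterval a (ereal c)))"

definition adm_right :: "ereal \<Rightarrow> ereal \<Rightarrow> (real \<Rightarrow> complex) \<Rightarrow> bool" where
  "adm_right a b f \<longleftrightarrow> vanishes_right b f \<and> (\<forall>c\<in>einterval a b. f \<in> L2 (einterval (ereal c) b))"

lemma vanishes_left_cong:
  assumes "c \<in> einterval a b" "\<And>x. x \<in> einterval a (ereal c) \<Longrightarrow> f x = g x"
  shows "vanishes_left a f \<longleftrightarrow> vanishes_left a g"
  unfolding vanishes_left_def comp_def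
  by (rule tendsto_cong, rule eventually_at_right_ereal[OF assms(1), where P="\<lambda>x. f x = g x"]) (rule assms(2))

lemma vanishes_right_cong:
  assumes "c \<in> einterval a b" "\<And>x. x \<in> einterval (ereal c) b \<Longrightarrow> f x = g x"
  shows "vanishes_right b f \<longleftrightarrow> vanishes_right b g"
  unfolding vanishes_right_def comp_def
  by (rule tendsto_cong, rule eventually_at_left_ereal[OF assms(1), where P="\<lambda>x. f x = g x"]) (rule assms(2))

lemma vanishes_left_lincomb:
  assumes "vanishes_left a f" "vanishes_left a g"
  shows "vanishes_left a (\<lambda>x. c * f x + d * g x :: complex)"
  using tendsto_add[OF tendsto_mult_left[OF assms(1)[unfolded vanishes_left_def], of c] tendsto_mult_left[OF assms(2)[unfolded vanishes_left_def], of d]]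
  by (simp add: vanishes_left_def comp_def)

lemma vanishes_right_lincomb:
  assumes "vanishes_right a f" "vanishes_right a g"
  shows "vanishes_right a (\<lambda>x. c * f x + d * g x :: complex)"
  using tendsto_add[OF tendsto_mult_left[OF assms(1)[unfolded vanishes_right_def], of c] tendsto_mult_left[OF assms(2)[unfolded vanishes_right_def], of d]]
  by (simp add: vanishes_right_def comp_def)

lemma vanishes_cnj:
  "vanishes_left a f \<Longrightarrow> vanishes_left a (\<lambda>x. cnj (f x))" "vanishes_right b f \<Longrightarrow> vanishes_right b (\<lambda>x. cnj (f x))"
  using tendsto_cnj[of "f \<circ> real_of_ereal" 0] by (auto simp: vanishes_left_def vanishes_right_def comp_def)

lemma adm_left_lincomb: "adm_left a b f \<Longrightarrow> adm_left a b g \<Longrightarrow> adm_left a b (\<lambda>x. c * f x + d * g x)"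
  by (simp add: adm_left_def vanishes_left_lincomb L2_lincomb(1))

lemma adm_right_lincomb: "adm_right a b f \<Longrightarrow> adm_right a b g \<Longrightarrow> adm_right a b (\<lambda>x. c * f x + d * g x)"
  by (simp add: adm_right_def vanishes_right_lincomb L2_lincomb(1))

lemma adm_left_scale: "adm_left a b f \<Longrightarrow> adm_left a b (\<lambda>x. c * f x)"
  using adm_left_lincomb[of a b f f c 0] by simp

lemma adm_right_scale: "adm_right a b f \<Longrightarrow> adm_right a b (\<lambda>x. c * f x)"
  using adm_right_lincomb[of a b f f c 0] by simp

text \<open>Moving a cut point adds or removes a compact piece, on which a continuous function is
  square integrable.\<close>

lemma L2_extend:
  assumes cont: "continuous_on (einterval a b) f" and cd: "c \<in> einterval a b" "d \<in> einterval a b"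
  shows "f \<in> L2 (einterval a (ereal c)) \<Longrightarrow> f \<in> L2 (einterval a (ereal d))"
    "f \<in> L2 (einterval (ereal c) b) \<Longrightarrow> f \<in> L2 (einterval (ereal d) b)"
    "f \<in> L2 (einterval a (ereal c)) \<Longrightarrow> f \<in> L2 (einterval (ereal d) b) \<Longrightarrow> f \<in> L2 (einterval a b)"
proof -
  have Icc: "f \<in> L2 {x..y}" if "x \<in> einterval a b" "y \<in> einterval a b" for x y
  proof -
    have c: "continuous_on {x..y} f" using cont einterval_Icc_subset[OF that] continuous_on_subset by blast
    have "continuous_on {x..y} (\<lambda>s. (cmod (f s))\<^sup>2)" by (intro continuous_intros c)
    then show ?thesis
      using continuous_on_set_borel_measurable[OF c] continuous_on_Icc_set_integrable(1)[of x y "\<lambda>s. (cmod (f s))\<^sup>2"]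
      by (simp add: L2_def)
  qed
  show 1: "f \<in> L2 (einterval a (ereal d))" if "f \<in> L2 (einterval a (ereal c))"
  proof (rule L2_subset)
    have "einterval a (ereal c) \<union> {c..d} \<subseteq> einterval a b"
      using einterval_half_subset[OF cd(1)] einterval_Icc_subset[OF cd] by blast
    then show "f \<in> L2 (einterval a (ereal c) \<union> {c..d})"
      by (intro L2_Un[OF that Icc[OF cd]] continuous_on_set_borel_measurable continuous_on_subset[OF cont]) auto
  qed (auto simp: einterval_iff)
  show "f \<in> L2 (einterval (ereal d) b)" if "f \<in> L2 (einterval (ereal c) b)"
  proof (rule L2_subset)
    have "einterval (ereal c) b \<union> {d..c} \<subseteq> einterval a b"
      using einterval_half_subset[OF cd(1)] einterval_Icc_subset[OF cd(2,1)] by blast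
    then show "f \<in> L2 (einterval (ereal c) b \<union> {d..c})"
      by (intro L2_Un[OF that Icc[OF cd(2,1)]] continuous_on_set_borel_measurable continuous_on_subset[OF cont]) auto
  qed (auto simp: einterval_iff)
  show "f \<in> L2 (einterval a b)" if l: "f \<in> L2 (einterval a (ereal c))" and r: "f \<in> L2 (einterval (ereal d) b)"
  proof -
    \<comment> \<open>The open half intervals omit \<open>c\<close> and \<open>d\<close>; a closed
      piece that starts at \<open>c\<close> and reaches beyond \<open>d\<close> covers what lies
      between.\<close>
    obtain e where e: "e \<in> einterval a b" "d < e" using einterval_greater_ex[OF cd(2)] by blast
    have l': "f \<in> L2 (einterval a (ereal c) \<union> {c..e})"
    proof -
      have "einterval a (ereal c) \<union> {c..e} \<subseteq> einterval a b"
        using einterval_half_subset[OF cd(1)] einterval_Icc_subset[OF cd(1) e(1)] by blast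
      then show ?thesis
        by (intro L2_Un[OF l Icc[OF cd(1) e(1)]] continuous_on_set_borel_measurable continuous_on_subset[OF cont]) auto
    qed
    have eq: "einterval a b = (einterval a (ereal c) \<union> {c..e}) \<union> einterval (ereal d) b"
    proof
      show "einterval a b \<subseteq> (einterval a (ereal c) \<union> {c..e}) \<union> einterval (ereal d) b"
        using e(2) by (auto simp: einterval_iff not_less)
      show "(einterval a (ereal c) \<union> {c..e}) \<union> einterval (ereal d) b \<subseteq> einterval a b"
        using einterval_half_subset[OF cd(1)] einterval_half_subset[OF cd(2)] einterval_Icc_subset[OF cd(1) e(1)] by blast
    qed
    show ?thesis
      by (subst eq, rule L2_Un[OF l' r]) (use cont in \<open>auto simp: eq[symmetric] intro!: continuous_on_set_borel_measurable\<close>)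
  qed
qed

text \<open>Admissibility is decided near the end point alone. This lets a solution on a half
  interval be replaced by its extension, and a resolvent image by a multiple of a Weyl
  solution.\<close>

lemma adm_left_cong:
  assumes f: "continuous_on (einterval a b) f" and c: "c \<in> einterval a b"
    and eq: "\<And>x. x \<in> einterval a (ereal c) \<Longrightarrow> f x = g x" and g: "vanishes_left a g" "g \<in> L2 (einterval a (ereal c))"
  shows "adm_left a b f"
proof -
  have "vanishes_left a f" using vanishes_left_cong[OF c, of f g] eq g by simp
  moreover have "f \<in> L2 (einterval a (ereal c))" using L2_cong[of "einterval a (ereal c)" f g] eq g by simp
  ultimately show ?thesis using L2_extend(1)[OF f c] by (simp add: adm_left_def)
qed

lemma adm_right_cong:
  assumes f: "continuous_on (einterval a b) f" and c: "c \<in> einterval a b"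
    and eq: "\<And>x. x \<in> einterval (ereal c) b \<Longrightarrow> f x = g x" and g: "vanishes_right b g" "g \<in> L2 (einterval (ereal c) b)"
  shows "adm_right a b f"
proof -
  have "vanishes_right b f" using vanishes_right_cong[OF c, of f g] eq g by simp
  moreover have "f \<in> L2 (einterval (ereal c) b)" using L2_cong[of "einterval (ereal c) b" f g] eq g by simp
  ultimately show ?thesis using L2_extend(2)[OF f c] by (simp add: adm_right_def)
qed

section \<open>The domain of the Schroedinger operator\<close>

lemma dirichlet_opD:
  assumes "(f, h) \<in> dirichlet_op a b V"
  shows "C2_on (einterval a b) f" "\<And>x. x \<in> einterval a b \<Longrightarrow> h x = schroedinger V f x"
    "f \<in> L2 (einterval a b)" "h \<in> L2 (einterval a b)" "vanishes_left a f" "vanishes_right b f"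
  using assms by (auto simp: dirichlet_op_def)

lemma dirichlet_op_sol:
  assumes "(f, h) \<in> dirichlet_op a b V" "\<And>x. x \<in> einterval a b \<Longrightarrow> h x = E * f x + g x"
  shows "schroedinger_sol (einterval a b) V E g f (vderiv f)"
  by (rule schroedinger_solI[OF dirichlet_opD(1)[OF assms(1)]])
    (use dirichlet_opD(2)[OF assms(1)] assms(2) in metis)

lemma dirichlet_op_adm:
  assumes "(f, h) \<in> dirichlet_op a b V"
  shows "adm_left a b f" "adm_right a b f"
  unfolding adm_left_def adm_right_def
  using dirichlet_opD(5,6)[OF assms] L2_subset[OF dirichlet_opD(3)[OF assms]] einterval_half_subset[of _ a b] by simp_all

lemma dirichlet_opI:
  assumes "schroedinger_sol (einterval a b) V E g f f'" "continuous_on (einterval a b) V" "continuous_on (einterval a b) g"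
    and "g \<in> L2 (einterval a b)" "adm_left a b f" "adm_right a b f" "a < b"
    and h: "\<And>x. x \<in> einterval a b \<Longrightarrow> h x = E * f x + g x"
  shows "(f, h) \<in> dirichlet_op a b V"
proof -
  obtain c where c: "c \<in> einterval a b" using einterval_nonempty[OF assms(7)] by blast
  have f: "f \<in> L2 (einterval a b)"
    by (rule L2_extend(3)[OF schroedinger_sol_continuous(1)[OF assms(1)] c c])
      (use assms c in \<open>auto simp: adm_left_def adm_right_def\<close>)
  have "(\<lambda>x. E * f x + 1 * g x) \<in> L2 (einterval a b)" by (rule L2_lincomb(1)[OF f assms(4)])
  then have "h \<in> L2 (einterval a b)" using L2_cong[of "einterval a b" h "\<lambda>x. E * f x + 1 * g x"] h by simp
  then show ?thesis
    using schroedinger_sol_C2[OF assms(1) open_einterval assms(2,3)] f assms(5,6) h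
    by (simp add: dirichlet_op_def adm_left_def adm_right_def)
qed

lemma dirichlet_op_lincomb:
  assumes 1: "(f, h) \<in> dirichlet_op a b V" and 2: "(g, k) \<in> dirichlet_op a b V"
  shows "(\<lambda>x. c * f x + d * g x, \<lambda>x. c * h x + d * k x) \<in> dirichlet_op a b V"
proof -
  let ?I = "einterval a b"
  note D1 = dirichlet_opD[OF 1] and D2 = dirichlet_opD[OF 2]
  have cc: "continuous_on ?I (\<lambda>x. c * vderiv (vderiv f) x + d * vderiv (vderiv g) x)"
    using D1(1) D2(1) unfolding C2_on_def by (intro continuous_intros) auto
  have s1: "((\<lambda>x. c * f x + d * g x) has_vector_derivative c * vderiv f x + d * vderiv g x) (at x)" if "x \<in> ?I" for x
    using C2_onD[OF D1(1) that] C2_onD[OF D2(1) that] by (auto intro!: derivative_eq_intros)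
  have s2: "((\<lambda>x. c * vderiv f x + d * vderiv g x) has_vector_derivative c * vderiv (vderiv f) x + d * vderiv (vderiv g) x) (at x)" if "x \<in> ?I" for x
    using C2_onD[OF D1(1) that] C2_onD[OF D2(1) that] by (auto intro!: derivative_eq_intros)
  have C: "C2_on ?I (\<lambda>x. c * f x + d * g x)"
    "\<And>x. x \<in> ?I \<Longrightarrow> vderiv (vderiv (\<lambda>x. c * f x + d * g x)) x = c * vderiv (vderiv f) x + d * vderiv (vderiv g) x"
    by (rule C2_onI[OF open_einterval s1 s2 cc]; assumption)+
  have "c * h x + d * k x = schroedinger V (\<lambda>x. c * f x + d * g x) x" if "x \<in> ?I" for x
    unfolding schroedinger_def C(2)[OF that] D1(2)[OF that] D2(2)[OF that] by (simp add: scaleR_conv_of_real algebra_simps)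
  then show ?thesis
    using C(1) D1 D2 by (simp add: dirichlet_op_def L2_lincomb(1) vanishes_left_lincomb vanishes_right_lincomb)
qed

lemma L2_cnj: "f \<in> L2 I \<Longrightarrow> (\<lambda>x. cnj (f x)) \<in> L2 I"
proof -
  assume f: "f \<in> L2 I"
  have "(\<lambda>x. cnj (indicator I x *\<^sub>R f x)) \<in> borel_measurable lborel"
    using L2_measurable[OF f] unfolding set_borel_measurable_def
    by (rule borel_measurable_continuous_on[OF continuous_on_cnj[OF continuous_on_id], rotated, simplified, unfolded id_def])
  then have "set_borel_measurable lborel I (\<lambda>x. cnj (f x))" unfolding set_borel_measurable_def by simp
  then show ?thesis using f by (simp add: L2_def)
qed

lemma dirichlet_op_cnj:
  assumes "(f, h) \<in> dirichlet_op a b V"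
  shows "(\<lambda>x. cnj (f x), \<lambda>x. cnj (h x)) \<in> dirichlet_op a b V"
proof -
  let ?I = "einterval a b"
  note D = dirichlet_opD[OF assms]
  have cc: "continuous_on ?I (\<lambda>x. cnj (vderiv (vderiv f) x))"
    using D(1) unfolding C2_on_def by (intro continuous_intros) auto
  have s1: "((\<lambda>x. cnj (f x)) has_vector_derivative cnj (vderiv f x)) (at x)" if "x \<in> ?I" for x
    using C2_onD[OF D(1) that] by (simp add: has_vector_derivative_cnj)
  have s2: "((\<lambda>x. cnj (vderiv f x)) has_vector_derivative cnj (vderiv (vderiv f) x)) (at x)" if "x \<in> ?I" for x
    using C2_onD[OF D(1) that] by (simp add: has_vector_derivative_cnj)
  have C: "C2_on ?I (\<lambda>x. cnj (f x))"
    "\<And>x. x \<in> ?I \<Longrightarrow> vderiv (vderiv (\<lambda>x. cnj (f x))) x = cnj (vderiv (vderiv f) x)"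
    by (rule C2_onI[OF open_einterval s1 s2 cc]; assumption)+
  have "cnj (h x) = schroedinger V (\<lambda>x. cnj (f x)) x" if "x \<in> ?I" for x
    unfolding schroedinger_def C(2)[OF that] D(2)[OF that] by (simp add: scaleR_conv_of_real)
  then show ?thesis using C(1) D by (simp add: dirichlet_op_def L2_cnj vanishes_cnj)
qed

section \<open>Closure, symmetry and a priori bounds\<close>

lemma op_closure_superset:
  assumes "(f, h) \<in> dirichlet_op a b V"
  shows "(f, h) \<in> op_closure (einterval a b) (dirichlet_op a b V)"
proof -
  have "\<exists>F H. (\<forall>n::nat. (F n, H n) \<in> dirichlet_op a b V) \<and>
      (\<lambda>n. L2_norm (einterval a b) (\<lambda>x. F n x - f x)) \<longlonglongrightarrow> 0 \<and>
      (\<lambda>n. L2_norm (einterval a b) (\<lambda>x. H n x - h x)) \<longlonglongrightarrow> 0"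
    by (rule exI[of _ "\<lambda>_. f"], rule exI[of _ "\<lambda>_. h"]) (use assms in \<open>simp add: L2_norm_zero\<close>)
  then show ?thesis using dirichlet_opD(3,4)[OF assms] by (simp add: op_closure_def)
qed

text \<open>Essential self-adjointness places the operator inside the adjoint of its closure.
  Symmetry thus holds without integrating by parts and without control of derivatives at the
  possibly infinite end points.\<close>

lemma dirichlet_op_symmetric:
  assumes "essentially_self_adjoint (einterval a b) (dirichlet_op a b V)"
    and "(f, h) \<in> dirichlet_op a b V" "(g, k) \<in> dirichlet_op a b V"
  shows "L2_inner (einterval a b) h g = L2_inner (einterval a b) f k"
proof -
  have "(g, k) \<in> op_adjoint (einterval a b) (op_closure (einterval a b) (dirichlet_op a b V))"
    using assms(1) op_closure_superset[OF assms(3)] by (simp add: essentially_self_adjoint_def)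
  then show ?thesis using op_closure_superset[OF assms(2)] by (auto simp: op_adjoint_def)
qed

text \<open>The a priori estimate behind \<open>E \<notin> spec a b V\<close>, restricted from the
  closure to \<open>dirichlet_op\<close>. The constant is explicit because later arguments need one
  \<open>C\<close> for a whole set of energies.\<close>

definition resolvent_bound :: "ereal \<Rightarrow> ereal \<Rightarrow> (real \<Rightarrow> real) \<Rightarrow> complex \<Rightarrow> real \<Rightarrow> bool" where
  "resolvent_bound a b V E C \<longleftrightarrow> C > 0 \<and>
     (\<forall>(f, h)\<in>dirichlet_op a b V. L2_norm (einterval a b) f \<le> C * L2_norm (einterval a b) (\<lambda>x. h x - E * f x))"

lemma resolvent_bound_pos: "resolvent_bound a b V E C \<Longrightarrow> C > 0"
  unfolding resolvent_bound_def by (rule conjunct1)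

lemma resolvent_boundD:
  assumes "resolvent_bound a b V E C" "(f, h) \<in> dirichlet_op a b V" "\<And>x. x \<in> einterval a b \<Longrightarrow> h x = E * f x + g x"
  shows "L2_norm (einterval a b) f \<le> C * L2_norm (einterval a b) g"
proof -
  have "L2_norm (einterval a b) (\<lambda>x. h x - E * f x) = L2_norm (einterval a b) g"
    by (rule L2_norm_cong) (simp add: assms(3))
  then show ?thesis using assms(1,2) by (auto simp: resolvent_bound_def)
qed

lemma resolvent_bound_exists:
  assumes "E \<notin> spec a b V"
  obtains C where "resolvent_bound a b V E C"
proof -
  obtain C where C: "\<forall>(f, h)\<in>op_closure (einterval a b) (dirichlet_op a b V).
      L2_norm (einterval a b) f \<le> C * L2_norm (einterval a b) (\<lambda>x. h x - E * f x)"
    using assms unfolding spec_def resolvent_set_def by blast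
  have "resolvent_bound a b V E (max C 1)"
    unfolding resolvent_bound_def
  proof (rule conjI, simp, clarify)
    fix f h assume "(f, h) \<in> dirichlet_op a b V"
    then have "L2_norm (einterval a b) f \<le> C * L2_norm (einterval a b) (\<lambda>x. h x - E * f x)"
      using C op_closure_superset by blast
    also have "\<dots> \<le> max C 1 * L2_norm (einterval a b) (\<lambda>x. h x - E * f x)"
      by (intro mult_right_mono L2_norm_nonneg) auto
    finally show "L2_norm (einterval a b) f \<le> max C 1 * L2_norm (einterval a b) (\<lambda>x. h x - E * f x)" .
  qed
  then show thesis by (rule that)
qed

text \<open>Replacing \<open>E0\<close> by \<open>E\<close> perturbs the right-hand side by
  \<open>(E - E0) * f\<close>. With the factor 2 of \<open>L2_norm_lincomb\<close> this costs at
  most \<open>2 * C * cmod (E - E0)\<close> times the norm of \<open>f\<close>, which the hypothesis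
  makes at most half of that norm, so it can be absorbed on the left.\<close>

lemma resolvent_bound_nearby:
  assumes "resolvent_bound a b V E0 C" "4 * C * cmod (E - E0) \<le> 1"
  shows "resolvent_bound a b V E (4 * C)"
proof -
  let ?I = "einterval a b"
  have C: "C > 0" by (rule resolvent_bound_pos[OF assms(1)])
  have "L2_norm ?I f \<le> 4 * C * L2_norm ?I (\<lambda>x. h x - E * f x)" if fh: "(f, h) \<in> dirichlet_op a b V" for f h
  proof -
    define g where "g = (\<lambda>x. h x - E * f x)"
    have "(\<lambda>x. 1 * h x + (- E) * f x) \<in> L2 ?I" by (rule L2_lincomb(1)[OF dirichlet_opD(4,3)[OF fh]])
    then have g: "g \<in> L2 ?I" by (simp add: g_def)
    have "L2_norm ?I f \<le> C * L2_norm ?I (\<lambda>x. 1 * g x + (E - E0) * f x)"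
      by (rule resolvent_boundD[OF assms(1) fh]) (simp add: g_def algebra_simps)
    also have "\<dots> \<le> C * (2 * (cmod 1 * L2_norm ?I g + cmod (E - E0) * L2_norm ?I f))"
      by (rule mult_left_mono[OF L2_norm_lincomb[OF g dirichlet_opD(3)[OF fh]]]) (use C in simp)
    also have "\<dots> = 2 * C * L2_norm ?I g + (4 * C * cmod (E - E0)) * L2_norm ?I f / 2" by (simp add: algebra_simps)
    also have "\<dots> \<le> 2 * C * L2_norm ?I g + 1 * L2_norm ?I f / 2"
      by (intro add_left_mono divide_right_mono mult_right_mono assms(2) L2_norm_nonneg) simp
    finally have "L2_norm ?I f \<le> 4 * (C * L2_norm ?I g)" by linarith
    then show ?thesis by (simp add: g_def mult.assoc)
  qed
  then show ?thesis using C unfolding resolvent_bound_def by auto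
qed

lemma resolvent_injective:
  assumes "resolvent_bound a b V E C" "(f, h) \<in> dirichlet_op a b V" "\<And>x. x \<in> einterval a b \<Longrightarrow> h x = E * f x"
    and x: "x \<in> einterval a b"
  shows "f x = 0"
proof -
  have "L2_norm (einterval a b) f \<le> C * L2_norm (einterval a b) (\<lambda>x. 0)"
    by (rule resolvent_boundD[OF assms(1,2)]) (simp add: assms(3))
  then have "L2_norm (einterval a b) f = 0" using L2_norm_nonneg[of "einterval a b" f] by (simp add: L2_norm_zero)
  then show ?thesis
    using L2_norm_eq_0[OF dirichlet_opD(3)[OF assms(2)] C2_on_continuous(1)[OF dirichlet_opD(1)[OF assms(2)]] _ x] by simp
qed

section \<open>Weyl solutions and the structure of Green functions\<close>

definition fundamental_system ::
  "real set \<Rightarrow> (real \<Rightarrow> real) \<Rightarrow> complex \<Rightarrow> real \<Rightarrow> (real \<Rightarrow> complex) \<Rightarrow> (real \<Rightarrow> complex) \<Rightarrow> (real \<Rightarrow> complex) \<Rightarrow> (real \<Rightarrow> complex) \<Rightarrow> bool" where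
  "fundamental_system I V E z p p' q q' \<longleftrightarrow>
     schroedinger_sol I V E (\<lambda>_. 0) p p' \<and> schroedinger_sol I V E (\<lambda>_. 0) q q' \<and>
     p z = 1 \<and> (\<forall>x\<in>I. wronskian p p' q q' x = 1)"

lemma fundamental_systemD:
  assumes "fundamental_system I V E z p p' q q'"
  shows "schroedinger_sol I V E (\<lambda>_. 0) p p'" "schroedinger_sol I V E (\<lambda>_. 0) q q'"
    "p z = 1" "\<And>x. x \<in> I \<Longrightarrow> wronskian p p' q q' x = 1"
  using assms by (auto simp: fundamental_system_def)

lemma fundamental_system_exists:
  assumes "continuous_on (einterval a b) V" "z \<in> einterval a b"
  shows "\<exists>p p' q q'. fundamental_system (einterval a b) V E z p p' q q'"
proof -
  have c: "continuous_on (einterval a b) (\<lambda>x. of_real (V x) - E)" by (intro continuous_intros assms)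
  obtain p p' where p: "p z = 1" "p' z = 0"
    "\<And>x. x \<in> einterval a b \<Longrightarrow> (p has_vector_derivative p' x) (at x)"
    "\<And>x. x \<in> einterval a b \<Longrightarrow> (p' has_vector_derivative (of_real (V x) - E) * p x) (at x)"
    using linear_ode2_exists[OF c assms(2), of 1 0] by blast
  obtain q q' where q: "q z = 0" "q' z = 1"
    "\<And>x. x \<in> einterval a b \<Longrightarrow> (q has_vector_derivative q' x) (at x)"
    "\<And>x. x \<in> einterval a b \<Longrightarrow> (q' has_vector_derivative (of_real (V x) - E) * q x) (at x)"
    using linear_ode2_exists[OF c assms(2), of 0 1] by blast
  have sp: "schroedinger_sol (einterval a b) V E (\<lambda>_. 0) p p'" and sq: "schroedinger_sol (einterval a b) V E (\<lambda>_. 0) q q'"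
    using p(3,4) q(3,4) by (simp_all add: schroedinger_sol_def)
  have "wronskian p p' q q' x = 1" if "x \<in> einterval a b" for x
    using wronskian_constant[OF sp sq that assms(2)] p q by simp
  then show ?thesis using sp sq p(1) unfolding fundamental_system_def by blast
qed

text \<open>Write W for the Wronskian. Pointwise \<open>W(f, q) p - W(f, p) q = f W(p, q)\<close>,
  and for solutions the two coefficients are constants; the combination of \<open>p\<close> and
  \<open>q\<close> then makes sense on the larger interval.\<close>

lemma solution_extends:
  assumes V: "continuous_on (einterval a b) V" and sub: "einterval c d \<subseteq> einterval a b"
    and f: "schroedinger_sol (einterval c d) V E (\<lambda>_. 0) f f'"
  shows "\<exists>F F'. schroedinger_sol (einterval a b) V E (\<lambda>_. 0) F F' \<and> (\<forall>x\<in>einterval c d. F x = f x)"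
proof (cases "einterval c d = {}")
  case True
  show ?thesis
    by (rule exI[of _ "\<lambda>_. 0"], rule exI[of _ "\<lambda>_. 0"]) (use True in \<open>auto simp: schroedinger_sol_def\<close>)
next
  case False
  then obtain z where z: "z \<in> einterval c d" by blast
  obtain p p' q q' where "fundamental_system (einterval a b) V E z p p' q q'"
    using fundamental_system_exists[OF V subsetD[OF sub z]] by blast
  note pq = fundamental_systemD[OF this]
  note pJ = schroedinger_sol_subset[OF pq(1) sub] and qJ = schroedinger_sol_subset[OF pq(2) sub]
  define c1 where "c1 = wronskian f f' q q' z"
  define c2 where "c2 = wronskian f f' p p' z"
  have "c1 * p x + (- c2) * q x = f x" if x: "x \<in> einterval c d" for x
  proof -
    have "c1 = wronskian f f' q q' x" "c2 = wronskian f f' p p' x"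
      unfolding c1_def c2_def by (rule wronskian_constant[OF f qJ z x], rule wronskian_constant[OF f pJ z x])
    then have "c1 * p x + (- c2) * q x = f x * wronskian p p' q q' x" by (simp only:) (simp add: algebra_simps)
    then show ?thesis using pq(4)[of x] x sub by auto
  qed
  moreover have "schroedinger_sol (einterval a b) V E (\<lambda>_. 0) (\<lambda>x. c1 * p x + (- c2) * q x) (\<lambda>x. c1 * p' x + (- c2) * q' x)"
    using schroedinger_sol_lincomb[OF pq(1,2), of c1 "- c2"] by simp
  ultimately show ?thesis by blast
qed

text \<open>The Wronskians of \<open>f\<close> with a fundamental system vanish at \<open>z\<close>,
  hence everywhere, and they are the coefficients of \<open>f\<close> in that system.\<close>

lemma solution_unique:
  assumes V: "continuous_on (einterval a b) V"
    and f: "schroedinger_sol (einterval a b) V E (\<lambda>_. 0) f f'" and z: "z \<in> einterval a b" "f z = 0" "f' z = 0"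
    and x: "x \<in> einterval a b"
  shows "f x = 0"
proof -
  obtain p p' q q' where "fundamental_system (einterval a b) V E z p p' q q'"
    using fundamental_system_exists[OF V z(1)] by blast
  note pq = fundamental_systemD[OF this]
  have "f x * wronskian p p' q q' x = wronskian f f' q q' x * p x - wronskian f f' p p' x * q x"
    by (simp add: algebra_simps)
  also have "\<dots> = 0"
    using wronskian_constant[OF f pq(2) z(1) x] wronskian_constant[OF f pq(1) z(1) x] z by simp
  finally show ?thesis using pq(4)[OF x] by simp
qed

text \<open>The Wronskian is normalized to -1 so that the derivative of
  \<open>weyl_kernel F R\<close> in \<open>x\<close> jumps by -1 on the diagonal, which the minus
  sign of the second derivative in \<open>h\<close> turns into
  \<open>+\<delta>(x - y)\<close>.\<close>

definition weyl_pair :: "ereal \<Rightarrow> ereal \<Rightarrow> (real \<Rightarrow> real) \<Rightarrow> complex \<Rightarrow>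
    (real \<Rightarrow> complex) \<Rightarrow> (real \<Rightarrow> complex) \<Rightarrow> (real \<Rightarrow> complex) \<Rightarrow> (real \<Rightarrow> complex) \<Rightarrow> bool" where
  "weyl_pair a b V E F F' R R' \<longleftrightarrow>
     schroedinger_sol (einterval a b) V E (\<lambda>_. 0) F F' \<and> schroedinger_sol (einterval a b) V E (\<lambda>_. 0) R R' \<and>
     adm_left a b F \<and> adm_right a b R \<and> (\<forall>x\<in>einterval a b. F x * R' x - F' x * R x = -1)"

definition weyl_kernel :: "(real \<Rightarrow> complex) \<Rightarrow> (real \<Rightarrow> complex) \<Rightarrow> real \<Rightarrow> real \<Rightarrow> complex" where
  "weyl_kernel F R x y = F (min x y) * R (max x y)"

lemma weyl_kernel_simps:
  "x \<le> y \<Longrightarrow> weyl_kernel F R x y = F x * R y" "y \<le> x \<Longrightarrow> weyl_kernel F R x y = R x * F y"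
  by (auto simp: weyl_kernel_def)

lemma weyl_kernel_sym: "weyl_kernel F R x y = weyl_kernel F R y x"
  by (simp add: weyl_kernel_def min.commute max.commute)

lemma weyl_pairD:
  assumes "weyl_pair a b V E F F' R R'"
  shows "schroedinger_sol (einterval a b) V E (\<lambda>_. 0) F F'" "schroedinger_sol (einterval a b) V E (\<lambda>_. 0) R R'"
    "adm_left a b F" "adm_right a b R" "\<And>x. x \<in> einterval a b \<Longrightarrow> F x * R' x - F' x * R x = -1"
  using assms by (auto simp: weyl_pair_def)

text \<open>If the Wronskian vanished, \<open>R\<close> would be a multiple of \<open>F\<close>;
  then \<open>F\<close> would be admissible at both ends and be an eigenfunction at
  \<open>E\<close>, against the resolvent bound. Otherwise rescaling \<open>F\<close> gives the
  Wronskian -1.\<close>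

lemma weyl_pairI:
  assumes V: "continuous_on (einterval a b) V" and ab: "a < b"
    and F: "schroedinger_sol (einterval a b) V E (\<lambda>_. 0) F F'" "adm_left a b F" "y \<in> einterval a b" "F y \<noteq> 0"
    and R: "schroedinger_sol (einterval a b) V E (\<lambda>_. 0) R R'" "adm_right a b R" "z \<in> einterval a b" "R z \<noteq> 0"
    and E: "resolvent_bound a b V E C"
  shows "\<exists>F F' R R'. weyl_pair a b V E F F' R R'"
proof -
  let ?I = "einterval a b"
  define W where "W = wronskian F F' R R' y"
  have W: "wronskian F F' R R' x = W" if "x \<in> ?I" for x
    unfolding W_def by (rule wronskian_constant[OF F(1) R(1) that F(3)])
  have "W \<noteq> 0"
  proof
    assume W0: "W = 0"
    define c where "c = R y / F y"
    have D: "schroedinger_sol ?I V E (\<lambda>_. 0) (\<lambda>x. 1 * R x + (- c) * F x) (\<lambda>x. 1 * R' x + (- c) * F' x)"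
      using schroedinger_sol_lincomb[OF R(1) F(1), of 1 "-c"] by simp
    have "F y * R' y - F' y * R y = 0" using W[OF F(3)] W0 by simp
    then have "R' y = c * F' y" using F(4) by (simp add: c_def field_simps)
    moreover have "R y = c * F y" using F(4) by (simp add: c_def)
    ultimately have "1 * R x + (- c) * F x = 0" if "x \<in> ?I" for x
      by (intro solution_unique[OF V D F(3) _ _ that]) auto
    then have RF: "R x = c * F x" if "x \<in> ?I" for x using that by (simp add: algebra_simps eq_neg_iff_add_eq_0)
    then have c0: "c \<noteq> 0" using R(3,4) by auto
    have "adm_right a b F"
    proof (rule adm_right_cong[OF schroedinger_sol_continuous(1)[OF F(1)] F(3)])
      show "vanishes_right b (\<lambda>x. inverse c * R x)" "(\<lambda>x. inverse c * R x) \<in> L2 (einterval (ereal y) b)"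
        using adm_right_scale[OF R(2), of "inverse c"] F(3) by (auto simp: adm_right_def)
      fix x assume "x \<in> einterval (ereal y) b"
      then show "F x = inverse c * R x" using RF[of x] einterval_half_subset(2)[OF F(3)] c0 by auto
    qed
    then have "(F, \<lambda>x. E * F x) \<in> dirichlet_op a b V"
      by (intro dirichlet_opI[OF F(1) V _ _ F(2) _ ab]) (auto simp: L2_def set_borel_measurable_def set_integrable_def)
    from resolvent_injective[OF E this refl F(3)] F(4) show False by simp
  qed
  let ?c = "- (1 / W)"
  have s: "schroedinger_sol ?I V E (\<lambda>_. 0) (\<lambda>x. ?c * F x) (\<lambda>x. ?c * F' x)"
    using schroedinger_sol_lincomb[OF F(1) F(1), of ?c 0] by simp
  have "?c * F x * R' x - ?c * F' x * R x = -1" if "x \<in> ?I" for x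
  proof -
    have "?c * F x * R' x - ?c * F' x * R x = ?c * wronskian F F' R R' x" by (simp add: algebra_simps)
    then show ?thesis using W[OF that] \<open>W \<noteq> 0\<close> by simp
  qed
  then have "weyl_pair a b V E (\<lambda>x. ?c * F x) (\<lambda>x. ?c * F' x) R R'"
    using s R(1,2) adm_left_scale[OF F(2), of ?c] by (simp add: weyl_pair_def)
  then show ?thesis by blast
qed

section \<open>Symmetry of the resolvent and existence of Weyl solutions\<close>

lemma L2_mult_integrable:
  assumes "f \<in> L2 I" "g \<in> L2 I"
  shows "set_integrable lborel I (\<lambda>x. f x * g x)"
proof (rule set_integrable_bound)
  show "set_integrable lborel I (\<lambda>x. (cmod (f x))\<^sup>2 + (cmod (g x))\<^sup>2)"
    using assms by (intro set_integral_add L2_integrable)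
  have "(\<lambda>x. (indicator I x *\<^sub>R f x) * (indicator I x *\<^sub>R g x)) \<in> borel_measurable lborel"
    using L2_measurable[OF assms(1)] L2_measurable[OF assms(2)] unfolding set_borel_measurable_def by measurable
  moreover have "(\<lambda>x. (indicator I x *\<^sub>R f x) * (indicator I x *\<^sub>R g x)) = (\<lambda>x. indicator I x *\<^sub>R (f x * g x))"
    by (auto simp: indicator_def)
  ultimately show "set_borel_measurable lborel I (\<lambda>x. f x * g x)" unfolding set_borel_measurable_def by simp
  have "norm (f x * g x) \<le> norm ((cmod (f x))\<^sup>2 + (cmod (g x))\<^sup>2)" for x
  proof -
    have "0 \<le> cmod (f x) * cmod (g x)" by simp
    then have "cmod (f x) * cmod (g x) \<le> (cmod (f x))\<^sup>2 + (cmod (g x))\<^sup>2"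
      using sum_squares_bound[of "cmod (f x)" "cmod (g x)"] by linarith
    then show ?thesis by (simp add: norm_mult)
  qed
  then show "AE x in lborel. x \<in> I \<longrightarrow> norm (f x * g x) \<le> norm ((cmod (f x))\<^sup>2 + (cmod (g x))\<^sup>2)" by simp
qed

text \<open>Since \<open>V\<close> is real, symmetry passes from the sesquilinear to the bilinear pairing.\<close>

lemma resolvent_symmetric:
  assumes esa: "essentially_self_adjoint (einterval a b) (dirichlet_op a b V)"
    and g1: "(g1, \<lambda>x. E * g1 x + f1 x) \<in> dirichlet_op a b V" and g2: "(g2, \<lambda>x. E * g2 x + f2 x) \<in> dirichlet_op a b V"
  shows "(LINT x:einterval a b|lborel. g2 x * f1 x) = (LINT x:einterval a b|lborel. g1 x * f2 x)"
proof -
  let ?I = "einterval a b"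
  have L: "g1 \<in> L2 ?I" "g2 \<in> L2 ?I" "f1 \<in> L2 ?I" "f2 \<in> L2 ?I"
  proof -
    show g: "g1 \<in> L2 ?I" "g2 \<in> L2 ?I" using dirichlet_opD(3) g1 g2 by blast+
    show "f1 \<in> L2 ?I" using L2_lincomb(1)[OF dirichlet_opD(4)[OF g1] g(1), of 1 "-E"] by simp
    show "f2 \<in> L2 ?I" using L2_lincomb(1)[OF dirichlet_opD(4)[OF g2] g(2), of 1 "-E"] by simp
  qed
  have "L2_inner ?I (\<lambda>x. cnj (E * g2 x + f2 x)) g1 = L2_inner ?I (\<lambda>x. cnj (g2 x)) (\<lambda>x. E * g1 x + f1 x)"
    by (rule dirichlet_op_symmetric[OF esa dirichlet_op_cnj[OF g2] g1])
  then have "(LINT x:?I|lborel. E * (g1 x * g2 x) + g1 x * f2 x) = (LINT x:?I|lborel. E * (g1 x * g2 x) + g2 x * f1 x)"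
    by (simp add: L2_inner_def algebra_simps)
  then show ?thesis
    using L by (simp add: set_integral_add L2_mult_integrable)
qed

definition resolvent_kernel :: "ereal \<Rightarrow> ereal \<Rightarrow> (real \<Rightarrow> real) \<Rightarrow> complex \<Rightarrow> (real \<Rightarrow> real \<Rightarrow> complex) \<Rightarrow> bool" where
  "resolvent_kernel a b V E K \<longleftrightarrow>
     continuous_on (einterval a b \<times> einterval a b) (\<lambda>(x, y). K x y) \<and>
     (\<forall>f. continuous_on UNIV f \<longrightarrow> compactly_supported_in (einterval a b) f \<longrightarrow>
        (\<lambda>x. LINT y:einterval a b|lborel. K x y * f y, \<lambda>x. E * (LINT y:einterval a b|lborel. K x y * f y) + f x)
          \<in> dirichlet_op a b V)"

lemma green_function_resolvent_kernel:
  "green_function a b V G \<Longrightarrow> E \<notin> spec a b V \<Longrightarrow> resolvent_kernel a b V E (\<lambda>x y. G x y E)"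
  by (simp add: green_function_def resolvent_kernel_def Let_def)

lemma resolvent_kernelD:
  assumes "resolvent_kernel a b V E K" "continuous_on UNIV f" "compactly_supported_in (einterval a b) f"
  shows "(\<lambda>x. LINT y:einterval a b|lborel. K x y * f y, \<lambda>x. E * (LINT y:einterval a b|lborel. K x y * f y) + f x)
          \<in> dirichlet_op a b V"
  using assms by (simp add: resolvent_kernel_def)

text \<open>A resolvent cannot preserve supports. If the image \<open>g\<close> of
  \<open>\<eta>\<close> vanished off the support of \<open>\<eta>\<close>, integrating the
  derivative \<open>- p * \<eta>\<close> of the Wronskian of \<open>g\<close> with a homogeneous
  solution \<open>p\<close> would give the integral 0 for every \<open>\<eta>\<close>, hence
  \<open>p z = 0\<close>; but \<open>p\<close> is normalized to \<open>p z = 1\<close>.\<close>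

lemma resolvent_nonlocal:
  assumes V: "continuous_on (einterval a b) V" and ab: "a < b" and K: "resolvent_kernel a b V E K"
    and 0: "\<And>f c d x. continuous_on UNIV f \<Longrightarrow> compactly_supported_in (einterval a b) f \<Longrightarrow> c \<in> einterval a b \<Longrightarrow> d \<in> einterval a b \<Longrightarrow>
       (\<And>s. s \<notin> {c<..<d} \<Longrightarrow> f s = 0) \<Longrightarrow> x \<in> einterval a b \<Longrightarrow> x < c \<or> d < x \<Longrightarrow> (LINT y:einterval a b|lborel. K x y * f y) = 0"
  shows False
proof -
  let ?I = "einterval a b"
  obtain z where z: "z \<in> ?I" using einterval_nonempty[OF ab] by blast
  obtain p p' q q' where "fundamental_system ?I V E z p p' q q'"
    using fundamental_system_exists[OF V z] by blast
  note p = fundamental_systemD[OF this]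
  obtain c0 d0 where cd0: "c0 \<in> ?I" "c0 < z" "d0 \<in> ?I" "z < d0"
    using einterval_less_ex[OF z] einterval_greater_ex[OF z] by blast
  have cp: "continuous_on ?I p" by (rule schroedinger_sol_continuous(1)[OF p(1)])
  have "p z = 0"
  proof (rule fundamental_lemma_variations[OF cp, of c0 d0])
    show "{c0<..<d0} \<subseteq> ?I" using einterval_Icc_subset[OF cd0(1,3)] by force
    show "z \<in> {c0<..<d0}" using cd0 by simp
    fix \<eta> assume \<eta>: "continuous_on UNIV \<eta>" "\<And>s. s \<notin> {c0<..<d0} \<Longrightarrow> \<eta> s = 0" "compactly_supported_in ?I \<eta>"
    define g where "g = (\<lambda>x. LINT y:?I|lborel. K x y * \<eta> y)"
    have gT: "(g, \<lambda>x. E * g x + \<eta> x) \<in> dirichlet_op a b V"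
      unfolding g_def by (rule resolvent_kernelD[OF K \<eta>(1,3)])
    have sg: "schroedinger_sol ?I V E \<eta> g (vderiv g)" by (rule dirichlet_op_sol[OF gT refl])
    \<comment> \<open>At points beyond the support of \<open>\<eta>\<close> the function
      \<open>g\<close> vanishes on a neighbourhood, so its derivative is 0 there too.\<close>
    obtain c where c: "c \<in> ?I" "c < c0" using einterval_less_ex[OF cd0(1)] by blast
    obtain d where d: "d \<in> ?I" "d0 < d" using einterval_greater_ex[OF cd0(3)] by blast
    have sub: "{c..d} \<subseteq> ?I" by (rule einterval_Icc_subset[OF c(1) d(1)])
    have g0: "g x = 0" if "x \<in> ?I \<inter> {..<c0} \<or> x \<in> ?I \<inter> {d0<..}" for x
      unfolding g_def by (rule 0[OF \<eta>(1,3) cd0(1,3) \<eta>(2)]) (use that in auto)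
    have "vderiv g c = vderiv (\<lambda>_. 0) c" "vderiv g d = vderiv (\<lambda>_. 0) d"
      by (rule vderiv_cong_open[of "?I \<inter> {..<c0}"], use g0 c in auto, rule vderiv_cong_open[of "?I \<inter> {d0<..}"], use g0 d in auto)
    then have g'0: "vderiv g c = 0" "vderiv g d = 0" by (auto simp: vderivI)
    have "((\<lambda>x. - (p x * \<eta> x)) has_integral (wronskian p p' g (vderiv g) d - wronskian p p' g (vderiv g) c)) {c..d}"
    proof (rule fundamental_theorem_of_calculus)
      show "c \<le> d" using c d cd0 by linarith
      fix x assume "x \<in> {c..d}"
      then have "x \<in> ?I" using sub by blast
      from wronskian_derivative[OF p(1) sg this]
      show "(wronskian p p' g (vderiv g) has_vector_derivative - (p x * \<eta> x)) (at x within {c..d})"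
        by (auto intro: has_vector_derivative_at_within)
    qed
    then have "((\<lambda>x. - (p x * \<eta> x)) has_integral 0) {c..d}" using g0[of c] g0[of d] g'0 c d by simp
    then have "integral {c..d} (\<lambda>x. p x * \<eta> x) = 0" using has_integral_neg_iff by (metis integral_unique neg_0_equal_iff_equal has_integral_neg)
    moreover have "continuous_on {c..d} (\<lambda>x. p x * \<eta> x)"
      by (intro continuous_intros continuous_on_subset[OF cp sub] continuous_on_subset[OF \<eta>(1)]) auto
    moreover have "(LINT s:?I|lborel. p s * \<eta> s) = (LINT s:{c..d}|lborel. p s * \<eta> s)"
      by (rule set_lebesgue_integral_support[OF sub]) (use \<eta>(2) c d in auto)
    ultimately show "(LINT s:?I|lborel. p s * \<eta> s) = 0"
      using continuous_on_Icc_set_integrable(2)[of c d "\<lambda>x. p x * \<eta> x"] by simp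
  qed
  then show False using p(3) by simp
qed

text \<open>The image of \<open>f\<close> near \<open>x\<close> is tested against
  \<open>\<eta>\<close> supported near \<open>x\<close>; symmetry moves the resolvent onto
  \<open>\<eta>\<close>, and the last hypothesis makes the resulting integrand vanish. Knowledge
  about one side of a support is thus carried to the other side.\<close>

lemma resolvent_kernel_sym_zero:
  assumes esa: "essentially_self_adjoint (einterval a b) (dirichlet_op a b V)" and K: "resolvent_kernel a b V E K"
    and f: "continuous_on UNIV f" "compactly_supported_in (einterval a b) f"
    and J: "{c<..<d} \<subseteq> einterval a b" and x: "x \<in> {c<..<d}"
    and 0: "\<And>\<eta> s. continuous_on UNIV \<eta> \<Longrightarrow> compactly_supported_in (einterval a b) \<eta> \<Longrightarrow> (\<And>s. s \<notin> {c<..<d} \<Longrightarrow> \<eta> s = 0) \<Longrightarrow>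
       s \<in> einterval a b \<Longrightarrow> f s = 0 \<or> (LINT y:einterval a b|lborel. K s y * \<eta> y) = 0"
  shows "(LINT y:einterval a b|lborel. K x y * f y) = 0"
proof -
  let ?I = "einterval a b"
  note gT = resolvent_kernelD[OF K f]
  show ?thesis
  proof (rule fundamental_lemma_variations[OF C2_on_continuous(1)[OF dirichlet_opD(1)[OF gT]] J _ x])
    fix \<eta> assume \<eta>: "continuous_on UNIV \<eta>" "\<And>s. s \<notin> {c<..<d} \<Longrightarrow> \<eta> s = 0" "compactly_supported_in ?I \<eta>"
    have "(LINT x:?I|lborel. (LINT y:?I|lborel. K x y * f y) * \<eta> x) = (LINT x:?I|lborel. (LINT y:?I|lborel. K x y * \<eta> y) * f x)"
      by (rule resolvent_symmetric[OF esa resolvent_kernelD[OF K \<eta>(1,3)] gT])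
    also have "\<dots> = (LINT x:?I|lborel. 0)"
      by (rule set_lebesgue_integral_cong) (use 0[OF \<eta>(1,3,2)] in auto)
    finally show "(LINT x:?I|lborel. (LINT y:?I|lborel. K x y * f y) * \<eta> x) = 0" by simp
  qed
qed

text \<open>If there were no solution of the first kind, the resolvent would map each \<open>f\<close> to a function that vanishes to
  the left of the support of \<open>f\<close> and, by symmetry, also to its right.\<close>

lemma weyl_solutions_exist:
  assumes V: "continuous_on (einterval a b) V" and ab: "a < b"
    and esa: "essentially_self_adjoint (einterval a b) (dirichlet_op a b V)" and K: "resolvent_kernel a b V E K"
  shows "\<exists>F F'. schroedinger_sol (einterval a b) V E (\<lambda>_. 0) F F' \<and> adm_left a b F \<and> (\<exists>x\<in>einterval a b. F x \<noteq> 0)" (is ?left)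
    and "\<exists>F F'. schroedinger_sol (einterval a b) V E (\<lambda>_. 0) F F' \<and> adm_right a b F \<and> (\<exists>x\<in>einterval a b. F x \<noteq> 0)" (is ?right)
proof -
  let ?I = "einterval a b"
  let ?g = "\<lambda>f x. LINT y:?I|lborel. K x y * f y"
  show ?left
  proof (rule ccontr)
    assume none: "\<not> ?left"
    \<comment> \<open>To the left of \<open>c\<close> the image of \<open>f\<close> solves the
      homogeneous equation. Its extension to \<open>?I\<close> is admissible at \<open>a\<close>, so
      \<open>none\<close> forces it to be 0.\<close>
    have left: "?g f x = 0" if f: "continuous_on UNIV f" "compactly_supported_in ?I f" "c \<in> ?I" "\<And>s. s \<notin> {c<..<d} \<Longrightarrow> f s = 0"
      and x: "x \<in> ?I" "x < c" for f c d x
    proof -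
      note gT = resolvent_kernelD[OF K f(1,2)]
      have sub: "einterval a (ereal c) \<subseteq> ?I" by (rule einterval_half_subset[OF f(3)])
      have "schroedinger_sol ?I V E f (?g f) (vderiv (?g f))" by (rule dirichlet_op_sol[OF gT refl])
      from schroedinger_sol_subset[OF this sub]
      have sJ: "schroedinger_sol (einterval a (ereal c)) V E (\<lambda>_. 0) (?g f) (vderiv (?g f))"
        by (rule schroedinger_sol_cong[THEN iffD1, rotated]) (use f(4) in \<open>auto simp: einterval_iff\<close>)
      then obtain F F' where F: "schroedinger_sol ?I V E (\<lambda>_. 0) F F'" "\<And>x. x \<in> einterval a (ereal c) \<Longrightarrow> F x = ?g f x"
        using solution_extends[OF V sub sJ] by blast
      have "adm_left a b F"
        by (rule adm_left_cong[OF schroedinger_sol_continuous(1)[OF F(1)] f(3) F(2)])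
          (use dirichlet_op_adm(1)[OF gT] f(3) in \<open>auto simp: adm_left_def\<close>)
      then have "F x = 0" using none F(1) x(1) by blast
      then show ?thesis using F(2)[of x] x by (simp add: einterval_iff)
    qed
    show False
    proof (rule resolvent_nonlocal[OF V ab K])
      fix f c d x assume f: "continuous_on UNIV f" "compactly_supported_in ?I f" "c \<in> ?I" "d \<in> ?I" "\<And>s. s \<notin> {c<..<d} \<Longrightarrow> f s = 0"
        and x: "x \<in> ?I" "x < c \<or> d < x"
      show "?g f x = 0"
      proof (cases "x < c")
        case True then show ?thesis using left[OF f(1-3,5) x(1)] by blast
      next
        case False
        then have dx: "d < x" using x by simp
        obtain e where e: "e \<in> ?I" "x < e" using einterval_greater_ex[OF x(1)] by blast
        show ?thesis
        proof (rule resolvent_kernel_sym_zero[OF esa K f(1,2), of d e])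
          show "{d<..<e} \<subseteq> ?I" using einterval_Icc_subset[OF f(4) e(1)] by force
          show "x \<in> {d<..<e}" using dx e by simp
          fix \<eta> s assume \<eta>: "continuous_on UNIV \<eta>" "compactly_supported_in ?I \<eta>" "\<And>s. s \<notin> {d<..<e} \<Longrightarrow> \<eta> s = 0" "s \<in> ?I"
          \<comment> \<open>\<open>\<eta>\<close> is supported to the right of \<open>d\<close>, so
            by \<open>left\<close> its image vanishes for \<open>s < d\<close>, while
            \<open>f s = 0\<close> for \<open>s \<ge> d\<close>.\<close>
          show "f s = 0 \<or> ?g \<eta> s = 0"
            using left[OF \<eta>(1,2) f(4) \<eta>(3,4)] f(5)[of s] by force
        qed
      qed
    qed
  qed
  show ?right
  proof (rule ccontr)
    assume none: "\<not> ?right"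
    have right: "?g f x = 0" if f: "continuous_on UNIV f" "compactly_supported_in ?I f" "d \<in> ?I" "\<And>s. s \<notin> {c<..<d} \<Longrightarrow> f s = 0"
      and x: "x \<in> ?I" "d < x" for f c d x
    proof -
      note gT = resolvent_kernelD[OF K f(1,2)]
      have sub: "einterval (ereal d) b \<subseteq> ?I" by (rule einterval_half_subset[OF f(3)])
      have "schroedinger_sol ?I V E f (?g f) (vderiv (?g f))" by (rule dirichlet_op_sol[OF gT refl])
      from schroedinger_sol_subset[OF this sub]
      have sJ: "schroedinger_sol (einterval (ereal d) b) V E (\<lambda>_. 0) (?g f) (vderiv (?g f))"
        by (rule schroedinger_sol_cong[THEN iffD1, rotated]) (use f(4) in \<open>auto simp: einterval_iff\<close>)
      then obtain F F' where F: "schroedinger_sol ?I V E (\<lambda>_. 0) F F'" "\<And>x. x \<in> einterval (ereal d) b \<Longrightarrow> F x = ?g f x"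
        using solution_extends[OF V sub sJ] by blast
      have "adm_right a b F"
        by (rule adm_right_cong[OF schroedinger_sol_continuous(1)[OF F(1)] f(3) F(2)])
          (use dirichlet_op_adm(2)[OF gT] f(3) in \<open>auto simp: adm_right_def\<close>)
      then have "F x = 0" using none F(1) x(1) by blast
      then show ?thesis using F(2)[of x] x by (simp add: einterval_iff)
    qed
    show False
    proof (rule resolvent_nonlocal[OF V ab K])
      fix f c d x assume f: "continuous_on UNIV f" "compactly_supported_in ?I f" "c \<in> ?I" "d \<in> ?I" "\<And>s. s \<notin> {c<..<d} \<Longrightarrow> f s = 0"
        and x: "x \<in> ?I" "x < c \<or> d < x"
      show "?g f x = 0"
      proof (cases "d < x")
        case True then show ?thesis using right[OF f(1,2,4,5) x(1)] by blast
      next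
        case False
        then have xc: "x < c" using x by simp
        obtain e where e: "e \<in> ?I" "e < x" using einterval_less_ex[OF x(1)] by blast
        show ?thesis
        proof (rule resolvent_kernel_sym_zero[OF esa K f(1,2), of e c])
          show "{e<..<c} \<subseteq> ?I" using einterval_Icc_subset[OF e(1) f(3)] by force
          show "x \<in> {e<..<c}" using xc e by simp
          fix \<eta> s assume \<eta>: "continuous_on UNIV \<eta>" "compactly_supported_in ?I \<eta>" "\<And>s. s \<notin> {e<..<c} \<Longrightarrow> \<eta> s = 0" "s \<in> ?I"
          show "f s = 0 \<or> ?g \<eta> s = 0"
            using right[OF \<eta>(1,2) f(3) \<eta>(3,4)] f(5)[of s] by force
        qed
      qed
    qed
  qed
qed

lemma weyl_pair_exists:
  assumes V: "continuous_on (einterval a b) V" and ab: "a < b"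
    and esa: "essentially_self_adjoint (einterval a b) (dirichlet_op a b V)" and K: "resolvent_kernel a b V E K"
    and E: "resolvent_bound a b V E C"
  obtains F F' R R' where "weyl_pair a b V E F F' R R'"
  using weyl_solutions_exist[OF V ab esa K] weyl_pairI[OF V ab _ _ _ _ _ _ _ _ E] by metis

section \<open>Variation of parameters: every resolvent kernel is a Weyl kernel\<close>

lemma einterval_antiderivative_at:
  fixes f :: "real \<Rightarrow> complex"
  assumes "continuous_on (einterval a b) f" "c \<in> einterval a b"
  shows "\<exists>P. (\<forall>x\<in>einterval a b. (P has_vector_derivative f x) (at x)) \<and> P c = 0"
proof -
  have ab: "a < b" using assms(2) by (auto simp: einterval_iff intro: less_trans)
  have "\<exists>P. \<forall>x. a < ereal x \<longrightarrow> ereal x < b \<longrightarrow> (P has_vector_derivative f x) (at x)"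
    by (rule einterval_antiderivative[OF ab])
      (use assms(1) in \<open>auto simp: continuous_on_eq_continuous_at einterval_iff\<close>)
  then obtain P where P: "\<And>x. x \<in> einterval a b \<Longrightarrow> (P has_vector_derivative f x) (at x)"
    by (auto simp: einterval_iff)
  show ?thesis
    by (rule exI[of _ "\<lambda>x. P x - P c"]) (use P in \<open>auto intro!: derivative_eq_intros\<close>)
qed

lemma antiderivative_integral:
  fixes f :: "real \<Rightarrow> complex"
  assumes "\<And>x. x \<in> einterval a b \<Longrightarrow> (P has_vector_derivative f x) (at x)"
    and "x \<in> einterval a b" "y \<in> einterval a b" "x \<le> y"
  shows "(f has_integral P y - P x) {x..y}"
  by (rule fundamental_theorem_of_calculus[OF assms(4)])
    (use assms einterval_Icc_subset[OF assms(2,3)] in \<open>blast intro: has_vector_derivative_at_within\<close>)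

lemma weyl_kernel_continuous:
  assumes "continuous_on (einterval a b) F" "continuous_on (einterval a b) R"
  shows "continuous_on (einterval a b \<times> einterval a b) (\<lambda>(x, y). weyl_kernel F R x y)"
proof -
  let ?S = "einterval a b \<times> einterval a b"
  have "continuous_on ?S (\<lambda>p. F (min (fst p) (snd p)))"
    by (rule continuous_on_compose2[OF assms(1)], intro continuous_intros) (auto simp: min_def)
  moreover have "continuous_on ?S (\<lambda>p. R (max (fst p) (snd p)))"
    by (rule continuous_on_compose2[OF assms(2)], intro continuous_intros) (auto simp: max_def)
  ultimately show ?thesis unfolding weyl_kernel_def case_prod_unfold by (rule continuous_on_mult)
qed

lemma continuous_on_slice:
  assumes "continuous_on (A \<times> B) (\<lambda>(x, y). K x y)" "x \<in> A" "S \<subseteq> B"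
  shows "continuous_on S (\<lambda>y. K x y)"
proof -
  have "continuous_on S (\<lambda>y. (x, y))" "(\<lambda>y. (x, y)) ` S \<subseteq> A \<times> B"
    using assms(2,3) by (auto intro!: continuous_on_Pair continuous_on_const continuous_on_id)
  from continuous_on_compose2[OF assms(1) this] show ?thesis by simp
qed

text \<open>Variation of parameters. Anchoring \<open>P\<close> at \<open>c\<close> and
  \<open>Q\<close> at \<open>d\<close> makes \<open>P\<close> and \<open>- Q\<close> the integrals
  of \<open>F f\<close> from \<open>c\<close> and of \<open>R f\<close> up to \<open>d\<close>. Both
  are constant off the support of \<open>f\<close>, so \<open>k\<close> is a multiple of
  \<open>F\<close> to the left of it and of \<open>R\<close> to the right, which yields the boundary
  conditions. The integral formula is only needed on \<open>{c<..<d}\<close>.\<close>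

lemma weyl_resolvent:
  assumes V: "continuous_on (einterval a b) V" and ab: "a < b" and w: "weyl_pair a b V E F F' R R'"
    and f: "continuous_on UNIV f" and cd: "c \<in> einterval a b" "d \<in> einterval a b" and supp: "\<And>s. s \<notin> {c<..<d} \<Longrightarrow> f s = 0"
  shows "\<exists>k. (k, \<lambda>x. E * k x + f x) \<in> dirichlet_op a b V \<and>
    (\<forall>x\<in>{c<..<d}. k x = (LINT y:einterval a b|lborel. weyl_kernel F R x y * f y))"
proof -
  let ?I = "einterval a b"
  note W = weyl_pairD[OF w]
  have cF: "continuous_on ?I F" and cR: "continuous_on ?I R" using W schroedinger_sol_continuous by blast+
  have cf: "continuous_on ?I f" using f continuous_on_subset by blast
  obtain P where P: "\<And>x. x \<in> ?I \<Longrightarrow> (P has_vector_derivative F x * f x) (at x)" "P c = 0"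
    using einterval_antiderivative_at[OF continuous_on_mult[OF cF cf] cd(1)] by blast
  obtain Q where Q: "\<And>x. x \<in> ?I \<Longrightarrow> (Q has_vector_derivative R x * f x) (at x)" "Q d = 0"
    using einterval_antiderivative_at[OF continuous_on_mult[OF cR cf] cd(2)] by blast
  define k where "k = (\<lambda>x. R x * P x - F x * Q x)"
  define k' where "k' = (\<lambda>x. R' x * P x - F' x * Q x)"
  have k: "schroedinger_sol ?I V E f k k'"
    unfolding schroedinger_sol_def
  proof (intro ballI conjI)
    fix x assume x: "x \<in> ?I"
    note d = P(1)[OF x] Q(1)[OF x]
      W(1)[unfolded schroedinger_sol_def, rule_format, OF x, THEN conjunct1] W(1)[unfolded schroedinger_sol_def, rule_format, OF x, THEN conjunct2]
      W(2)[unfolded schroedinger_sol_def, rule_format, OF x, THEN conjunct1] W(2)[unfolded schroedinger_sol_def, rule_format, OF x, THEN conjunct2]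
    have "(k has_vector_derivative (R x * (F x * f x) + R' x * P x) - (F x * (R x * f x) + F' x * Q x)) (at x)"
      unfolding k_def by (intro has_vector_derivative_diff has_vector_derivative_mult d)
    then show "(k has_vector_derivative k' x) (at x)" by (simp add: k'_def algebra_simps)
    have "(k' has_vector_derivative (R' x * (F x * f x) + ((of_real (V x) - E) * R x - 0) * P x)
        - (F' x * (R x * f x) + ((of_real (V x) - E) * F x - 0) * Q x)) (at x)"
      unfolding k'_def by (intro has_vector_derivative_diff has_vector_derivative_mult d)
    moreover have "R' x * (F x * f x) + ((of_real (V x) - E) * R x - 0) * P x
        - (F' x * (R x * f x) + ((of_real (V x) - E) * F x - 0) * Q x)
        = (of_real (V x) - E) * k x + (F x * R' x - F' x * R x) * f x"
      by (simp add: k_def algebra_simps)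
    ultimately show "(k' has_vector_derivative (of_real (V x) - E) * k x - f x) (at x)"
      using W(5)[OF x] by simp
  qed
  have P0: "P x = P y" if "x \<in> ?I" "y \<in> ?I" "x \<le> y" "y \<le> c \<or> d \<le> x" for x y
  proof -
    have 0: "((\<lambda>s. F s * f s) has_integral 0) {x..y}" by (rule has_integral_is_0) (use that supp in auto)
    have "P y - P x = 0" by (rule has_integral_unique[OF antiderivative_integral[OF P(1) that(1-3)] 0])
    then show ?thesis by simp
  qed
  have Q0: "Q x = Q y" if "x \<in> ?I" "y \<in> ?I" "x \<le> y" "y \<le> c \<or> d \<le> x" for x y
  proof -
    have 0: "((\<lambda>s. R s * f s) has_integral 0) {x..y}" by (rule has_integral_is_0) (use that supp in auto)
    have "Q y - Q x = 0" by (rule has_integral_unique[OF antiderivative_integral[OF Q(1) that(1-3)] 0])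
    then show ?thesis by simp
  qed
  have ck: "continuous_on ?I k" by (rule schroedinger_sol_continuous(1)[OF k])
  have al: "adm_left a b k"
  proof (rule adm_left_cong[OF ck cd(1)])
    show "vanishes_left a (\<lambda>x. - Q c * F x)" "(\<lambda>x. - Q c * F x) \<in> L2 (einterval a (ereal c))"
      using adm_left_scale[OF W(3), of "- Q c"] cd(1) by (auto simp: adm_left_def)
    fix x assume x: "x \<in> einterval a (ereal c)"
    then have "x \<in> ?I" "x \<le> c" using einterval_half_subset(1)[OF cd(1)] by (auto simp: einterval_iff)
    then show "k x = - Q c * F x" using P0[of x c] Q0[of x c] P(2) cd(1) by (simp add: k_def)
  qed
  have ar: "adm_right a b k"
  proof (rule adm_right_cong[OF ck cd(2)])
    show "vanishes_right b (\<lambda>x. P d * R x)" "(\<lambda>x. P d * R x) \<in> L2 (einterval (ereal d) b)"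
      using adm_right_scale[OF W(4), of "P d"] cd(2) by (auto simp: adm_right_def)
    fix x assume x: "x \<in> einterval (ereal d) b"
    then have "x \<in> ?I" "d \<le> x" using einterval_half_subset(2)[OF cd(2)] by (auto simp: einterval_iff)
    then show "k x = P d * R x" using P0[of d x] Q0[of d x] Q(2) cd(2) by (simp add: k_def)
  qed
  have fL: "f \<in> L2 ?I"
  proof -
    have "continuous_on {c..d} (\<lambda>s. (cmod (f s))\<^sup>2)" by (intro continuous_intros continuous_on_subset[OF f]) auto
    from continuous_on_Icc_set_integrable(1)[OF this]
    have "set_integrable lborel ?I (\<lambda>s. (cmod (f s))\<^sup>2)"
      by (subst set_integrable_support[OF einterval_Icc_subset[OF cd]]) (use supp in auto)
    then show ?thesis using continuous_on_set_borel_measurable[OF cf] by (simp add: L2_def)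
  qed
  have T: "(k, \<lambda>x. E * k x + f x) \<in> dirichlet_op a b V"
    by (rule dirichlet_opI[OF k V cf fL al ar ab refl])
  have "k x = (LINT y:?I|lborel. weyl_kernel F R x y * f y)" if x: "x \<in> {c<..<d}" for x
  proof -
    have xI: "x \<in> ?I" using x einterval_between[OF cd] by auto
    have sub: "{c..d} \<subseteq> ?I" by (rule einterval_Icc_subset[OF cd])
    have cK: "continuous_on {c..d} (\<lambda>y. weyl_kernel F R x y * f y)"
      by (intro continuous_on_mult continuous_on_slice[OF weyl_kernel_continuous[OF cF cR] xI sub] continuous_on_subset[OF f]) auto
    have "((\<lambda>y. weyl_kernel F R x y * f y) has_integral R x * (P x - P c)) {c..x}"
      by (rule has_integral_eq[rotated, OF has_integral_mult_right[OF antiderivative_integral[OF P(1) cd(1) xI]]])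
        (use x in \<open>auto simp: weyl_kernel_simps\<close>)
    moreover have "((\<lambda>y. weyl_kernel F R x y * f y) has_integral F x * (Q d - Q x)) {x..d}"
      by (rule has_integral_eq[rotated, OF has_integral_mult_right[OF antiderivative_integral[OF Q(1) xI cd(2)]]])
        (use x in \<open>auto simp: weyl_kernel_simps\<close>)
    ultimately have "((\<lambda>y. weyl_kernel F R x y * f y) has_integral R x * (P x - P c) + F x * (Q d - Q x)) {c..d}"
      using x by (intro has_integral_combine[of c x d]) auto
    then have "integral {c..d} (\<lambda>y. weyl_kernel F R x y * f y) = k x" using P(2) Q(2) by (auto simp: k_def intro: integral_unique)
    then have "(LINT y:{c..d}|lborel. weyl_kernel F R x y * f y) = k x"
      using continuous_on_Icc_set_integrable(2)[OF cK] by simp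
    moreover have "(LINT y:?I|lborel. weyl_kernel F R x y * f y) = (LINT y:{c..d}|lborel. weyl_kernel F R x y * f y)"
      by (rule set_lebesgue_integral_support[OF sub]) (use supp in auto)
    ultimately show "k x = (LINT y:?I|lborel. weyl_kernel F R x y * f y)" by simp
  qed
  then show ?thesis using T by blast
qed

text \<open>The two kernels send a test function to two solutions of the same inhomogeneous problem,
  which coincide by injectivity. Both kernels being continuous in \<open>y\<close>, agreement
  against all test functions is agreement at each point.\<close>

lemma resolvent_kernel_eq_weyl_kernel:
  assumes V: "continuous_on (einterval a b) V" and ab: "a < b" and w: "weyl_pair a b V E F F' R R'"
    and K: "resolvent_kernel a b V E K" and E: "resolvent_bound a b V E C"
    and x: "x \<in> einterval a b" and y: "y \<in> einterval a b"
  shows "K x y = weyl_kernel F R x y"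
proof -
  let ?I = "einterval a b"
  note W = weyl_pairD[OF w]
  have cF: "continuous_on ?I F" and cR: "continuous_on ?I R" using W schroedinger_sol_continuous by blast+
  have "compact {x, y}" "{x, y} \<subseteq> ?I" using x y by auto
  then obtain c d where cd: "c \<in> ?I" "d \<in> ?I" "c < d" "{x, y} \<subseteq> {c<..<d}"
    using compact_in_einterval ab by metis
  have sub: "{c..d} \<subseteq> ?I" by (rule einterval_Icc_subset[OF cd(1,2)])
  have cK: "continuous_on ?I (K x)" and cW: "continuous_on ?I (weyl_kernel F R x)"
    using continuous_on_slice[OF _ x order_refl] K weyl_kernel_continuous[OF cF cR] unfolding resolvent_kernel_def by blast+
  have "K x y - weyl_kernel F R x y = 0"
  proof (rule fundamental_lemma_variations[of a b "\<lambda>y. K x y - weyl_kernel F R x y" c d])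
    show "continuous_on ?I (\<lambda>y. K x y - weyl_kernel F R x y)" by (intro continuous_on_diff cK cW)
    show "{c<..<d} \<subseteq> ?I" using sub by force
    show "y \<in> {c<..<d}" using cd by simp
    fix \<eta> assume \<eta>: "continuous_on UNIV \<eta>" "\<And>s. s \<notin> {c<..<d} \<Longrightarrow> \<eta> s = 0" "compactly_supported_in ?I \<eta>"
    obtain k where k: "(k, \<lambda>x. E * k x + \<eta> x) \<in> dirichlet_op a b V"
      "\<And>x. x \<in> {c<..<d} \<Longrightarrow> k x = (LINT y:?I|lborel. weyl_kernel F R x y * \<eta> y)"
      using weyl_resolvent[OF V ab w \<eta>(1) cd(1,2) \<eta>(2)] by blast
    let ?g = "\<lambda>x. LINT y:?I|lborel. K x y * \<eta> y"
    have "1 * ?g x + (-1) * k x = 0"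
      by (rule resolvent_injective[OF E dirichlet_op_lincomb[OF resolvent_kernelD[OF K \<eta>(1,3)] k(1)] _ x]) (simp add: algebra_simps)
    then have eq: "?g x = (LINT y:?I|lborel. weyl_kernel F R x y * \<eta> y)" using k(2)[of x] cd(4) by simp
    have int: "set_integrable lborel ?I (\<lambda>y. L y * \<eta> y)" if "continuous_on ?I L" for L
    proof -
      have "set_integrable lborel {c..d} (\<lambda>y. L y * \<eta> y)"
        by (intro continuous_on_Icc_set_integrable(1) continuous_on_mult continuous_on_subset[OF that sub] continuous_on_subset[OF \<eta>(1)]) auto
      then show ?thesis by (subst set_integrable_support[OF sub]) (use \<eta>(2) in auto)
    qed
    have "(LINT s:?I|lborel. (K x s - weyl_kernel F R x s) * \<eta> s) = ?g x - (LINT y:?I|lborel. weyl_kernel F R x y * \<eta> y)"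
      unfolding left_diff_distrib by (rule set_integral_diff(2)[OF int[OF cK] int[OF cW]])
    then show "(LINT s:?I|lborel. (K x s - weyl_kernel F R x s) * \<eta> s) = 0" using eq by simp
  qed
  then show ?thesis by simp
qed

section \<open>The supersymmetric partner\<close>

text \<open>Monotone convergence along an exhaustion by compact intervals; it turns the uniform
  energy estimate below into square integrability up to the end point.\<close>

lemma L2_of_bounded_integrals:
  assumes cont: "continuous_on (einterval a b) g" and ab: "a < b"
    and B: "\<And>x y. x \<in> einterval a b \<Longrightarrow> y \<in> einterval a b \<Longrightarrow> x \<le> y \<Longrightarrow> integral {x..y} (\<lambda>s. (cmod (g s))\<^sup>2) \<le> B"
  shows "g \<in> L2 (einterval a b)"
proof -
  let ?q = "\<lambda>s. (cmod (g s))\<^sup>2"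
  obtain u l :: "nat \<Rightarrow> real" where ul: "einterval a b = (\<Union>i. {l i .. u i})" "incseq u" "decseq l"
    "\<And>i. l i < u i" "\<And>i. a < l i" "\<And>i. u i < b" "l \<longlonglongrightarrow> a" "u \<longlonglongrightarrow> b"
    by (blast intro: einterval_Icc_approximation[OF ab])
  have sub: "{l i..u i} \<subseteq> einterval a b" for i using ul(1) by blast
  have li: "l i \<in> einterval a b" "u i \<in> einterval a b" for i using sub[of i] ul(4)[of i] by auto
  have cq: "continuous_on (einterval a b) ?q" by (intro continuous_intros cont)
  have c: "continuous_on {l i..u i} ?q" for i using cq sub continuous_on_subset by blast
  have int: "set_integrable lborel {l i..u i} ?q" for i by (rule continuous_on_Icc_set_integrable(1)[OF c])
  have eq: "(LBINT x=l i..u i. ?q x) = integral {l i..u i} ?q" for i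
    by (rule interval_integral_eq_integral[OF less_imp_le[OF ul(4)] int])
  have "incseq (\<lambda>i. integral {l i..u i} ?q)"
  proof (rule incseq_SucI)
    fix i
    have "{l i..u i} \<subseteq> {l (Suc i)..u (Suc i)}"
      using incseq_SucD[OF ul(2), of i] decseq_SucD[OF ul(3), of i] by simp
    then show "integral {l i..u i} ?q \<le> integral {l (Suc i)..u (Suc i)} ?q"
      by (rule integral_subset_le) (intro integrable_continuous_real c, intro integrable_continuous_real c, simp)
  qed
  moreover have "\<forall>i. integral {l i..u i} ?q \<le> B" using B li ul(4) less_imp_le by blast
  ultimately obtain L where "(\<lambda>i. integral {l i..u i} ?q) \<longlonglongrightarrow> L"
    by (rule incseq_convergent)
  then have lim: "(\<lambda>i. LBINT x=l i..u i. ?q x) \<longlonglongrightarrow> L" by (simp add: eq)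
  have "set_integrable lborel (einterval a b) ?q"
    by (rule interval_integral_Icc_approx_nonneg(1)[OF ab ul int _ _ lim])
      (auto intro!: continuous_on_set_borel_measurable cq)
  then show ?thesis using continuous_on_set_borel_measurable[OF cont] by (simp add: L2_def)
qed

locale susy =
  fixes a b :: ereal and V u :: "real \<Rightarrow> real" and \<alpha> :: real
  assumes ab: "a < b" and V: "continuous_on (einterval a b) V"
    and u: "C2_on (einterval a b) u" "\<And>x. x \<in> einterval a b \<Longrightarrow> schroedinger V u x = \<alpha> * u x" "\<And>x. x \<in> einterval a b \<Longrightarrow> u x \<noteq> 0"
begin

abbreviation I where "I \<equiv> einterval a b"
abbreviation w where "w \<equiv> superpotential u"
abbreviation V1 where "V1 \<equiv> partner V u"

lemma u_derivatives:
  assumes "x \<in> I"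
  shows "(u has_vector_derivative vderiv u x) (at x)" "(vderiv u has_vector_derivative (V x - \<alpha>) * u x) (at x)"
proof -
  have "vderiv (vderiv u) x = (V x - \<alpha>) * u x"
    using u(2)[OF assms] by (simp add: schroedinger_def algebra_simps)
  then show "(u has_vector_derivative vderiv u x) (at x)" "(vderiv u has_vector_derivative (V x - \<alpha>) * u x) (at x)"
    using C2_onD[OF u(1) assms] by auto
qed

text \<open>This Riccati equation eliminates the derivative of \<open>w\<close> from
  \<open>V1\<close>, so that \<open>V1\<close> is continuous although \<open>V\<close> is merely
  continuous.\<close>

lemma w_derivative:
  assumes "x \<in> I"
  shows "(w has_vector_derivative (V x - \<alpha> - (w x)\<^sup>2)) (at x)"
proof -
  have d: "(u has_real_derivative vderiv u x) (at x)" "(vderiv u has_real_derivative (V x - \<alpha>) * u x) (at x)"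
    using u_derivatives[OF assms] by (simp_all add: has_real_derivative_iff_has_vector_derivative)
  have "((\<lambda>x. vderiv u x / u x) has_real_derivative ((V x - \<alpha>) * u x * u x - vderiv u x * vderiv u x) / (u x * u x)) (at x)"
    by (rule DERIV_divide[OF d(2,1) u(3)[OF assms]])
  also have "((V x - \<alpha>) * u x * u x - vderiv u x * vderiv u x) / (u x * u x) = V x - \<alpha> - (w x)\<^sup>2"
    using u(3)[OF assms] by (simp add: superpotential_def field_simps power2_eq_square)
  finally show ?thesis by (simp add: superpotential_def has_real_derivative_iff_has_vector_derivative)
qed

lemma w_continuous: "continuous_on I w"
  by (rule has_vector_derivative_continuous_on[OF w_derivative])

lemma V1_eq: "x \<in> I \<Longrightarrow> V1 x = 2 * \<alpha> + 2 * (w x)\<^sup>2 - V x"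
  using vderivI[OF w_derivative] by (simp add: partner_def)

lemma V1_continuous: "continuous_on I V1"
proof -
  have "continuous_on I (\<lambda>x. 2 * \<alpha> + 2 * (w x)\<^sup>2 - V x)" by (intro continuous_intros w_continuous V)
  then show ?thesis by (simp add: V1_eq cong: continuous_on_cong)
qed

text \<open>In contrast to \<open>L_op\<close>, the derivative is a separate argument, to match the
  pairs \<open>f\<close>, \<open>f'\<close> carried by \<open>schroedinger_sol\<close>.\<close>

definition L :: "(real \<Rightarrow> complex) \<Rightarrow> (real \<Rightarrow> complex) \<Rightarrow> real \<Rightarrow> complex" where
  "L f f' x = - f' x + of_real (w x) * f x"

text \<open>The derivative of \<open>L f\<close> for \<open>h\<^sub>0 f = E f\<close>, read off from \<open>L\<^sup>+ L f = (E - \<alpha>) f\<close>.\<close>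

definition L' :: "complex \<Rightarrow> (real \<Rightarrow> complex) \<Rightarrow> (real \<Rightarrow> complex) \<Rightarrow> real \<Rightarrow> complex" where
  "L' E f f' x = (E - of_real \<alpha>) * f x - of_real (w x) * L f f' x"

lemma w_derivative_complex:
  assumes "x \<in> I"
  shows "((\<lambda>x. complex_of_real (w x)) has_vector_derivative of_real (V x - \<alpha> - (w x)\<^sup>2)) (at x)"
  using has_vector_derivative_of_real[OF w_derivative[OF assms, folded has_real_derivative_iff_has_vector_derivative]] .

text \<open>Differentiating \<open>L f\<close> twice in the naive way would require a derivative of
  \<open>V\<close>. Expressing \<open>(L f)'\<close> through \<open>f\<close> and \<open>L f\<close>
  leaves a first order system in which only \<open>w\<close> is differentiated, and the Riccati
  equation handles that.\<close>

lemma L_sol: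
  assumes "schroedinger_sol I V E (\<lambda>_. 0) f f'"
  shows "schroedinger_sol I V1 E (\<lambda>_. 0) (L f f') (L' E f f')"
  unfolding schroedinger_sol_def
proof (intro ballI conjI)
  fix x assume x: "x \<in> I"
  note d = w_derivative_complex[OF x] assms[unfolded schroedinger_sol_def, rule_format, OF x, THEN conjunct1]
    assms[unfolded schroedinger_sol_def, rule_format, OF x, THEN conjunct2]
  have "((\<lambda>x. - f' x + of_real (w x) * f x) has_vector_derivative
      - ((of_real (V x) - E) * f x - 0) + (of_real (w x) * f' x + of_real (V x - \<alpha> - (w x)\<^sup>2) * f x)) (at x)"
    by (intro has_vector_derivative_add has_vector_derivative_minus has_vector_derivative_mult d)
  then show 1: "(L f f' has_vector_derivative L' E f f' x) (at x)"
    unfolding L_def[abs_def] L'_def by (rule has_vector_derivative_eq_rhs) (simp add: algebra_simps power2_eq_square)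
  have "((\<lambda>x. (E - of_real \<alpha>) * f x - of_real (w x) * L f f' x) has_vector_derivative
      (E - of_real \<alpha>) * f' x - (of_real (w x) * L' E f f' x + of_real (V x - \<alpha> - (w x)\<^sup>2) * L f f' x)) (at x)"
    by (intro has_vector_derivative_diff has_vector_derivative_mult has_vector_derivative_mult_right d 1)
  then show "(L' E f f' has_vector_derivative (of_real (V1 x) - E) * L f f' x - 0) (at x)"
    unfolding L'_def[abs_def] V1_eq[OF x]
    by (rule has_vector_derivative_eq_rhs) (simp add: L_def L'_def algebra_simps power2_eq_square)
qed

lemma L_continuous:
  assumes "schroedinger_sol I V E (\<lambda>_. 0) f f'"
  shows "continuous_on I (L f f')"
  by (rule schroedinger_sol_continuous(1)[OF L_sol[OF assms]])

lemma L_op_eq: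
  assumes "schroedinger_sol I V E (\<lambda>_. 0) f f'" "x \<in> I"
  shows "L_op w f x = L f f' x"
  using assms vderivI[of f "f' x" x] by (auto simp: L_op_def L_def schroedinger_sol_def scaleR_conv_of_real)

text \<open>The identity for the derivative of \<open>cnj f * L f\<close>, integrated over
  \<open>{x..y}\<close>. Each of the two boundary terms has modulus at most 1, which accounts for
  \<open>+ 2\<close>; the bound does not depend on \<open>x\<close> and \<open>y\<close>.\<close>

lemma L_energy_bound:
  assumes f: "schroedinger_sol I V E (\<lambda>_. 0) f f'" and J: "J \<subseteq> I" "f \<in> L2 J" "{x..y} \<subseteq> J" "x \<le> y"
    and b: "cmod (f x) \<le> 1" "cmod (f y) \<le> 1" "cmod (L f f' x) \<le> 1" "cmod (L f f' y) \<le> 1"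
  shows "integral {x..y} (\<lambda>s. (cmod (L f f' s))\<^sup>2) \<le> cmod (E - of_real \<alpha>) * (LINT s:J|lborel. (cmod (f s))\<^sup>2) + 2"
proof -
  let ?g = "L f f'"
  have sub: "{x..y} \<subseteq> I" using J by blast
  have cf: "continuous_on {x..y} f" and cg: "continuous_on {x..y} ?g"
    using continuous_on_subset[OF _ sub] schroedinger_sol_continuous(1)[OF f] L_continuous[OF f] by blast+
  have "((\<lambda>s. (E - of_real \<alpha>) * of_real ((cmod (f s))\<^sup>2) - of_real ((cmod (?g s))\<^sup>2)) has_integral
      cnj (f y) * ?g y - cnj (f x) * ?g x) {x..y}"
  proof (rule fundamental_theorem_of_calculus[OF J(4)])
    fix s assume "s \<in> {x..y}"
    then have s: "s \<in> I" using sub by blast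
    have d1: "(f has_vector_derivative f' s) (at s)" and d2: "(?g has_vector_derivative L' E f f' s) (at s)"
      using f L_sol[OF f] s by (auto simp: schroedinger_sol_def)
    have "((\<lambda>s. cnj (f s) * ?g s) has_vector_derivative cnj (f s) * L' E f f' s + cnj (f' s) * ?g s) (at s)"
      by (rule has_vector_derivative_mult[OF has_vector_derivative_cnj[OF d1] d2])
    \<comment> \<open>Substituting \<open>f' = w f - L f\<close> makes the two terms with
      \<open>w\<close> cancel, since \<open>w\<close> is real.\<close>
    moreover have "cnj (f s) * L' E f f' s + cnj (f' s) * ?g s
        = (E - of_real \<alpha>) * (f s * cnj (f s)) - (?g s * cnj (?g s))"
      by (simp add: L'_def L_def algebra_simps)
    ultimately show "((\<lambda>s. cnj (f s) * ?g s) has_vector_derivative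
        (E - of_real \<alpha>) * of_real ((cmod (f s))\<^sup>2) - of_real ((cmod (?g s))\<^sup>2)) (at s within {x..y})"
      unfolding complex_norm_square by (metis has_vector_derivative_at_within)
  qed
  moreover have i1: "((\<lambda>s. (E - of_real \<alpha>) * of_real ((cmod (f s))\<^sup>2)) has_integral
      (E - of_real \<alpha>) * of_real (integral {x..y} (\<lambda>s. (cmod (f s))\<^sup>2))) {x..y}"
    by (intro has_integral_mult_right has_integral_of_real integrable_integral integrable_continuous_real continuous_intros cf)
  moreover have i2: "((\<lambda>s. complex_of_real ((cmod (?g s))\<^sup>2)) has_integral
      of_real (integral {x..y} (\<lambda>s. (cmod (?g s))\<^sup>2))) {x..y}"
    by (intro has_integral_of_real integrable_integral integrable_continuous_real continuous_intros cg)
  ultimately have "(E - of_real \<alpha>) * of_real (integral {x..y} (\<lambda>s. (cmod (f s))\<^sup>2)) - of_real (integral {x..y} (\<lambda>s. (cmod (?g s))\<^sup>2))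
      = cnj (f y) * ?g y - cnj (f x) * ?g x"
    using has_integral_diff[OF i1 i2] has_integral_unique by blast
  then have "complex_of_real (integral {x..y} (\<lambda>s. (cmod (?g s))\<^sup>2))
      = (E - of_real \<alpha>) * of_real (integral {x..y} (\<lambda>s. (cmod (f s))\<^sup>2)) - cnj (f y) * ?g y + cnj (f x) * ?g x"
    by (simp add: algebra_simps)
  then have "cmod (of_real (integral {x..y} (\<lambda>s. (cmod (?g s))\<^sup>2)))
      \<le> cmod ((E - of_real \<alpha>) * of_real (integral {x..y} (\<lambda>s. (cmod (f s))\<^sup>2))) + cmod (cnj (f y) * ?g y) + cmod (cnj (f x) * ?g x)"
    by (metis norm_triangle_le norm_triangle_ineq4 add_right_mono)
  also have "\<dots> \<le> cmod (E - of_real \<alpha>) * (LINT s:J|lborel. (cmod (f s))\<^sup>2) + 1 + 1"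
  proof (intro add_mono)
    have "0 \<le> integral {x..y} (\<lambda>s. (cmod (f s))\<^sup>2)"
      by (rule integral_nonneg) (auto intro!: integrable_continuous_real continuous_intros cf)
    then show "cmod ((E - of_real \<alpha>) * of_real (integral {x..y} (\<lambda>s. (cmod (f s))\<^sup>2))) \<le> cmod (E - of_real \<alpha>) * (LINT s:J|lborel. (cmod (f s))\<^sup>2)"
      using L2_integral_mono_Icc[OF J(2,3) cf] by (simp add: norm_mult mult_left_mono)
    show "cmod (cnj (f y) * ?g y) \<le> 1" "cmod (cnj (f x) * ?g x) \<le> 1"
      using b by (simp_all add: norm_mult mult_le_one)
  qed
  finally show ?thesis by (simp del: of_real_power) 
qed

text \<open>Near \<open>a\<close> both \<open>f\<close> and \<open>L f\<close> have modulus at most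
  1 because they tend to 0, so the energy bound holds there uniformly and gives square integrability
  of \<open>L f\<close>.\<close>

lemma L_adm_left:
  assumes f: "schroedinger_sol I V E (\<lambda>_. 0) f f'" "adm_left a b f" and v: "vanishes_left a (L f f')"
  shows "adm_left a b (L f f')"
proof -
  have ev: "eventually (\<lambda>x. cmod (g (real_of_ereal x)) \<le> 1) (at_right a)" if "vanishes_left a g" for g :: "real \<Rightarrow> complex"
    using tendstoD[OF that[unfolded vanishes_left_def], of 1] by (auto simp: dist_norm elim: eventually_mono)
  have "eventually (\<lambda>x. cmod (f (real_of_ereal x)) \<le> 1 \<and> cmod (L f f' (real_of_ereal x)) \<le> 1) (at_right a)"
    using ev[OF v] ev[of f] f(2) by (auto simp: adm_left_def intro: eventually_conj)
  then obtain c where c: "c \<in> I" "\<And>x. x \<in> einterval a (ereal c) \<Longrightarrow> cmod (f x) \<le> 1 \<and> cmod (L f f' x) \<le> 1"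
    by (rule eventually_at_rightE_ereal[OF _ ab, where P="\<lambda>x. cmod (f x) \<le> 1 \<and> cmod (L f f' x) \<le> 1"]) blast
  let ?J = "einterval a (ereal c)"
  have J: "?J \<subseteq> I" by (rule einterval_half_subset[OF c(1)])
  have "L f f' \<in> L2 ?J"
  proof (rule L2_of_bounded_integrals)
    show "continuous_on ?J (L f f')" using L_continuous[OF f(1)] J continuous_on_subset by blast
    show "a < ereal c" using c(1) by (simp add: einterval_iff)
    fix x y assume "x \<in> ?J" "y \<in> ?J" "x \<le> y"
    then show "integral {x..y} (\<lambda>s. (cmod (L f f' s))\<^sup>2) \<le> cmod (E - of_real \<alpha>) * (LINT s:?J|lborel. (cmod (f s))\<^sup>2) + 2"
      by (intro L_energy_bound[OF f(1) J]) (use c f(2) einterval_Icc_subset in \<open>auto simp: adm_left_def\<close>)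
  qed
  then show ?thesis using v L2_extend(1)[OF L_continuous[OF f(1)] c(1)] by (simp add: adm_left_def)
qed

lemma L_adm_right:
  assumes f: "schroedinger_sol I V E (\<lambda>_. 0) f f'" "adm_right a b f" and v: "vanishes_right b (L f f')"
  shows "adm_right a b (L f f')"
proof -
  have ev: "eventually (\<lambda>x. cmod (g (real_of_ereal x)) \<le> 1) (at_left b)" if "vanishes_right b g" for g :: "real \<Rightarrow> complex"
    using tendstoD[OF that[unfolded vanishes_right_def], of 1] by (auto simp: dist_norm elim: eventually_mono)
  have "eventually (\<lambda>x. cmod (f (real_of_ereal x)) \<le> 1 \<and> cmod (L f f' (real_of_ereal x)) \<le> 1) (at_left b)"
    using ev[OF v] ev[of f] f(2) by (auto simp: adm_right_def intro: eventually_conj)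
  then obtain c where c: "c \<in> I" "\<And>x. x \<in> einterval (ereal c) b \<Longrightarrow> cmod (f x) \<le> 1 \<and> cmod (L f f' x) \<le> 1"
    by (rule eventually_at_leftE_ereal[OF _ ab, where P="\<lambda>x. cmod (f x) \<le> 1 \<and> cmod (L f f' x) \<le> 1"]) blast
  let ?J = "einterval (ereal c) b"
  have J: "?J \<subseteq> I" by (rule einterval_half_subset[OF c(1)])
  have "L f f' \<in> L2 ?J"
  proof (rule L2_of_bounded_integrals)
    show "continuous_on ?J (L f f')" using L_continuous[OF f(1)] J continuous_on_subset by blast
    show "ereal c < b" using c(1) by (simp add: einterval_iff)
    fix x y assume "x \<in> ?J" "y \<in> ?J" "x \<le> y"
    then show "integral {x..y} (\<lambda>s. (cmod (L f f' s))\<^sup>2) \<le> cmod (E - of_real \<alpha>) * (LINT s:?J|lborel. (cmod (f s))\<^sup>2) + 2"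
      by (intro L_energy_bound[OF f(1) J]) (use c f(2) einterval_Icc_subset in \<open>auto simp: adm_right_def\<close>)
  qed
  then show ?thesis using v L2_extend(2)[OF L_continuous[OF f(1)] c(1)] by (simp add: adm_right_def)
qed

text \<open>At each point \<open>(f, f')\<close> is mapped to \<open>(L f, L' f)\<close> by a matrix
  of determinant \<open>E - \<alpha>\<close>.\<close>

lemma L_wronskian:
  "wronskian (L f f') (L' E f f') (L g g') (L' E g g') x = (E - of_real \<alpha>) * wronskian f f' g g' x"
  by (simp add: L_def L'_def algebra_simps)

text \<open>The condition \<open>E \<noteq> \<alpha>\<close> enters twice: the boundary conditions
  are preserved only for such energies, and the Wronskian, multiplied by \<open>E - \<alpha>\<close>
  under \<open>L\<close>, has to be normalized again by rescaling \<open>F\<close>.\<close>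

lemma weyl_pair_partner:
  assumes pres: "preserves_boundary_conditions a b V \<alpha> w" and E: "E \<noteq> of_real \<alpha>"
    and W: "weyl_pair a b V E F F' R R'"
  shows "weyl_pair a b V1 E (\<lambda>x. inverse (E - of_real \<alpha>) * L F F' x) (\<lambda>x. inverse (E - of_real \<alpha>) * L' E F F' x) (L R R') (L' E R R')"
proof -
  note w = weyl_pairD[OF W]
  obtain z where z: "z \<in> I" using einterval_nonempty[OF ab] by blast
  have sols: "C2_on I f \<and> (\<forall>x\<in>I. schroedinger V f x = E * f x)" if "schroedinger_sol I V E (\<lambda>_. 0) f f'" for f f'
    using schroedinger_sol_C2[OF that open_einterval V] by simp
  have "vanishes_left a (L_op w F)" "vanishes_right b (L_op w R)"
    using pres E sols[OF w(1)] sols[OF w(2)] w(3,4) unfolding preserves_boundary_conditions_def adm_left_def adm_right_def by blast+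
  then have "vanishes_left a (L F F')" "vanishes_right b (L R R')"
    using vanishes_left_cong[OF z, of "L_op w F" "L F F'"] vanishes_right_cong[OF z, of "L_op w R" "L R R'"]
      L_op_eq[OF w(1)] L_op_eq[OF w(2)] einterval_half_subset[OF z] by blast+
  then have adm: "adm_left a b (L F F')" "adm_right a b (L R R')"
    using L_adm_left[OF w(1,3)] L_adm_right[OF w(2,4)] by blast+
  let ?c = "inverse (E - of_real \<alpha>)"
  have c: "?c * (E - of_real \<alpha>) = 1" using E by simp
  have "?c * L F F' x * L' E R R' x - ?c * L' E F F' x * L R R' x = -1" if "x \<in> I" for x
  proof -
    have "?c * L F F' x * L' E R R' x - ?c * L' E F F' x * L R R' x = ?c * wronskian (L F F') (L' E F F') (L R R') (L' E R R') x"
      by (simp add: algebra_simps)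
    also have "\<dots> = (?c * (E - of_real \<alpha>)) * wronskian F F' R R' x" unfolding L_wronskian by (simp only: mult.assoc)
    finally show ?thesis using c w(5)[OF that] by simp
  qed
  then show ?thesis
    using schroedinger_sol_lincomb[OF L_sol[OF w(1)] L_sol[OF w(1)], of ?c 0] L_sol[OF w(2)] adm_left_scale[OF adm(1), of ?c] adm(2)
    by (simp add: weyl_pair_def)
qed

text \<open>At \<open>E = \<alpha>\<close> the function \<open>L f\<close> solves the first order equation \<open>L\<^sup>+ (L f) = 0\<close>.\<close>

lemma L_at_alpha:
  assumes f: "schroedinger_sol I V (of_real \<alpha>) (\<lambda>_. 0) f f'"
  obtains c where "\<And>x. x \<in> I \<Longrightarrow> L f f' x = c / of_real (u x)"
proof -
  obtain z where z: "z \<in> I" using einterval_nonempty[OF ab] by blast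
  have "(\<lambda>x. of_real (u x) * L f f' x) x = (\<lambda>x. of_real (u x) * L f f' x) z" if x: "x \<in> I" for x
  proof (rule has_derivative_zero_unique_connected[of I "\<lambda>x. of_real (u x) * L f f' x"])
    show "connected I" by (rule connected_einterval)
    fix s assume s: "s \<in> I"
    have d: "((\<lambda>x. complex_of_real (u x)) has_vector_derivative of_real (vderiv u s)) (at s)"
      "(L f f' has_vector_derivative L' (of_real \<alpha>) f f' s) (at s)"
      using u_derivatives(1)[OF s] L_sol[OF f] s
      by (auto simp: schroedinger_sol_def has_real_derivative_iff_has_vector_derivative intro!: has_vector_derivative_of_real)
    have "((\<lambda>x. of_real (u x) * L f f' x) has_vector_derivative of_real (u s) * L' (of_real \<alpha>) f f' s + of_real (vderiv u s) * L f f' s) (at s)"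
      by (rule has_vector_derivative_mult[OF d])
    moreover have "of_real (u s) * L' (of_real \<alpha>) f f' s + of_real (vderiv u s) * L f f' s = 0"
      using u(3)[OF s] by (simp add: L'_def superpotential_def)
    ultimately show "((\<lambda>x. of_real (u x) * L f f' x) has_derivative (\<lambda>h. 0)) (at s)"
      by (simp add: has_vector_derivative_def)
  qed (use x z in auto)
  then have "L f f' x = (of_real (u z) * L f f' z) / of_real (u x)" if "x \<in> I" for x
    using u(3)[OF that] that by (simp add: field_simps)
  then show thesis by (rule that)
qed

text \<open>\<open>L f = 0\<close> is the first order equation \<open>f' = w f\<close>, which
  \<open>u\<close> satisfies too, so \<open>f / u\<close> has derivative 0.\<close>

lemma L_zero_imp_multiple:
  assumes f: "schroedinger_sol I V E (\<lambda>_. 0) f f'" and 0: "\<And>x. x \<in> I \<Longrightarrow> L f f' x = 0"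
  obtains c where "\<And>x. x \<in> I \<Longrightarrow> f x = c * of_real (u x)"
proof -
  obtain z where z: "z \<in> I" using einterval_nonempty[OF ab] by blast
  have "(\<lambda>x. f x / of_real (u x)) x = (\<lambda>x. f x / of_real (u x)) z" if x: "x \<in> I" for x
  proof (rule has_derivative_zero_unique_connected[of I "\<lambda>x. f x / of_real (u x)"])
    show "connected I" by (rule connected_einterval)
    fix s assume s: "s \<in> I"
    have "(u has_real_derivative vderiv u s) (at s)"
      using u_derivatives(1)[OF s] by (simp add: has_real_derivative_iff_has_vector_derivative)
    then have "((\<lambda>x. inverse (u x)) has_real_derivative - (vderiv u s) / (u s)\<^sup>2) (at s)"
      using u(3)[OF s] by (auto intro!: derivative_eq_intros simp: field_simps power2_eq_square)
    then have d: "((\<lambda>x. complex_of_real (inverse (u x))) has_vector_derivative of_real (- (vderiv u s) / (u s)\<^sup>2)) (at s)"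
      by (rule has_vector_derivative_of_real)
    have df: "(f has_vector_derivative f' s) (at s)" using f s by (auto simp: schroedinger_sol_def)
    have "((\<lambda>x. f x * of_real (inverse (u x))) has_vector_derivative f s * of_real (- (vderiv u s) / (u s)\<^sup>2) + f' s * of_real (inverse (u s))) (at s)"
      by (rule has_vector_derivative_mult[OF df d])
    moreover have "f s * of_real (- (vderiv u s) / (u s)\<^sup>2) + f' s * of_real (inverse (u s)) = - L f f' s / of_real (u s)"
      using u(3)[OF s] by (simp add: L_def superpotential_def field_simps power2_eq_square)
    ultimately show "((\<lambda>x. f x / of_real (u x)) has_derivative (\<lambda>h. 0)) (at s)"
      using 0[OF s] by (simp add: has_vector_derivative_def divide_inverse)
  qed (use x z in auto)
  then have eq: "f x / of_real (u x) = f z / of_real (u z)" if "x \<in> I" for x using that by blast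
  have "f x = (f z / of_real (u z)) * of_real (u x)" if "x \<in> I" for x
    unfolding eq[OF that, symmetric] using u(3)[OF that] by simp
  then show thesis by (rule that)
qed

end

section \<open>Distributional derivatives of kernels\<close>

lemma set_integrable_If:
  fixes f g :: "'b \<Rightarrow> 'a::{banach, second_countable_topology}"
  assumes "set_integrable M A f" "set_integrable M A g" "B \<in> sets M" "space M = UNIV"
  shows "set_integrable M A (\<lambda>x. if x \<in> B then f x else g x)"
proof -
  have B: "- B \<in> sets M" using sets.compl_sets[OF assms(3)] assms(4) by (simp add: Compl_eq_Diff_UNIV)
  have "integrable M (\<lambda>x. indicator B x *\<^sub>R (indicator A x *\<^sub>R f x) + indicator (- B) x *\<^sub>R (indicator A x *\<^sub>R g x))"
    by (rule Bochner_Integration.integrable_add[OF integrable_mult_indicator[OF assms(3)] integrable_mult_indicator[OF B]])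
      (use assms(1,2) in \<open>simp_all add: set_integrable_def\<close>)
  moreover have "(\<lambda>x. indicator B x *\<^sub>R (indicator A x *\<^sub>R f x) + indicator (- B) x *\<^sub>R (indicator A x *\<^sub>R g x))
      = (\<lambda>x. indicator A x *\<^sub>R (if x \<in> B then f x else g x))"
    by (auto simp: indicator_def fun_eq_iff)
  ultimately show ?thesis by (simp add: set_integrable_def)
qed

lemma set_lebesgue_integral_diff_has_integral:
  fixes f g :: "real \<Rightarrow> complex"
  assumes f: "set_integrable lborel {c..d} f" and g: "set_integrable lborel {c..d} g"
    and "((\<lambda>x. f x - g x) has_integral v) {c..d}"
  shows "(LINT x:{c..d}|lborel. f x) = v + (LINT x:{c..d}|lborel. g x)"
proof -
  have "(LINT x:{c..d}|lborel. f x - g x) = integral {c..d} (\<lambda>x. f x - g x)"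
    by (rule set_borel_integral_eq_integral(2)[OF set_integral_diff(1)[OF f g]])
  also have "\<dots> = v" by (rule integral_unique[OF assms(3)])
  finally show ?thesis unfolding set_integral_diff(2)[OF f g] diff_eq_eq .
qed

lemma fubini_Icc:
  fixes f :: "real \<times> real \<Rightarrow> complex"
  assumes "set_integrable lborel ({c..d} \<times> {c..d}) f"
  shows "(LINT p:{c..d} \<times> {c..d}|lborel. f p) = (LINT y:{c..d}|lborel. LINT x:{c..d}|lborel. f (x, y))"
    and "(LINT p:{c..d} \<times> {c..d}|lborel. f p) = (LINT x:{c..d}|lborel. LINT y:{c..d}|lborel. f (x, y))"
    and "set_integrable lborel {c..d} (\<lambda>x. LINT y:{c..d}|lborel. f (x, y))"
proof -
  let ?Q = "{c..d}"
  let ?g = "\<lambda>p. indicator (?Q \<times> ?Q) p *\<^sub>R f p"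
  have int: "integrable (lborel \<Otimes>\<^sub>M lborel) ?g" using assms by (simp add: set_integrable_def lborel_prod)
  have int': "integrable (lborel \<Otimes>\<^sub>M lborel) (\<lambda>(x, y). ?g (x, y))" using int by (simp add: case_prod_unfold)
  have g: "?g (x, y) = indicator ?Q x *\<^sub>R (indicator ?Q y *\<^sub>R f (x, y))" "?g (x, y) = indicator ?Q y *\<^sub>R (indicator ?Q x *\<^sub>R f (x, y))" for x y
    by (auto simp: indicator_def)
  have "(LINT p:?Q \<times> ?Q|lborel. f p) = integral\<^sup>L (lborel \<Otimes>\<^sub>M lborel) (\<lambda>(x, y). ?g (x, y))"
    by (simp add: set_lebesgue_integral_def lborel_prod case_prod_unfold)
  also have "\<dots> = (\<integral>y. (\<integral>x. ?g (x, y) \<partial>lborel) \<partial>lborel)"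
    by (rule lborel_pair.integral_snd[OF int', symmetric])
  also have "\<dots> = (LINT y:?Q|lborel. LINT x:?Q|lborel. f (x, y))"
    unfolding g(2) set_lebesgue_integral_def by (simp only: integral_scaleR_right)
  finally show "(LINT p:?Q \<times> ?Q|lborel. f p) = (LINT y:?Q|lborel. LINT x:?Q|lborel. f (x, y))" .
  have "(LINT p:?Q \<times> ?Q|lborel. f p) = integral\<^sup>L (lborel \<Otimes>\<^sub>M lborel) ?g"
    by (simp add: set_lebesgue_integral_def lborel_prod)
  also have "\<dots> = (\<integral>x. (\<integral>y. ?g (x, y) \<partial>lborel) \<partial>lborel)"
    by (rule lborel_pair.integral_fst'[OF int, symmetric])
  also have "\<dots> = (LINT x:?Q|lborel. LINT y:?Q|lborel. f (x, y))"
    unfolding g(1) set_lebesgue_integral_def by (simp only: integral_scaleR_right)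
  finally show "(LINT p:?Q \<times> ?Q|lborel. f p) = (LINT x:?Q|lborel. LINT y:?Q|lborel. f (x, y))" .
  have "integrable lborel (\<lambda>x. \<integral>y. ?g (x, y) \<partial>lborel)" by (rule lborel_pair.integrable_fst'[OF int])
  then show "set_integrable lborel ?Q (\<lambda>x. LINT y:?Q|lborel. f (x, y))"
    unfolding g(1) set_integrable_def set_lebesgue_integral_def by (simp only: integral_scaleR_right)
qed

lemma continuous_on_square_set_integrable:
  fixes f :: "real \<times> real \<Rightarrow> complex"
  assumes "continuous_on ({c..d} \<times> {c..d}) f"
  shows "set_integrable lborel ({c..d} \<times> {c..d}) f"
  unfolding set_integrable_def using borel_integrable_compact[OF _ assms] by (simp add: compact_Times scaleR_conv_of_real)

text \<open>Integration by parts on either side of \<open>y\<close>, for a function \<open>m\<close>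
  that equals \<open>A\<close> on the left and \<open>B\<close> on the right, with \<open>n\<close>
  playing the role of \<open>L m\<close>. The outer boundary terms vanish with
  \<open>\<theta>\<close>, and the jump of \<open>m\<close> at \<open>y\<close> survives. The values
  of \<open>m\<close> and \<open>n\<close> at \<open>y\<close> itself do not matter for the
  integral.\<close>

lemma jump_by_parts:
  fixes A B \<theta> m n :: "real \<Rightarrow> complex"
  assumes A: "\<And>x. x \<in> {c..d} \<Longrightarrow> (A has_vector_derivative A' x) (at x)" and B: "\<And>x. x \<in> {c..d} \<Longrightarrow> (B has_vector_derivative B' x) (at x)"
    and \<theta>: "\<And>x. x \<in> {c..d} \<Longrightarrow> (\<theta> has_vector_derivative \<theta>' x) (at x)" "\<theta> c = 0" "\<theta> d = 0"
    and y: "y \<in> {c..d}"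
    and m: "\<And>x. x < y \<Longrightarrow> m x = A x" "\<And>x. y < x \<Longrightarrow> m x = B x"
    and n: "\<And>x. x < y \<Longrightarrow> n x = - A' x + of_real (w x) * A x" "\<And>x. y < x \<Longrightarrow> n x = - B' x + of_real (w x) * B x"
  shows "((\<lambda>x. m x * (\<theta>' x + of_real (w x) * \<theta> x) - n x * \<theta> x) has_integral (A y - B y) * \<theta> y) {c..d}"
proof -
  have "((\<lambda>x. A x * \<theta>' x + A' x * \<theta> x) has_integral A y * \<theta> y - A c * \<theta> c) {c..y}"
  proof (rule fundamental_theorem_of_calculus)
    fix x assume "x \<in> {c..y}"
    then have x: "x \<in> {c..d}" using y by auto
    show "((\<lambda>x. A x * \<theta> x) has_vector_derivative A x * \<theta>' x + A' x * \<theta> x) (at x within {c..y})"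
      by (rule has_vector_derivative_at_within[OF has_vector_derivative_mult[OF A[OF x] \<theta>(1)[OF x]]])
  qed (use y in simp)
  then have "((\<lambda>x. A x * \<theta>' x + A' x * \<theta> x) has_integral A y * \<theta> y) {c..y}" using \<theta>(2,3) by simp
  then have 1: "((\<lambda>x. m x * (\<theta>' x + of_real (w x) * \<theta> x) - n x * \<theta> x) has_integral A y * \<theta> y) {c..y}"
  proof (rule has_integral_spike_finite[of "{y}", rotated 2])
    fix x assume "x \<in> {c..y} - {y}"
    then have xy: "x < y" by auto
    have mn: "m x = A x" "n x = - A' x + of_real (w x) * A x" by (rule m(1)[OF xy], rule n(1)[OF xy])
    show "m x * (\<theta>' x + of_real (w x) * \<theta> x) - n x * \<theta> x = A x * \<theta>' x + A' x * \<theta> x"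
      unfolding mn by (simp add: algebra_simps)
  qed simp
  have "((\<lambda>x. B x * \<theta>' x + B' x * \<theta> x) has_integral B d * \<theta> d - B y * \<theta> y) {y..d}"
  proof (rule fundamental_theorem_of_calculus)
    fix x assume "x \<in> {y..d}"
    then have x: "x \<in> {c..d}" using y by auto
    show "((\<lambda>x. B x * \<theta> x) has_vector_derivative B x * \<theta>' x + B' x * \<theta> x) (at x within {y..d})"
      by (rule has_vector_derivative_at_within[OF has_vector_derivative_mult[OF B[OF x] \<theta>(1)[OF x]]])
  qed (use y in simp)
  then have "((\<lambda>x. B x * \<theta>' x + B' x * \<theta> x) has_integral - (B y * \<theta> y)) {y..d}" using \<theta>(2,3) by simp
  then have 2: "((\<lambda>x. m x * (\<theta>' x + of_real (w x) * \<theta> x) - n x * \<theta> x) has_integral - (B y * \<theta> y)) {y..d}"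
  proof (rule has_integral_spike_finite[of "{y}", rotated 2])
    fix x assume "x \<in> {y..d} - {y}"
    then have xy: "y < x" by auto
    have mn: "m x = B x" "n x = - B' x + of_real (w x) * B x" by (rule m(2)[OF xy], rule n(2)[OF xy])
    show "m x * (\<theta>' x + of_real (w x) * \<theta> x) - n x * \<theta> x = B x * \<theta>' x + B' x * \<theta> x"
      unfolding mn by (simp add: algebra_simps)
  qed simp
  show ?thesis
    using has_integral_combine[OF _ _ 1 2] y by (simp add: algebra_simps)
qed

section \<open>Test functions on the square and their supports\<close>

lemma Ck_plane_continuous: "(\<And>n. Ck_plane n \<phi>) \<Longrightarrow> continuous_on UNIV (\<lambda>(x, y). \<phi> x y)"
  by (metis Ck_plane.simps(1))

lemma Ck_plane_deriv:
  assumes "\<And>n. Ck_plane n \<phi>"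
  shows "\<And>n. Ck_plane n (deriv_x \<phi>)" "\<And>n. Ck_plane n (deriv_y \<phi>)"
    "((\<lambda>s. \<phi> s y) has_vector_derivative deriv_x \<phi> x y) (at x)" "((\<lambda>t. \<phi> x t) has_vector_derivative deriv_y \<phi> x y) (at y)"
proof -
  have *: "(\<forall>x y. (\<lambda>s. \<phi> s y) differentiable (at x) \<and> (\<lambda>t. \<phi> x t) differentiable (at y)) \<and>
     Ck_plane n (deriv_x \<phi>) \<and> Ck_plane n (deriv_y \<phi>)" for n
    using assms[of "Suc n"] by simp
  show "\<And>n. Ck_plane n (deriv_x \<phi>)" "\<And>n. Ck_plane n (deriv_y \<phi>)" using * by blast+
  show "((\<lambda>s. \<phi> s y) has_vector_derivative deriv_x \<phi> x y) (at x)" "((\<lambda>t. \<phi> x t) has_vector_derivative deriv_y \<phi> x y) (at y)"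
    unfolding deriv_x_def deriv_y_def using * by (blast intro: vderivD)+
qed

lemma deriv_vanishes_outside:
  assumes S: "closed S" and 0: "\<And>x y. (x, y) \<notin> S \<Longrightarrow> \<phi> x y = 0" and xy: "(x, y) \<notin> S"
  shows "deriv_x \<phi> x y = 0" "deriv_y \<phi> x y = 0"
proof -
  have o: "open ((\<lambda>s. (s, y)) -` (- S))" "open ((\<lambda>t. (x, t)) -` (- S))"
    using S by (auto intro!: open_vimage continuous_intros)
  have "vderiv (\<lambda>s. \<phi> s y) x = vderiv (\<lambda>_. 0) x" by (rule vderiv_cong_open[OF o(1)]) (use xy 0 in auto)
  then show "deriv_x \<phi> x y = 0" by (simp add: deriv_x_def vderivI)
  have "vderiv (\<lambda>t. \<phi> x t) y = vderiv (\<lambda>_. 0) y" by (rule vderiv_cong_open[OF o(2)]) (use xy 0 in auto)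
  then show "deriv_y \<phi> x y = 0" by (simp add: deriv_y_def vderivI)
qed

lemma test_functions2_support:
  assumes \<phi>: "\<phi> \<in> test_functions2 (einterval a b)" and ab: "a < b"
  shows "\<exists>c d. c \<in> einterval a b \<and> d \<in> einterval a b \<and> c < d \<and>
    (\<forall>x y. (x, y) \<notin> {c<..<d} \<times> {c<..<d} \<longrightarrow>
       \<phi> x y = 0 \<and> deriv_x \<phi> x y = 0 \<and> deriv_y \<phi> x y = 0 \<and> deriv_x (deriv_y \<phi>) x y = 0)"
proof -
  obtain S where S: "compact S" "S \<subseteq> einterval a b \<times> einterval a b" "\<And>x y. (x, y) \<notin> S \<Longrightarrow> \<phi> x y = 0"
    using \<phi> by (auto simp: test_functions2_def)
  have "compact (fst ` S \<union> snd ` S)" "fst ` S \<union> snd ` S \<subseteq> einterval a b"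
    using S by (auto intro!: compact_Un compact_continuous_image continuous_intros)
  then obtain c d where cd: "c \<in> einterval a b" "d \<in> einterval a b" "c < d" "fst ` S \<union> snd ` S \<subseteq> {c<..<d}"
    using compact_in_einterval ab by metis
  have sub: "S \<subseteq> {c<..<d} \<times> {c<..<d}" using cd(4) by (force simp: image_subset_iff)
  note D = deriv_vanishes_outside[OF compact_imp_closed[OF S(1)]]
  have "\<phi> x y = 0 \<and> deriv_x \<phi> x y = 0 \<and> deriv_y \<phi> x y = 0 \<and> deriv_x (deriv_y \<phi>) x y = 0" if "(x, y) \<notin> {c<..<d} \<times> {c<..<d}" for x y
  proof -
    have "(x, y) \<notin> S" using that sub by blast
    then show ?thesis using S(3) D[of \<phi>] D(1)[of "deriv_y \<phi>"] by blast
  qed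
  then show ?thesis using cd by blast
qed

text \<open>\<open>w y\<close> is a constant for the derivative in \<open>x\<close>, so no
  derivative of \<open>w\<close> appears in the expansion.\<close>

lemma Lt_x_Lt_y:
  assumes "\<And>n. Ck_plane n \<phi>"
  shows "Lt_x w (Lt_y w \<phi>) x y =
    (deriv_x (deriv_y \<phi>) x y + of_real (w y) * deriv_x \<phi> x y) + of_real (w x) * (deriv_y \<phi> x y + of_real (w y) * \<phi> x y)"
proof -
  have "((\<lambda>s. deriv_y \<phi> s y + of_real (w y) * \<phi> s y) has_vector_derivative
      deriv_x (deriv_y \<phi>) x y + of_real (w y) * deriv_x \<phi> x y) (at x)"
    by (intro has_vector_derivative_add has_vector_derivative_mult_right Ck_plane_deriv(3) Ck_plane_deriv(2) assms)
  then have "vderiv (\<lambda>s. Lt_y w \<phi> s y) x = deriv_x (deriv_y \<phi>) x y + of_real (w y) * deriv_x \<phi> x y"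
    unfolding Lt_y_def scaleR_conv_of_real by (rule vderivI)
  then have "deriv_x (Lt_y w \<phi>) x y = deriv_x (deriv_y \<phi>) x y + of_real (w y) * deriv_x \<phi> x y"
    by (subst deriv_x_def)
  then show ?thesis by (simp add: Lt_x_def Lt_y_def scaleR_conv_of_real)
qed

lemma kernel_dist_square:
  assumes "{c..d} \<subseteq> I" "\<And>x y. (x, y) \<notin> {c<..<d} \<times> {c<..<d} \<Longrightarrow> \<phi> x y = 0"
  shows "kernel_dist I K \<phi> = (LINT p:{c..d} \<times> {c..d}|lborel. K (fst p) (snd p) * \<phi> (fst p) (snd p))"
  unfolding kernel_dist_def
proof (rule set_lebesgue_integral_support)
  show "{c..d} \<times> {c..d} \<subseteq> I \<times> I" using assms(1) by blast
  fix p assume "p \<notin> {c..d} \<times> {c..d}"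
  then have "(fst p, snd p) \<notin> {c<..<d} \<times> {c<..<d}" by (cases p) auto
  from assms(2)[OF this] show "K (fst p) (snd p) * \<phi> (fst p) (snd p) = 0" by simp
qed

text \<open>Integration by parts first in \<open>x\<close>, then, after exchanging the integrals, in
  \<open>y\<close>. The kernel is continuous across the diagonal, so the first round leaves no
  boundary term; \<open>L\<^sub>x\<close> of the kernel jumps there, and the second round leaves the
  delta distribution.\<close>

lemma LL_dist_weyl_kernel:
  fixes F R F' R' :: "real \<Rightarrow> complex"
  assumes ab: "a < b"
    and F: "\<And>x. x \<in> einterval a b \<Longrightarrow> (F has_vector_derivative F' x) (at x)" "continuous_on (einterval a b) F'"
    and R: "\<And>x. x \<in> einterval a b \<Longrightarrow> (R has_vector_derivative R' x) (at x)" "continuous_on (einterval a b) R'"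
    and w: "continuous_on (einterval a b) w"
    and W: "\<And>x. x \<in> einterval a b \<Longrightarrow> F x * R' x - F' x * R x = -1"
    and \<phi>: "\<phi> \<in> test_functions2 (einterval a b)"
    and LF: "\<And>x. LF x = - F' x + of_real (w x) * F x" and LR: "\<And>x. LR x = - R' x + of_real (w x) * R x"
  shows "LL_dist (einterval a b) w (weyl_kernel F R) \<phi>
      = kernel_dist (einterval a b) (weyl_kernel LF LR) \<phi> + delta_dist (einterval a b) \<phi>"
proof -
  let ?I = "einterval a b"
  obtain c d where cd: "c \<in> ?I" "d \<in> ?I" "c < d" and
    supp: "\<And>x y. (x, y) \<notin> {c<..<d} \<times> {c<..<d} \<Longrightarrow> \<phi> x y = 0 \<and> deriv_x \<phi> x y = 0 \<and> deriv_y \<phi> x y = 0 \<and> deriv_x (deriv_y \<phi>) x y = 0"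
    using test_functions2_support[OF \<phi> ab] by blast
  let ?Q = "{c..d}"
  have sub: "?Q \<subseteq> ?I" by (rule einterval_Icc_subset[OF cd(1,2)])
  have C: "\<And>n. Ck_plane n \<phi>" using \<phi> by (simp add: test_functions2_def)
  note Cy = Ck_plane_deriv(2)[OF C]
  define \<psi> where "\<psi> x y = deriv_y \<phi> x y + of_real (w y) * \<phi> x y" for x y
  define \<psi>x where "\<psi>x x y = deriv_x (deriv_y \<phi>) x y + of_real (w y) * deriv_x \<phi> x y" for x y
  have d\<psi>: "((\<lambda>s. \<psi> s y) has_vector_derivative \<psi>x x y) (at x)" for x y
    unfolding \<psi>_def \<psi>x_def
    by (intro has_vector_derivative_add has_vector_derivative_mult_right Ck_plane_deriv(3) Cy C)
  have Psi: "Lt_x w (Lt_y w \<phi>) x y = \<psi>x x y + of_real (w x) * \<psi> x y" for x y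
    unfolding Lt_x_Lt_y[OF C] \<psi>_def \<psi>x_def by simp
  have contQ: "continuous_on (?Q \<times> ?Q) (\<lambda>p. \<theta> (fst p) (snd p))" if "\<And>n. Ck_plane n \<theta>" for \<theta>
    using continuous_on_subset[OF Ck_plane_continuous[OF that]] by (auto simp: case_prod_unfold)
  have cw: "continuous_on ?Q w" and cF: "continuous_on ?I F" and cR: "continuous_on ?I R"
    using continuous_on_subset[OF w sub] has_vector_derivative_continuous_on[OF F(1)] has_vector_derivative_continuous_on[OF R(1)] by auto
  have fstQ: "continuous_on (?Q \<times> ?Q) (\<lambda>p. g (fst p))" and sndQ: "continuous_on (?Q \<times> ?Q) (\<lambda>p. g (snd p))"
    if "continuous_on ?Q g" for g :: "real \<Rightarrow> 'z::topological_space"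
    by (rule continuous_on_compose2[OF that]; auto intro!: continuous_intros)+
  have c\<psi>: "continuous_on (?Q \<times> ?Q) (\<lambda>p. \<psi> (fst p) (snd p))"
    unfolding \<psi>_def by (intro continuous_intros contQ C Cy sndQ cw)
  have c\<psi>x: "continuous_on (?Q \<times> ?Q) (\<lambda>p. \<psi>x (fst p) (snd p))"
    unfolding \<psi>x_def by (intro continuous_intros contQ C Cy sndQ cw Ck_plane_deriv(1))
  have cLF: "continuous_on ?I LF" and cLR: "continuous_on ?I LR"
    unfolding LF LR by (intro continuous_intros F(2) R(2) cF cR w)+
  note cQ = continuous_on_subset[OF cF sub] continuous_on_subset[OF cR sub] continuous_on_subset[OF cLF sub] continuous_on_subset[OF cLR sub]
  \<comment> \<open>\<open>M\<close> is \<open>L\<^sub>x\<close> of the kernel; its value on the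
    diagonal is an arbitrary choice on a null set.\<close>
  define M where "M x y = (if x \<le> y then LF x * R y else LR x * F y)" for x y
  have supp\<psi>: "\<psi> x y = 0" "\<psi>x x y = 0" "\<phi> x y = 0" if "(x, y) \<notin> {c<..<d} \<times> {c<..<d}" for x y
    using supp[OF that] by (simp_all add: \<psi>_def \<psi>x_def)
  have K: "continuous_on (?Q \<times> ?Q) (\<lambda>p. weyl_kernel F R (fst p) (snd p))" "continuous_on (?Q \<times> ?Q) (\<lambda>p. weyl_kernel LF LR (fst p) (snd p))"
    using continuous_on_subset[OF weyl_kernel_continuous[OF cF cR], of "?Q \<times> ?Q"] continuous_on_subset[OF weyl_kernel_continuous[OF cLF cLR], of "?Q \<times> ?Q"] sub
    by (auto simp: case_prod_unfold)
  have int1: "set_integrable lborel (?Q \<times> ?Q) (\<lambda>p. weyl_kernel F R (fst p) (snd p) * (\<psi>x (fst p) (snd p) + of_real (w (fst p)) * \<psi> (fst p) (snd p)))"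
    by (intro continuous_on_square_set_integrable continuous_intros K c\<psi> c\<psi>x fstQ cw)
  have int2: "set_integrable lborel (?Q \<times> ?Q) (\<lambda>p. M (fst p) (snd p) * \<psi> (fst p) (snd p))"
  proof -
    have "set_integrable lborel (?Q \<times> ?Q) (\<lambda>p. if p \<in> {p. fst p \<le> snd p} then LF (fst p) * R (snd p) * \<psi> (fst p) (snd p) else LR (fst p) * F (snd p) * \<psi> (fst p) (snd p))"
      by (intro set_integrable_If continuous_on_square_set_integrable continuous_intros c\<psi> fstQ sndQ cQ)
        (auto intro!: borel_closed closed_Collect_le continuous_intros)
    moreover have "(\<lambda>p. if p \<in> {p. fst p \<le> snd p} then LF (fst p) * R (snd p) * \<psi> (fst p) (snd p) else LR (fst p) * F (snd p) * \<psi> (fst p) (snd p))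
       = (\<lambda>p. M (fst p) (snd p) * \<psi> (fst p) (snd p))" by (auto simp: M_def)
    ultimately show ?thesis by simp
  qed
  have int3: "set_integrable lborel (?Q \<times> ?Q) (\<lambda>p. weyl_kernel LF LR (fst p) (snd p) * \<phi> (fst p) (snd p))"
    by (intro continuous_on_square_set_integrable continuous_intros K contQ C)
  have slice_x: "continuous_on ?Q (\<lambda>x. g (x, y))" if "continuous_on (?Q \<times> ?Q) g" "y \<in> ?Q" for g :: "real \<times> real \<Rightarrow> complex" and y
    by (rule continuous_on_compose2[OF that(1)]) (use that(2) in \<open>auto intro!: continuous_intros\<close>)
  have slice_y: "continuous_on ?Q (\<lambda>y. g (x, y))" if "continuous_on (?Q \<times> ?Q) g" "x \<in> ?Q" for g :: "real \<times> real \<Rightarrow> complex" and x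
    by (rule continuous_on_compose2[OF that(1)]) (use that(2) in \<open>auto intro!: continuous_intros\<close>)
  have step1: "(LINT x:?Q|lborel. weyl_kernel F R x y * (\<psi>x x y + of_real (w x) * \<psi> x y)) = (LINT x:?Q|lborel. M x y * \<psi> x y)" if y: "y \<in> ?Q" for y
  proof -
    have "((\<lambda>x. weyl_kernel F R x y * (\<psi>x x y + of_real (w x) * \<psi> x y) - M x y * \<psi> x y) has_integral (F y * R y - R y * F y) * \<psi> y y) ?Q"
    proof (rule jump_by_parts[where A="\<lambda>x. F x * R y" and B="\<lambda>x. R x * F y" and A'="\<lambda>x. F' x * R y" and B'="\<lambda>x. R' x * F y"])
      show "((\<lambda>x. F x * R y) has_vector_derivative F' x * R y) (at x)" "((\<lambda>x. R x * F y) has_vector_derivative R' x * F y) (at x)" if "x \<in> ?Q" for x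
        using F(1)[of x] R(1)[of x] that sub by (auto intro!: has_vector_derivative_mult_left)
    qed (use y d\<psi> supp\<psi> in \<open>auto simp: weyl_kernel_simps M_def LF LR algebra_simps\<close>)
    moreover have "set_integrable lborel ?Q (\<lambda>x. weyl_kernel F R x y * (\<psi>x x y + of_real (w x) * \<psi> x y))"
      using slice_x[OF K(1) y] slice_x[OF c\<psi> y] slice_x[OF c\<psi>x y] by (intro continuous_on_Icc_set_integrable(1) continuous_intros cw) auto
    moreover have "set_integrable lborel ?Q (\<lambda>x. M x y * \<psi> x y)"
    proof -
      have "set_integrable lborel ?Q (\<lambda>x. if x \<in> {..y} then LF x * R y * \<psi> x y else LR x * F y * \<psi> x y)"
        using slice_x[OF c\<psi> y] by (intro set_integrable_If continuous_on_Icc_set_integrable(1) continuous_intros cQ) auto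
      moreover have "(\<lambda>x. if x \<in> {..y} then LF x * R y * \<psi> x y else LR x * F y * \<psi> x y) = (\<lambda>x. M x y * \<psi> x y)" by (auto simp: M_def)
      ultimately show ?thesis by simp
    qed
    ultimately have "(LINT x:?Q|lborel. weyl_kernel F R x y * (\<psi>x x y + of_real (w x) * \<psi> x y))
        = (F y * R y - R y * F y) * \<psi> y y + (LINT x:?Q|lborel. M x y * \<psi> x y)"
      by (intro set_lebesgue_integral_diff_has_integral)
    moreover have "F y * R y - R y * F y = 0" by simp
    ultimately show ?thesis by simp
  qed
  have step2: "(LINT y:?Q|lborel. M x y * \<psi> x y) = \<phi> x x + (LINT y:?Q|lborel. weyl_kernel LF LR x y * \<phi> x y)" if x: "x \<in> ?Q" for x
  proof -
    have "((\<lambda>y. M x y * (deriv_y \<phi> x y + of_real (w y) * \<phi> x y) - weyl_kernel LF LR x y * \<phi> x y) has_integral (LR x * F x - LF x * R x) * \<phi> x x) ?Q"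
    proof (rule jump_by_parts[where A="\<lambda>y. LR x * F y" and B="\<lambda>y. LF x * R y" and A'="\<lambda>y. LR x * F' y" and B'="\<lambda>y. LF x * R' y"])
      show "((\<lambda>y. LR x * F y) has_vector_derivative LR x * F' y) (at y)" "((\<lambda>y. LF x * R y) has_vector_derivative LF x * R' y) (at y)" if "y \<in> ?Q" for y
        using F(1)[of y] R(1)[of y] that sub by (auto intro!: has_vector_derivative_mult_right)
    qed (use x Ck_plane_deriv(4)[OF C] supp\<psi> in \<open>auto simp: weyl_kernel_simps M_def LF LR algebra_simps\<close>)
    \<comment> \<open>The terms with \<open>w\<close> cancel and the jump is minus the Wronskian;
      this is the coefficient of the delta distribution.\<close>
    moreover have "LR x * F x - LF x * R x = 1"
    proof -
      have "LR x * F x - LF x * R x = - (F x * R' x - F' x * R x)" by (simp add: LF LR algebra_simps)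
      also have "F x * R' x - F' x * R x = -1" using W x sub by blast
      finally show ?thesis by simp
    qed
    moreover have "set_integrable lborel ?Q (\<lambda>y. weyl_kernel LF LR x y * \<phi> x y)"
      using slice_y[OF K(2) x] slice_y[OF contQ[OF C] x] by (intro continuous_on_Icc_set_integrable(1) continuous_intros) auto
    moreover have "set_integrable lborel ?Q (\<lambda>y. M x y * \<psi> x y)"
    proof -
      have "set_integrable lborel ?Q (\<lambda>y. if y \<in> {x..} then LF x * R y * \<psi> x y else LR x * F y * \<psi> x y)"
        using slice_y[OF c\<psi> x] by (intro set_integrable_If continuous_on_Icc_set_integrable(1) continuous_intros cQ) auto
      moreover have "(\<lambda>y. if y \<in> {x..} then LF x * R y * \<psi> x y else LR x * F y * \<psi> x y) = (\<lambda>y. M x y * \<psi> x y)" by (auto simp: M_def)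
      ultimately show ?thesis by simp
    qed
    ultimately show ?thesis
      using set_lebesgue_integral_diff_has_integral[of c d "\<lambda>y. M x y * \<psi> x y" "\<lambda>y. weyl_kernel LF LR x y * \<phi> x y" "1 * \<phi> x x"]
      by (simp add: \<psi>_def)
  qed
  have "LL_dist ?I w (weyl_kernel F R) \<phi> = (LINT p:?Q \<times> ?Q|lborel. weyl_kernel F R (fst p) (snd p) * (\<psi>x (fst p) (snd p) + of_real (w (fst p)) * \<psi> (fst p) (snd p)))"
    unfolding LL_dist_def Psi[symmetric] by (rule kernel_dist_square[OF sub]) (simp add: Psi supp\<psi>)
  also have "\<dots> = (LINT y:?Q|lborel. LINT x:?Q|lborel. weyl_kernel F R x y * (\<psi>x x y + of_real (w x) * \<psi> x y))"
    using fubini_Icc(1)[OF int1] by simp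
  also have "\<dots> = (LINT y:?Q|lborel. LINT x:?Q|lborel. M x y * \<psi> x y)"
    by (rule set_lebesgue_integral_cong) (use step1 in auto)
  also have "\<dots> = (LINT x:?Q|lborel. LINT y:?Q|lborel. M x y * \<psi> x y)"
    using fubini_Icc(1,2)[OF int2] by simp
  also have "\<dots> = (LINT x:?Q|lborel. \<phi> x x + (LINT y:?Q|lborel. weyl_kernel LF LR x y * \<phi> x y))"
    by (rule set_lebesgue_integral_cong) (use step2 in auto)
  also have "\<dots> = (LINT x:?Q|lborel. \<phi> x x) + (LINT x:?Q|lborel. LINT y:?Q|lborel. weyl_kernel LF LR x y * \<phi> x y)"
  proof (rule set_integral_add(2))
    have "continuous_on ?Q (\<lambda>x. \<phi> (fst (x, x)) (snd (x, x)))"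
      by (rule continuous_on_compose2[OF contQ[OF C], of ?Q "\<lambda>x. (x, x)"]) (auto intro!: continuous_intros)
    then show "set_integrable lborel ?Q (\<lambda>x. \<phi> x x)" by (intro continuous_on_Icc_set_integrable(1)) simp
    show "set_integrable lborel ?Q (\<lambda>x. LINT y:?Q|lborel. weyl_kernel LF LR x y * \<phi> x y)"
      using fubini_Icc(3)[OF int3] by simp
  qed
  also have "(LINT x:?Q|lborel. LINT y:?Q|lborel. weyl_kernel LF LR x y * \<phi> x y) = kernel_dist ?I (weyl_kernel LF LR) \<phi>"
    using fubini_Icc(2)[OF int3] kernel_dist_square[OF sub, of \<phi> "weyl_kernel LF LR"] supp\<psi> by simp
  also have "(LINT x:?Q|lborel. \<phi> x x) = delta_dist ?I \<phi>"
    unfolding delta_dist_def by (rule set_lebesgue_integral_support[OF sub, symmetric]) (auto intro!: supp\<psi>(3))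
  finally show ?thesis by (simp add: add.commute)
qed

section \<open>Dependence on the energy\<close>

text \<open>Green's identity for \<open>f\<close> and a weight \<open>p\<close> with a double zero
  at \<open>y\<close>: only the boundary term at \<open>x\<close> remains. Replacing the second
  derivative of \<open>f\<close> by \<open>V f - h\<close> bounds it by integrals of
  \<open>cmod f\<close> and \<open>cmod h\<close>, hence by L2 norms.\<close>

lemma sobolev_test_function:
  assumes T: "(f, h) \<in> dirichlet_op a b V" and V: "continuous_on (einterval a b) V"
    and xy: "x < y" "{x..y} \<subseteq> einterval a b" and M: "\<And>s. s \<in> {x..y} \<Longrightarrow> \<bar>V s\<bar> \<le> M"
    and p: "\<And>s. (p has_vector_derivative p' s) (at s)" "\<And>s. (p' has_vector_derivative p'' s) (at s)" "p y = 0" "p' y = 0"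
    and P: "\<And>s. s \<in> {x..y} \<Longrightarrow> \<bar>p s\<bar> \<le> P" "\<And>s. s \<in> {x..y} \<Longrightarrow> \<bar>p'' s\<bar> \<le> P"
  shows "cmod (p x *\<^sub>R vderiv f x - p' x *\<^sub>R f x)
    \<le> P * (M + 1) * sqrt (y - x) * (L2_norm (einterval a b) f + L2_norm (einterval a b) h)"
proof -
  let ?I = "einterval a b"
  let ?f' = "vderiv f" and ?f'' = "vderiv (vderiv f)"
  note D = dirichlet_opD[OF T]
  have sub: "s \<in> {x..y} \<Longrightarrow> s \<in> ?I" for s using xy by blast
  have cf: "continuous_on {x..y} f" using C2_on_continuous(1)[OF D(1)] xy(2) continuous_on_subset by blast
  have cf2: "continuous_on {x..y} ?f''" using D(1) xy(2) continuous_on_subset unfolding C2_on_def by blast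
  have c: "continuous_on {x..y} (\<lambda>s. - ?f'' s + V s *\<^sub>R f s)"
    by (intro continuous_intros cf cf2 continuous_on_subset[OF V xy(2)])
  have h: "h s = - ?f'' s + V s *\<^sub>R f s" if "s \<in> {x..y}" for s
    using D(2)[OF sub[OF that]] by (simp add: schroedinger_def)
  have ch: "continuous_on {x..y} h" by (rule continuous_on_eq[OF c]) (use h in simp)
  have M0: "0 \<le> M" using M[of x] xy(1) by force
  have P0: "0 \<le> P" using P(1)[of x] xy(1) by force
  have "((\<lambda>s. p s *\<^sub>R ?f'' s - p'' s *\<^sub>R f s) has_integral
      (p y *\<^sub>R ?f' y - p' y *\<^sub>R f y) - (p x *\<^sub>R ?f' x - p' x *\<^sub>R f x)) {x..y}"
  proof (rule fundamental_theorem_of_calculus)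
    fix s assume s: "s \<in> {x..y}"
    note d = C2_onD[OF D(1) sub[OF s]]
    have dp: "(p has_real_derivative p' s) (at s)" "(p' has_real_derivative p'' s) (at s)"
      using p(1,2) by (simp_all add: has_real_derivative_iff_has_vector_derivative)
    have "((\<lambda>s. p s *\<^sub>R ?f' s - p' s *\<^sub>R f s) has_vector_derivative
        (p s *\<^sub>R ?f'' s + p' s *\<^sub>R ?f' s) - (p' s *\<^sub>R ?f' s + p'' s *\<^sub>R f s)) (at s)"
      by (intro has_vector_derivative_diff has_vector_derivative_scaleR d dp)
    then show "((\<lambda>s. p s *\<^sub>R ?f' s - p' s *\<^sub>R f s) has_vector_derivative p s *\<^sub>R ?f'' s - p'' s *\<^sub>R f s) (at s within {x..y})"
      by (simp add: has_vector_derivative_at_within)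
  qed (use xy in simp)
  then have hi: "((\<lambda>s. p s *\<^sub>R ?f'' s - p'' s *\<^sub>R f s) has_integral - (p x *\<^sub>R ?f' x - p' x *\<^sub>R f x)) {x..y}"
    using p(3,4) by simp
  have "cmod (- (p x *\<^sub>R ?f' x - p' x *\<^sub>R f x)) \<le> integral {x..y} (\<lambda>s. P * (M + 1) * (cmod (f s) + cmod (h s)))"
    unfolding integral_unique[OF hi, symmetric]
  proof (rule integral_norm_bound_integral)
    show "(\<lambda>s. p s *\<^sub>R ?f'' s - p'' s *\<^sub>R f s) integrable_on {x..y}" using hi by blast
    show "(\<lambda>s. P * (M + 1) * (cmod (f s) + cmod (h s))) integrable_on {x..y}"
      by (intro integrable_continuous_real continuous_intros cf ch)
    fix s assume s: "s \<in> {x..y}"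
    have "?f'' s = V s *\<^sub>R f s - h s" using h[OF s] by simp
    then have "cmod (?f'' s) \<le> \<bar>V s\<bar> * cmod (f s) + cmod (h s)"
      using norm_triangle_ineq4[of "V s *\<^sub>R f s" "h s"] by simp
    also have "\<dots> \<le> M * cmod (f s) + cmod (h s)" using M[OF s] by (intro add_right_mono mult_right_mono) auto
    finally have 1: "cmod (?f'' s) \<le> M * cmod (f s) + cmod (h s)" .
    have "cmod (p s *\<^sub>R ?f'' s - p'' s *\<^sub>R f s) \<le> \<bar>p s\<bar> * cmod (?f'' s) + \<bar>p'' s\<bar> * cmod (f s)"
      using norm_triangle_ineq4[of "p s *\<^sub>R ?f'' s" "p'' s *\<^sub>R f s"] by simp
    also have "\<dots> \<le> P * (M * cmod (f s) + cmod (h s)) + P * cmod (f s)"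
      using P[OF s] 1 P0 by (intro add_mono mult_mono) auto
    also have "\<dots> \<le> P * (M + 1) * (cmod (f s) + cmod (h s))"
      using mult_nonneg_nonneg[OF mult_nonneg_nonneg[OF P0 M0] norm_ge_zero[of "h s"]] by (simp add: algebra_simps)
    finally show "cmod (p s *\<^sub>R ?f'' s - p'' s *\<^sub>R f s) \<le> P * (M + 1) * (cmod (f s) + cmod (h s))" .
  qed
  also have "integral {x..y} (\<lambda>s. P * (M + 1) * (cmod (f s) + cmod (h s)))
      = P * (M + 1) * (integral {x..y} (\<lambda>s. cmod (f s)) + integral {x..y} (\<lambda>s. cmod (h s)))"
    by (rule integral_unique, intro has_integral_mult_right has_integral_add integrable_integral integrable_continuous_real continuous_intros cf ch)
  also have "\<dots> \<le> P * (M + 1) * (sqrt (y - x) * L2_norm ?I f + sqrt (y - x) * L2_norm ?I h)"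
    using P0 M0 by (intro mult_left_mono add_mono L1_le_L2_norm D(3,4) xy cf ch) auto
  finally show ?thesis by (simp add: algebra_simps norm_minus_commute)
qed

text \<open>With a cubic \<open>p\<close> that has a double zero at \<open>y\<close>, the integral of \<open>p f'' - p'' f\<close> over \<open>[x, y]\<close> singles out \<open>f(x)\<close> if
  \<open>p(x) = 0\<close>, and \<open>f'(x)\<close> if \<open>p'(x) = 0\<close>.\<close>

lemma sobolev_local:
  assumes V: "continuous_on (einterval a b) V" and cd: "c \<in> einterval a b" "d \<in> einterval a b"
  shows "\<exists>K\<ge>0. \<forall>f h x. (f, h) \<in> dirichlet_op a b V \<longrightarrow> x \<in> {c..d} \<longrightarrow>
    cmod (f x) \<le> K * (L2_norm (einterval a b) f + L2_norm (einterval a b) h) \<and>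
    cmod (vderiv f x) \<le> K * (L2_norm (einterval a b) f + L2_norm (einterval a b) h)"
proof -
  \<comment> \<open>The interval to the right of \<open>x\<close> has the fixed length
    \<open>e - d\<close>, so for every \<open>x\<close> in \<open>{c..d}\<close> it stays inside the
    compact set \<open>{c..e}\<close> and the constants do not depend on \<open>x\<close>.\<close>
  obtain e where e: "e \<in> einterval a b" "d < e" using einterval_greater_ex[OF cd(2)] by blast
  define r where "r = e - d"
  have r: "0 < r" using e by (simp add: r_def)
  have sub: "{c..e} \<subseteq> einterval a b" by (rule einterval_Icc_subset[OF cd(1) e(1)])
  have "compact (V ` {c..e})" using V sub by (intro compact_continuous_image) (auto intro: continuous_on_subset)
  then obtain M where "\<forall>z\<in>V ` {c..e}. norm z \<le> M" using compact_imp_bounded bounded_iff by metis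
  then have M: "\<And>z. z \<in> {c..e} \<Longrightarrow> \<bar>V z\<bar> \<le> M" by auto
  \<comment> \<open>A common, generous bound: on the interval of length \<open>r\<close> both cubics
    are at most \<open>3 * r ^ 3\<close>, and their second derivatives are at most
    \<open>18 * r\<close> in modulus.\<close>
  define P where "P = 3 * r ^ 3 + 18 * r"
  define Q where "Q = P * (\<bar>M\<bar> + 1) * sqrt r"
  have P0: "0 \<le> P" using r by (simp add: P_def)
  have Q0: "0 \<le> Q" using r P0 by (simp add: Q_def)
  \<comment> \<open>The two denominators are the values singled out at \<open>x\<close>:
    \<open>p' x = r\<^sup>2\<close> in front of \<open>f x\<close>, and \<open>q x = r ^ 3\<close>
    in front of the derivative.\<close>
  define K where "K = max (Q / r ^ 2) (Q / r ^ 3)"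
  have K0: "0 \<le> K" using r Q0 by (simp add: K_def le_max_iff_disj)
  have "cmod (f x) \<le> K * N \<and> cmod (vderiv f x) \<le> K * N"
    if T: "(f, h) \<in> dirichlet_op a b V" and x: "x \<in> {c..d}" and N: "N = L2_norm (einterval a b) f + L2_norm (einterval a b) h"
    for f h x N
  proof -
    have N0: "0 \<le> N" unfolding N using L2_norm_nonneg by (metis add_nonneg_nonneg)
    define y where "y = x + r"
    have xy: "x < y" "y - x = r" using r by (auto simp: y_def)
    have "y \<le> e" "c \<le> x" using x by (auto simp: y_def r_def)
    then have sub2: "{x..y} \<subseteq> {c..e}" by auto
    have M': "\<bar>V s\<bar> \<le> \<bar>M\<bar>" if "s \<in> {x..y}" for s using M[of s] that sub2 by fastforce
    note main = sobolev_test_function[OF T V xy(1) order_trans[OF sub2 sub] M', of _ _ _ P]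
    have t: "0 \<le> s - x" "s - x \<le> r" if "s \<in> {x..y}" for s using that by (auto simp: y_def)
    define p where "p s = (s - x) * (r - (s - x))\<^sup>2" for s
    define p' where "p' s = (r - (s - x))\<^sup>2 - 2 * (s - x) * (r - (s - x))" for s
    define p'' where "p'' s = 6 * (s - x) - 4 * r" for s
    have dp: "(p has_vector_derivative p' s) (at s)" "(p' has_vector_derivative p'' s) (at s)" for s
      unfolding has_real_derivative_iff_has_vector_derivative[symmetric] p_def[abs_def] p'_def[abs_def] p''_def
      by (auto intro!: derivative_eq_intros simp: power2_eq_square algebra_simps)
    have pb: "\<bar>p s\<bar> \<le> P" "\<bar>p'' s\<bar> \<le> P" if "s \<in> {x..y}" for s
    proof -
      have "(s - x) * (r - (s - x))\<^sup>2 \<le> r * r\<^sup>2" using t[OF that] by (intro mult_mono power_mono) auto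
      moreover have "0 \<le> (s - x) * (r - (s - x))\<^sup>2" using t[OF that] by simp
      moreover have "r * r\<^sup>2 = r ^ 3" "0 \<le> r ^ 3" using r by (simp_all add: power2_eq_square power3_eq_cube)
      ultimately show "\<bar>p s\<bar> \<le> P" using r unfolding p_def P_def by linarith
      have "\<bar>p'' s\<bar> \<le> 18 * r" using t[OF that] unfolding p''_def by (simp add: abs_le_iff)
      moreover have "0 \<le> 3 * r ^ 3" using r by simp
      ultimately show "\<bar>p'' s\<bar> \<le> P" unfolding P_def by (intro add_increasing)
    qed
    have "cmod (p x *\<^sub>R vderiv f x - p' x *\<^sub>R f x) \<le> P * (\<bar>M\<bar> + 1) * sqrt (y - x) * N"
      unfolding N by (rule main[OF _ dp _ _ pb]) (auto simp: p_def p'_def y_def)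
    then have "r\<^sup>2 * cmod (f x) \<le> Q * N" by (simp add: p_def p'_def Q_def xy(2))
    then have "cmod (f x) \<le> (Q / r\<^sup>2) * N" using r by (simp add: field_simps)
    also have "\<dots> \<le> K * N" using N0 by (intro mult_right_mono) (auto simp: K_def)
    finally have 1: "cmod (f x) \<le> K * N" .
    define q where "q s = (r - (s - x))\<^sup>2 * (r + 2 * (s - x))" for s
    define q' where "q' s = 6 * (s - x) * ((s - x) - r)" for s
    define q'' where "q'' s = 12 * (s - x) - 6 * r" for s
    have dq: "(q has_vector_derivative q' s) (at s)" "(q' has_vector_derivative q'' s) (at s)" for s
      unfolding has_real_derivative_iff_has_vector_derivative[symmetric] q_def[abs_def] q'_def[abs_def] q''_def
      by (auto intro!: derivative_eq_intros simp: power2_eq_square algebra_simps)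
    have qb: "\<bar>q s\<bar> \<le> P" "\<bar>q'' s\<bar> \<le> P" if "s \<in> {x..y}" for s
    proof -
      have "(r - (s - x))\<^sup>2 * (r + 2 * (s - x)) \<le> r\<^sup>2 * (3 * r)" using t[OF that] by (intro mult_mono power_mono) auto
      moreover have "0 \<le> (r - (s - x))\<^sup>2 * (r + 2 * (s - x))" using t[OF that] r by simp
      moreover have "r\<^sup>2 * (3 * r) = 3 * r ^ 3" by (simp add: power2_eq_square power3_eq_cube)
      ultimately show "\<bar>q s\<bar> \<le> P" using r unfolding q_def P_def by linarith
      have "\<bar>q'' s\<bar> \<le> 18 * r" using t[OF that] unfolding q''_def by (simp add: abs_le_iff)
      moreover have "0 \<le> 3 * r ^ 3" using r by simp
      ultimately show "\<bar>q'' s\<bar> \<le> P" unfolding P_def by (intro add_increasing)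
    qed
    have "cmod (q x *\<^sub>R vderiv f x - q' x *\<^sub>R f x) \<le> P * (\<bar>M\<bar> + 1) * sqrt (y - x) * N"
      unfolding N by (rule main[OF _ dq _ _ qb]) (auto simp: q_def q'_def y_def)
    then have "r ^ 3 * cmod (vderiv f x) \<le> Q * N" using r by (simp add: q_def q'_def Q_def xy(2) power2_eq_square power3_eq_cube)
    then have "cmod (vderiv f x) \<le> (Q / r ^ 3) * N" using r by (simp add: field_simps)
    also have "\<dots> \<le> K * N" using N0 by (intro mult_right_mono) (auto simp: K_def)
    finally show ?thesis using 1 by simp
  qed
  then show ?thesis using K0 by blast
qed

section \<open>Limits at the centre of a disc, and L2 bounds for Weyl kernels\<close>

lemma ball_sequence:
  fixes z :: complex
  assumes "r > 0"
  obtains e where "\<And>n::nat. e n \<in> ball z r - {z}" "e \<longlonglongrightarrow> z"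
proof -
  define e where "e n = z + of_real (r / (real n + 2))" for n :: nat
  have pos: "0 < r / (real n + 2)" "r / (real n + 2) < r" for n using assms by (auto simp: field_simps intro: add_pos_nonneg)
  have e: "e n \<in> ball z r - {z}" for n
    using pos[of n] unfolding e_def by (auto simp: dist_norm norm_of_real simp del: of_real_divide of_real_add)
  have "(\<lambda>n. r / (real n + 2)) \<longlonglongrightarrow> 0" by real_asymp
  then have "(\<lambda>n. z + of_real (r / (real n + 2))) \<longlonglongrightarrow> z + of_real 0" by (intro tendsto_intros)
  then have "e \<longlonglongrightarrow> z" unfolding e_def[abs_def] by simp
  with e show thesis by (rule that)
qed

text \<open>Along one sequence tending to \<open>z\<close> the values of \<open>D\<close> are
  Cauchy, and the Lipschitz bound passes to the limit with the same \<open>K\<close>. The centre is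
  excluded since \<open>D\<close> will be a divided difference, or a Green function at an energy
  without a Weyl pair at hand.\<close>

lemma lipschitz_limit:
  fixes D :: "complex \<Rightarrow> complex"
  assumes "r > 0" and D: "\<And>E1 E2. E1 \<in> ball z r - {z} \<Longrightarrow> E2 \<in> ball z r - {z} \<Longrightarrow> cmod (D E1 - D E2) \<le> K * cmod (E1 - E2)"
  shows "\<exists>l. \<forall>E\<in>ball z r - {z}. cmod (D E - l) \<le> K * cmod (E - z)"
proof -
  obtain e where e: "\<And>n::nat. e n \<in> ball z r - {z}" and elim: "e \<longlonglongrightarrow> z" by (rule ball_sequence[OF assms(1)]) blast
  have K: "K * cmod (E1 - E2) \<le> \<bar>K\<bar> * cmod (E1 - E2)" for E1 E2 by (intro mult_right_mono) auto
  have "Cauchy (\<lambda>n. D (e n))"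
  proof (rule metric_CauchyI)
    fix \<epsilon> :: real assume \<epsilon>: "\<epsilon> > 0"
    then have "\<epsilon> / (\<bar>K\<bar> + 1) > 0" by simp
    from metric_CauchyD[OF LIMSEQ_imp_Cauchy[OF elim] this]
    obtain N where N: "\<And>m n. m \<ge> N \<Longrightarrow> n \<ge> N \<Longrightarrow> dist (e m) (e n) < \<epsilon> / (\<bar>K\<bar> + 1)" by blast
    show "\<exists>M. \<forall>m\<ge>M. \<forall>n\<ge>M. dist (D (e m)) (D (e n)) < \<epsilon>"
    proof (intro exI[of _ N] allI impI)
      fix m n assume "N \<le> m" "N \<le> n"
      have "dist (D (e m)) (D (e n)) \<le> \<bar>K\<bar> * dist (e m) (e n)"
        using D[OF e e, of m n] K[of "e m" "e n"] by (simp add: dist_norm)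
      also have "\<dots> \<le> (\<bar>K\<bar> + 1) * dist (e m) (e n)" by (intro mult_right_mono) auto
      also have "\<dots> < \<epsilon>" using N[OF \<open>N \<le> m\<close> \<open>N \<le> n\<close>] by (simp add: field_simps)
      finally show "dist (D (e m)) (D (e n)) < \<epsilon>" .
    qed
  qed
  then obtain l where l: "(\<lambda>n. D (e n)) \<longlonglongrightarrow> l" using Cauchy_convergent_iff convergent_def by blast
  have "cmod (D E - l) \<le> K * cmod (E - z)" if "E \<in> ball z r - {z}" for E
  proof (rule tendsto_le[OF sequentially_bot])
    show "(\<lambda>n. K * cmod (E - e n)) \<longlonglongrightarrow> K * cmod (E - z)" by (intro tendsto_intros elim)
    show "(\<lambda>n. cmod (D E - D (e n))) \<longlonglongrightarrow> cmod (D E - l)" by (intro tendsto_intros l)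
  qed (use D[OF that e] in simp)
  then show ?thesis by blast
qed

lemma has_vector_derivative_glue:
  assumes f: "(f has_vector_derivative f' x) (at x)" and g: "(g has_vector_derivative g' x) (at x)"
    and eq: "f y = g y" "f' y = g' y"
  shows "((\<lambda>s. if s \<le> y then f s else g s) has_vector_derivative (if x \<le> y then f' x else g' x)) (at x)"
proof -
  have "((\<lambda>s. if s \<in> {..y} then f s else g s) has_vector_derivative (if x \<in> {..y} then f' x else g' x)) (at x within UNIV)"
    by (rule has_vector_derivative_If_within_closures[where T="{y<..}"])
      (use f g eq in \<open>auto intro: has_vector_derivative_at_within\<close>)
  then show ?thesis by simp
qed

lemma L2_support:
  assumes "A \<subseteq> B" "\<And>x. x \<in> B \<Longrightarrow> x \<notin> A \<Longrightarrow> f x = 0"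
  shows "f \<in> L2 B \<longleftrightarrow> f \<in> L2 A"
proof -
  have "(\<lambda>x. indicator B x *\<^sub>R f x) = (\<lambda>x. indicator A x *\<^sub>R f x)"
    "(\<lambda>x. indicator B x *\<^sub>R (cmod (f x))\<^sup>2) = (\<lambda>x. indicator A x *\<^sub>R (cmod (f x))\<^sup>2)"
    using assms by (auto simp: indicator_def fun_eq_iff)
  then show ?thesis by (simp add: L2_def set_borel_measurable_def set_integrable_def)
qed

lemma continuous_bounded_Icc:
  fixes f :: "real \<Rightarrow> complex"
  assumes "continuous_on {c..d} f"
  obtains M where "0 \<le> M" "\<And>x. x \<in> {c..d} \<Longrightarrow> cmod (f x) \<le> M"
proof -
  have "bounded (f ` {c..d})" using assms by (intro compact_imp_bounded compact_continuous_image) auto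
  then obtain M where "\<forall>z\<in>f ` {c..d}. norm z \<le> M" using bounded_iff by blast
  then show thesis by (intro that[of "\<bar>M\<bar>"]) (auto intro: order_trans[OF _ abs_ge_self])
qed

text \<open>For \<open>y\<close> in \<open>{c..d}\<close> the kernel is dominated by constant
  multiples of \<open>F\<close> cut off beyond \<open>d\<close> and of \<open>R\<close> cut off
  before \<open>c\<close>. These functions are square integrable on the whole interval and do not
  depend on \<open>y\<close>.\<close>

lemma weyl_kernel_L2:
  assumes ab: "a < b" and w: "weyl_pair a b V E F F' R R'" and cd: "c \<in> einterval a b" "d \<in> einterval a b"
  shows "\<exists>B\<ge>0. \<forall>y\<in>{c..d}. (\<lambda>x. weyl_kernel F R x y) \<in> L2 (einterval a b) \<and>
    L2_norm (einterval a b) (\<lambda>x. weyl_kernel F R x y) \<le> B"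
proof -
  let ?I = "einterval a b"
  note W = weyl_pairD[OF w]
  have cF: "continuous_on ?I F" and cR: "continuous_on ?I R" using W schroedinger_sol_continuous by blast+
  have sub: "{c..d} \<subseteq> ?I" by (rule einterval_Icc_subset[OF cd])
  obtain NF where NF: "0 \<le> NF" "\<And>x. x \<in> {c..d} \<Longrightarrow> cmod (F x) \<le> NF"
    by (rule continuous_bounded_Icc[OF continuous_on_subset[OF cF sub]]) blast
  obtain NR where NR: "0 \<le> NR" "\<And>x. x \<in> {c..d} \<Longrightarrow> cmod (R x) \<le> NR"
    by (rule continuous_bounded_Icc[OF continuous_on_subset[OF cR sub]]) blast
  obtain e where e: "e \<in> ?I" "d < e" using einterval_greater_ex[OF cd(2)] by blast
  obtain e' where e': "e' \<in> ?I" "e' < c" using einterval_less_ex[OF cd(1)] by blast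
  define F1 where "F1 x = (if x \<le> d then F x else 0)" for x
  define R1 where "R1 x = (if c \<le> x then R x else 0)" for x
  have tr: "(\<lambda>x. if P x then f x else 0) \<in> L2 J" if "f \<in> L2 J" "{x. P x} \<in> sets borel" for f J P
  proof -
    have "(\<lambda>x. indicator {x. P x} x *\<^sub>R (indicator J x *\<^sub>R f x)) \<in> borel_measurable lborel"
      using L2_measurable[OF that(1)] that(2) unfolding set_borel_measurable_def by measurable
    moreover have "(\<lambda>x. indicator {x. P x} x *\<^sub>R (indicator J x *\<^sub>R f x)) = (\<lambda>x. indicator J x *\<^sub>R (if P x then f x else 0))"
      by (auto simp: indicator_def)
    ultimately have m: "set_borel_measurable lborel J (\<lambda>x. if P x then f x else 0)" by (simp only: set_borel_measurable_def)
    have "integrable lborel (\<lambda>x. indicator {x. P x} x *\<^sub>R (indicator J x *\<^sub>R (cmod (f x))\<^sup>2))"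
      by (rule integrable_mult_indicator) (use L2_integrable[OF that(1)] that(2) in \<open>auto simp: set_integrable_def\<close>)
    moreover have "(\<lambda>x. indicator {x. P x} x *\<^sub>R (indicator J x *\<^sub>R (cmod (f x))\<^sup>2)) = (\<lambda>x. indicator J x *\<^sub>R (cmod (if P x then f x else 0))\<^sup>2)"
      by (auto simp: indicator_def)
    ultimately show ?thesis using m by (simp only: L2_def set_integrable_def mem_Collect_eq)
  qed
  have F1: "F1 \<in> L2 ?I"
  proof (subst L2_support[OF einterval_half_subset(1)[OF e(1)]])
    show "F1 \<in> L2 (einterval a (ereal e))" unfolding F1_def[abs_def]
      by (rule tr) (use W(3) e(1) in \<open>auto simp: adm_left_def\<close>)
  qed (use e(2) in \<open>auto simp: F1_def einterval_iff\<close>)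
  have R1: "R1 \<in> L2 ?I"
  proof (subst L2_support[OF einterval_half_subset(2)[OF e'(1)]])
    show "R1 \<in> L2 (einterval (ereal e') b)" unfolding R1_def[abs_def]
      by (rule tr) (use W(4) e'(1) in \<open>auto simp: adm_right_def\<close>)
  qed (use e'(2) in \<open>auto simp: R1_def einterval_iff\<close>)
  let ?D = "\<lambda>x. 2 * NR\<^sup>2 * (cmod (F1 x))\<^sup>2 + 2 * NF\<^sup>2 * (cmod (R1 x))\<^sup>2"
  have iD: "set_integrable lborel ?I ?D"
    by (intro set_integral_add set_integrable_mult_right) (use L2_integrable[OF F1] L2_integrable[OF R1] in auto)
  define B where "B = sqrt (LINT x:?I|lborel. ?D x)"
  have main: "(\<lambda>x. weyl_kernel F R x y) \<in> L2 ?I \<and> L2_norm ?I (\<lambda>x. weyl_kernel F R x y) \<le> B" if y: "y \<in> {c..d}" for y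
  proof -
    have "continuous_on ?I (\<lambda>x. weyl_kernel F R y x)"
      by (rule continuous_on_slice[OF weyl_kernel_continuous[OF cF cR]]) (use y sub in auto)
    then have cW: "continuous_on ?I (\<lambda>x. weyl_kernel F R x y)" by (simp add: weyl_kernel_sym[of F R _ y])
    have le: "(cmod (weyl_kernel F R x y))\<^sup>2 \<le> ?D x" for x
    proof (cases "x \<le> y")
      case True
      then have "cmod (weyl_kernel F R x y) \<le> NR * cmod (F1 x)"
        using y mult_right_mono[OF NR(2)[OF y], of "cmod (F x)"] by (simp add: weyl_kernel_simps F1_def norm_mult mult.commute)
      then have "(cmod (weyl_kernel F R x y))\<^sup>2 \<le> (NR * cmod (F1 x))\<^sup>2" by (intro power_mono) auto
      moreover have "0 \<le> NR\<^sup>2 * (cmod (F1 x))\<^sup>2" "0 \<le> NF\<^sup>2 * (cmod (R1 x))\<^sup>2" by simp_all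
      ultimately show ?thesis unfolding power_mult_distrib by linarith
    next
      case False
      then have "cmod (weyl_kernel F R x y) \<le> NF * cmod (R1 x)"
        using y mult_right_mono[OF NF(2)[OF y], of "cmod (R x)"] by (simp add: weyl_kernel_simps R1_def norm_mult mult.commute)
      then have "(cmod (weyl_kernel F R x y))\<^sup>2 \<le> (NF * cmod (R1 x))\<^sup>2" by (intro power_mono) auto
      moreover have "0 \<le> NR\<^sup>2 * (cmod (F1 x))\<^sup>2" "0 \<le> NF\<^sup>2 * (cmod (R1 x))\<^sup>2" by simp_all
      ultimately show ?thesis unfolding power_mult_distrib by linarith
    qed
    have int: "set_integrable lborel ?I (\<lambda>x. (cmod (weyl_kernel F R x y))\<^sup>2)"
    proof (rule set_integrable_bound[OF iD], rule continuous_on_set_borel_measurable)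
      show "AE x in lborel. x \<in> ?I \<longrightarrow> norm ((cmod (weyl_kernel F R x y))\<^sup>2) \<le> norm (?D x)"
      proof (intro AE_I2 impI)
        fix x show "norm ((cmod (weyl_kernel F R x y))\<^sup>2) \<le> norm (?D x)"
          using le[of x] abs_ge_self[of "?D x"] unfolding real_norm_def abs_power2 by linarith
      qed
    qed (intro continuous_intros cW, simp)
    then have L: "(\<lambda>x. weyl_kernel F R x y) \<in> L2 ?I"
      using continuous_on_set_borel_measurable[OF cW] by (simp add: L2_def)
    have "(LINT x:?I|lborel. (cmod (weyl_kernel F R x y))\<^sup>2) \<le> (LINT x:?I|lborel. ?D x)"
      by (rule set_integral_mono[OF int iD le])
    then show ?thesis using L by (simp add: L2_norm_def B_def)
  qed
  have "0 \<le> (LINT x:?I|lborel. ?D x)"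
    unfolding set_lebesgue_integral_def by (rule Bochner_Integration.integral_nonneg) simp
  then have "0 \<le> B" by (simp add: B_def)
  then show ?thesis using main by blast
qed

text \<open>A set of energies with one resolvent constant \<open>C\<close> and one bound
  \<open>M\<close>. The Weyl solutions at different energies are unrelated choices. \<open>S\<close>
  is an arbitrary set so that it may be a punctured disc.\<close>

locale green_family =
  fixes a b :: ereal and V :: "real \<Rightarrow> real" and S :: "complex set" and C M :: real
    and G :: "real \<Rightarrow> real \<Rightarrow> complex \<Rightarrow> complex" and F F' R R' :: "complex \<Rightarrow> real \<Rightarrow> complex"
  assumes ab: "a < b" and V: "continuous_on (einterval a b) V"
    and weyl: "\<And>E. E \<in> S \<Longrightarrow> weyl_pair a b V E (F E) (F' E) (R E) (R' E)"
    and bound: "\<And>E. E \<in> S \<Longrightarrow> resolvent_bound a b V E C"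
    and M: "\<And>E. E \<in> S \<Longrightarrow> cmod E \<le> M"
    and G: "\<And>E x y. E \<in> S \<Longrightarrow> x \<in> einterval a b \<Longrightarrow> y \<in> einterval a b \<Longrightarrow> G x y E = weyl_kernel (F E) (R E) x y"
begin

abbreviation I where "I \<equiv> einterval a b"
abbreviation \<gamma> where "\<gamma> E y \<equiv> \<lambda>x. weyl_kernel (F E) (R E) x y"

text \<open>Off the diagonal this is the derivative of \<open>\<gamma> E y\<close>. On the diagonal
  the left branch is taken for every energy, so differences of \<open>\<gamma>'\<close> are genuine
  derivatives.\<close>

definition \<gamma>' where "\<gamma>' E y x = (if x \<le> y then F' E x * R E y else R' E x * F E y)"

lemma F_continuous: "E \<in> S \<Longrightarrow> continuous_on I (F E)" and R_continuous: "E \<in> S \<Longrightarrow> continuous_on I (R E)"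
  using weyl_pairD(1,2)[OF weyl] schroedinger_sol_continuous(1) by blast+

lemma \<gamma>_continuous:
  assumes "E \<in> S" "y \<in> I" shows "continuous_on I (\<gamma> E y)"
  using continuous_on_slice[OF weyl_kernel_continuous[OF F_continuous[OF assms(1)] R_continuous[OF assms(1)]] assms(2) order_refl]
  by (simp add: weyl_kernel_sym[of _ _ _ y])

lemma \<gamma>_L2:
  assumes "E \<in> S" "y \<in> I" shows "\<gamma> E y \<in> L2 I"
  using weyl_kernel_L2[OF ab weyl[OF assms(1)] assms(2,2)] by auto

text \<open>The jump of the derivative on the diagonal does not depend on the energy, so it cancels in a difference.\<close>

lemma \<gamma>_diff:
  assumes E: "E \<in> S" "E0 \<in> S" and y: "y \<in> I"
  shows "(\<lambda>x. \<gamma> E y x - \<gamma> E0 y x, \<lambda>x. E * (\<gamma> E y x - \<gamma> E0 y x) + (E - E0) * \<gamma> E0 y x) \<in> dirichlet_op a b V"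
    "\<And>x. x \<in> I \<Longrightarrow> vderiv (\<lambda>x. \<gamma> E y x - \<gamma> E0 y x) x = \<gamma>' E y x - \<gamma>' E0 y x"
proof -
  note W = weyl_pairD[OF weyl[OF E(1)]] and W0 = weyl_pairD[OF weyl[OF E(2)]]
  let ?d = "\<lambda>x. \<gamma> E y x - \<gamma> E0 y x" and ?d' = "\<lambda>x. \<gamma>' E y x - \<gamma>' E0 y x"
  define fl where "fl x = F E x * R E y - F E0 x * R E0 y" for x
  define fr where "fr x = R E x * F E y - R E0 x * F E0 y" for x
  define fl' where "fl' x = F' E x * R E y - F' E0 x * R E0 y" for x
  define fr' where "fr' x = R' E x * F E y - R' E0 x * F E0 y" for x
  have d: "?d x = (if x \<le> y then fl x else fr x)" for x by (simp add: weyl_kernel_simps fl_def fr_def)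
  have d': "?d' x = (if x \<le> y then fl' x else fr' x)" for x by (simp add: \<gamma>'_def fl'_def fr'_def)
  have s: "schroedinger_sol I V E (\<lambda>x. (E - E0) * \<gamma> E0 y x) ?d ?d'"
    unfolding schroedinger_sol_def
  proof (intro ballI conjI)
    fix x assume x: "x \<in> I"
    have D: "(F E has_vector_derivative F' E x) (at x)" "(R E has_vector_derivative R' E x) (at x)"
      "(F E0 has_vector_derivative F' E0 x) (at x)" "(R E0 has_vector_derivative R' E0 x) (at x)"
      "(F' E has_vector_derivative (of_real (V x) - E) * F E x) (at x)" "(R' E has_vector_derivative (of_real (V x) - E) * R E x) (at x)"
      "(F' E0 has_vector_derivative (of_real (V x) - E0) * F E0 x) (at x)" "(R' E0 has_vector_derivative (of_real (V x) - E0) * R E0 x) (at x)"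
      using W(1,2) W0(1,2) x by (auto simp: schroedinger_sol_def)
    have l1: "(fl has_vector_derivative fl' x) (at x)" and r1: "(fr has_vector_derivative fr' x) (at x)"
      unfolding fl_def[abs_def] fr_def[abs_def] fl'_def fr'_def
      by (intro has_vector_derivative_diff has_vector_derivative_mult_left D)+
    have l2: "(fl' has_vector_derivative (of_real (V x) - E) * F E x * R E y - (of_real (V x) - E0) * F E0 x * R E0 y) (at x)"
      and r2: "(fr' has_vector_derivative (of_real (V x) - E) * R E x * F E y - (of_real (V x) - E0) * R E0 x * F E0 y) (at x)"
      unfolding fl'_def[abs_def] fr'_def[abs_def]
      by (intro has_vector_derivative_diff has_vector_derivative_mult_left D)+
    have "fl y = fr y" by (simp add: fl_def fr_def)
    moreover have e': "fl' y = fr' y"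
    proof -
      have "fl' y - fr' y = (F E0 y * R' E0 y - F' E0 y * R E0 y) - (F E y * R' E y - F' E y * R E y)"
        by (simp add: fl'_def fr'_def algebra_simps)
      then show ?thesis unfolding W(5)[OF y] W0(5)[OF y] by simp
    qed
    ultimately show "(?d has_vector_derivative ?d' x) (at x)"
      unfolding d d' using has_vector_derivative_glue[of fl fl' x fr fr' y] l1 r1 by blast
    let ?l = "\<lambda>x. (of_real (V x) - E) * F E x * R E y - (of_real (V x) - E0) * F E0 x * R E0 y"
    let ?r = "\<lambda>x. (of_real (V x) - E) * R E x * F E y - (of_real (V x) - E0) * R E0 x * F E0 y"
    have "((\<lambda>s. if s \<le> y then fl' s else fr' s) has_vector_derivative (if x \<le> y then ?l x else ?r x)) (at x)"
      by (rule has_vector_derivative_glue[of fl' ?l x fr' ?r y]) (use l2 r2 e' in \<open>auto simp: algebra_simps\<close>)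
    moreover have "(if x \<le> y then ?l x else ?r x) = (of_real (V x) - E) * ?d x - (E - E0) * \<gamma> E0 y x"
      by (simp add: weyl_kernel_simps algebra_simps)
    ultimately show "(?d' has_vector_derivative (of_real (V x) - E) * ?d x - (E - E0) * \<gamma> E0 y x) (at x)"
      unfolding d' by simp
  qed
  have cg: "continuous_on I (\<lambda>x. (E - E0) * \<gamma> E0 y x)" by (intro continuous_intros \<gamma>_continuous E y)
  have cd: "continuous_on I ?d" by (intro continuous_intros \<gamma>_continuous E y)
  have al: "adm_left a b ?d"
  proof (rule adm_left_cong[OF cd y])
    show "vanishes_left a (\<lambda>x. R E y * F E x + (- R E0 y) * F E0 x)" "(\<lambda>x. R E y * F E x + (- R E0 y) * F E0 x) \<in> L2 (einterval a (ereal y))"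
      using adm_left_lincomb[OF W(3) W0(3), of "R E y" "- R E0 y"] y by (auto simp: adm_left_def)
    fix x assume "x \<in> einterval a (ereal y)"
    then show "?d x = R E y * F E x + (- R E0 y) * F E0 x" by (simp add: einterval_iff weyl_kernel_simps mult.commute)
  qed
  have ar: "adm_right a b ?d"
  proof (rule adm_right_cong[OF cd y])
    show "vanishes_right b (\<lambda>x. F E y * R E x + (- F E0 y) * R E0 x)" "(\<lambda>x. F E y * R E x + (- F E0 y) * R E0 x) \<in> L2 (einterval (ereal y) b)"
      using adm_right_lincomb[OF W(4) W0(4), of "F E y" "- F E0 y"] y by (auto simp: adm_right_def)
    fix x assume "x \<in> einterval (ereal y) b"
    then show "?d x = F E y * R E x + (- F E0 y) * R E0 x" by (simp add: einterval_iff weyl_kernel_simps mult.commute)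
  qed
  show "(?d, \<lambda>x. E * ?d x + (E - E0) * \<gamma> E0 y x) \<in> dirichlet_op a b V"
    by (rule dirichlet_opI[OF s V cg _ al ar ab refl]) (intro L2_scale \<gamma>_L2 E y)
  show "\<And>x. x \<in> I \<Longrightarrow> vderiv ?d x = ?d' x"
    by (rule schroedinger_sol_C2(2)[OF s open_einterval V cg])
qed

lemma L2_norm_resolvent:
  assumes "E \<in> S" "(f, \<lambda>x. E * f x + g x) \<in> dirichlet_op a b V"
  shows "L2_norm I f \<le> C * L2_norm I g"
  by (rule resolvent_boundD[OF bound[OF assms(1)] assms(2) refl])

text \<open>The local Sobolev inequality needs the norms of \<open>f\<close> and of
  \<open>h f = E f + g\<close>. Given \<open>C\<close> and \<open>M\<close>, the norm of
  \<open>g\<close> controls both, uniformly over the energies in \<open>S\<close>.\<close>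

lemma pointwise_resolvent:
  assumes cd: "c \<in> I" "d \<in> I"
  shows "\<exists>K\<ge>0. \<forall>E f g x. E \<in> S \<longrightarrow> (f, \<lambda>x. E * f x + g x) \<in> dirichlet_op a b V \<longrightarrow> g \<in> L2 I \<longrightarrow> x \<in> {c..d} \<longrightarrow>
    cmod (f x) \<le> K * L2_norm I g \<and> cmod (vderiv f x) \<le> K * L2_norm I g"
proof -
  obtain K where K: "K \<ge> 0" "\<And>f h x. (f, h) \<in> dirichlet_op a b V \<Longrightarrow> x \<in> {c..d} \<Longrightarrow>
    cmod (f x) \<le> K * (L2_norm I f + L2_norm I h) \<and> cmod (vderiv f x) \<le> K * (L2_norm I f + L2_norm I h)"
    using sobolev_local[OF V cd] by blast
  define K2 where "K2 = K * (\<bar>C\<bar> + 2 * (\<bar>M\<bar> * \<bar>C\<bar> + 1))"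
  have "cmod (f x) \<le> K2 * L2_norm I g \<and> cmod (vderiv f x) \<le> K2 * L2_norm I g"
    if E: "E \<in> S" and T: "(f, \<lambda>x. E * f x + g x) \<in> dirichlet_op a b V" and g: "g \<in> L2 I" and x: "x \<in> {c..d}" for E f g x
  proof -
    have N: "0 \<le> L2_norm I g" "0 \<le> L2_norm I f" by (rule L2_norm_nonneg)+
    have C: "C > 0" using resolvent_bound_pos[OF bound[OF E]] .
    have f: "L2_norm I f \<le> C * L2_norm I g" by (rule L2_norm_resolvent[OF E T])
    have "L2_norm I (\<lambda>x. E * f x + 1 * g x) \<le> 2 * (cmod E * L2_norm I f + cmod 1 * L2_norm I g)"
      by (rule L2_norm_lincomb[OF dirichlet_opD(3)[OF T] g])
    also have "\<dots> \<le> 2 * (\<bar>M\<bar> * (C * L2_norm I g) + cmod 1 * L2_norm I g)"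
      using M[OF E] f N C by (intro mult_left_mono add_right_mono mult_mono) auto
    finally have "L2_norm I f + L2_norm I (\<lambda>x. E * f x + g x) \<le> (\<bar>C\<bar> + 2 * (\<bar>M\<bar> * \<bar>C\<bar> + 1)) * L2_norm I g"
      using f C by (simp add: algebra_simps)
    then have "K * (L2_norm I f + L2_norm I (\<lambda>x. E * f x + g x)) \<le> K2 * L2_norm I g"
      unfolding K2_def mult.assoc by (rule mult_left_mono[OF _ K(1)])
    then show ?thesis using K(2)[OF T x] by linarith
  qed
  moreover have "0 \<le> K2" using K(1) by (simp add: K2_def)
  ultimately show ?thesis by blast
qed

text \<open>\<open>weyl_kernel_L2\<close> treats a single energy \<open>E0\<close>. The step to the
  others goes through the difference of kernels, which solves an equation with source
  \<open>(E - E0) * \<gamma> E0 y\<close>, where \<open>cmod (E - E0) \<le> 2 * M\<close>.\<close>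

lemma \<gamma>_bounded:
  assumes cd: "c \<in> I" "d \<in> I"
  shows "\<exists>B\<ge>0. \<forall>E\<in>S. \<forall>y\<in>{c..d}. L2_norm I (\<gamma> E y) \<le> B"
proof (cases "S = {}")
  case False
  then obtain E0 where E0: "E0 \<in> S" by blast
  obtain B where B: "B \<ge> 0" "\<And>y. y \<in> {c..d} \<Longrightarrow> L2_norm I (\<gamma> E0 y) \<le> B"
    using weyl_kernel_L2[OF ab weyl[OF E0] cd] by blast
  have C: "C > 0" using resolvent_bound_pos[OF bound[OF E0]] .
  have M0: "0 \<le> M" using M[OF E0] norm_ge_zero order_trans by blast
  have "L2_norm I (\<gamma> E y) \<le> 2 * (C * (2 * M) * B + B)" if E: "E \<in> S" and y: "y \<in> {c..d}" for E y
  proof -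
    have yI: "y \<in> I" using einterval_Icc_subset[OF cd] y by blast
    note T = \<gamma>_diff(1)[OF E E0 yI]
    have "cmod (E - E0) \<le> 2 * M" using norm_triangle_ineq4[of E E0] M[OF E] M[OF E0] by linarith
    then have 1: "cmod (E - E0) * L2_norm I (\<gamma> E0 y) \<le> 2 * M * B"
      using B(2)[OF y] M0 L2_norm_nonneg by (intro mult_mono) auto
    have "L2_norm I (\<lambda>x. \<gamma> E y x - \<gamma> E0 y x) \<le> C * (cmod (E - E0) * L2_norm I (\<gamma> E0 y))"
      using L2_norm_resolvent[OF E T] unfolding L2_norm_scale .
    also have "\<dots> \<le> C * (2 * M * B)" using 1 C by (intro mult_left_mono) auto
    finally have 2: "L2_norm I (\<lambda>x. \<gamma> E y x - \<gamma> E0 y x) \<le> C * (2 * M) * B" by (simp add: mult.assoc)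
    have "L2_norm I (\<gamma> E y) = L2_norm I (\<lambda>x. 1 * (\<gamma> E y x - \<gamma> E0 y x) + 1 * \<gamma> E0 y x)" by simp
    also have "\<dots> \<le> 2 * (cmod 1 * L2_norm I (\<lambda>x. \<gamma> E y x - \<gamma> E0 y x) + cmod 1 * L2_norm I (\<gamma> E0 y))"
      by (rule L2_norm_lincomb[OF dirichlet_opD(3)[OF T] \<gamma>_L2[OF E0 yI]])
    also have "\<dots> \<le> 2 * (C * (2 * M) * B + B)" using 2 B(2)[OF y] by simp
    finally show ?thesis .
  qed
  moreover have "0 \<le> 2 * (C * (2 * M) * B + B)" using C M0 B(1) by simp
  ultimately show ?thesis by blast
qed auto

lemma lipschitz:
  assumes cd: "c \<in> I" "d \<in> I"
  shows "\<exists>K\<ge>0. \<forall>E\<in>S. \<forall>E0\<in>S. \<forall>x\<in>{c..d}. \<forall>y\<in>{c..d}.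
    cmod (G x y E - G x y E0) \<le> K * cmod (E - E0) \<and> cmod (\<gamma>' E y x - \<gamma>' E0 y x) \<le> K * cmod (E - E0)"
proof -
  obtain K where K: "K \<ge> 0" "\<And>E f g x. E \<in> S \<Longrightarrow> (f, \<lambda>x. E * f x + g x) \<in> dirichlet_op a b V \<Longrightarrow> g \<in> L2 I \<Longrightarrow> x \<in> {c..d} \<Longrightarrow>
    cmod (f x) \<le> K * L2_norm I g \<and> cmod (vderiv f x) \<le> K * L2_norm I g"
    using pointwise_resolvent[OF cd] by blast
  obtain B where B: "B \<ge> 0" "\<And>E y. E \<in> S \<Longrightarrow> y \<in> {c..d} \<Longrightarrow> L2_norm I (\<gamma> E y) \<le> B"
    using \<gamma>_bounded[OF cd] by blast
  have "cmod (G x y E - G x y E0) \<le> K * B * cmod (E - E0) \<and> cmod (\<gamma>' E y x - \<gamma>' E0 y x) \<le> K * B * cmod (E - E0)"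
    if E: "E \<in> S" "E0 \<in> S" and x: "x \<in> {c..d}" and y: "y \<in> {c..d}" for E E0 x y
  proof -
    have xI: "x \<in> I" and yI: "y \<in> I" using einterval_Icc_subset[OF cd] x y by blast+
    have "K * L2_norm I (\<lambda>x. (E - E0) * \<gamma> E0 y x) = K * (cmod (E - E0) * L2_norm I (\<gamma> E0 y))" unfolding L2_norm_scale ..
    also have "\<dots> \<le> K * (cmod (E - E0) * B)" using B(2)[OF E(2) y] K(1) by (intro mult_left_mono) auto
    finally have le: "K * L2_norm I (\<lambda>x. (E - E0) * \<gamma> E0 y x) \<le> K * B * cmod (E - E0)" by (simp add: mult_ac)
    have "cmod (\<gamma> E y x - \<gamma> E0 y x) \<le> K * L2_norm I (\<lambda>x. (E - E0) * \<gamma> E0 y x) \<and>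
        cmod (vderiv (\<lambda>x. \<gamma> E y x - \<gamma> E0 y x) x) \<le> K * L2_norm I (\<lambda>x. (E - E0) * \<gamma> E0 y x)"
      by (rule K(2)[OF E(1) \<gamma>_diff(1)[OF E yI] L2_scale[OF \<gamma>_L2[OF E(2) yI]] x])
    then show ?thesis using le unfolding \<gamma>_diff(2)[OF E yI xI] G[OF E(1) xI yI] G[OF E(2) xI yI] by linarith
  qed
  moreover have "0 \<le> K * B" using K(1) B(1) by simp
  ultimately show ?thesis by blast
qed

text \<open>The divided difference \<open>D E\<close> solves
  \<open>(h - E) D = \<gamma> E0 y\<close>, with a source independent of \<open>E\<close>. Hence
  \<open>D E1 - D E2\<close> solves an equation at \<open>E1\<close> with source
  \<open>(E1 - E2) * D E2\<close>, and the estimate for the kernel itself can be repeated.\<close>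

lemma divided_difference_lipschitz:
  assumes cd: "c \<in> I" "d \<in> I"
  shows "\<exists>K\<ge>0. \<forall>E0\<in>S. \<forall>E1\<in>S - {E0}. \<forall>E2\<in>S - {E0}. \<forall>x\<in>{c..d}. \<forall>y\<in>{c..d}.
    cmod ((G x y E1 - G x y E0) / (E1 - E0) - (G x y E2 - G x y E0) / (E2 - E0)) \<le> K * cmod (E1 - E2)"
proof -
  obtain K where K: "K \<ge> 0" "\<And>E f g x. E \<in> S \<Longrightarrow> (f, \<lambda>x. E * f x + g x) \<in> dirichlet_op a b V \<Longrightarrow> g \<in> L2 I \<Longrightarrow> x \<in> {c..d} \<Longrightarrow>
    cmod (f x) \<le> K * L2_norm I g \<and> cmod (vderiv f x) \<le> K * L2_norm I g"
    using pointwise_resolvent[OF cd] by blast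
  obtain B where B: "B \<ge> 0" "\<And>E y. E \<in> S \<Longrightarrow> y \<in> {c..d} \<Longrightarrow> L2_norm I (\<gamma> E y) \<le> B"
    using \<gamma>_bounded[OF cd] by blast
  have "cmod ((G x y E1 - G x y E0) / (E1 - E0) - (G x y E2 - G x y E0) / (E2 - E0)) \<le> K * (\<bar>C\<bar> * B) * cmod (E1 - E2)"
    if E: "E0 \<in> S" "E1 \<in> S" "E1 \<noteq> E0" "E2 \<in> S" "E2 \<noteq> E0" and x: "x \<in> {c..d}" and y: "y \<in> {c..d}" for E0 E1 E2 x y
  proof -
    have xI: "x \<in> I" and yI: "y \<in> I" using einterval_Icc_subset[OF cd] x y by blast+
    have C: "C > 0" using resolvent_bound_pos[OF bound[OF E(1)]] .
    define D where "D E x = inverse (E - E0) * (\<gamma> E y x - \<gamma> E0 y x)" for E x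
    have T: "(D E, \<lambda>x. E * D E x + \<gamma> E0 y x) \<in> dirichlet_op a b V" if "E \<in> S" "E \<noteq> E0" for E
    proof -
      let ?i = "inverse (E - E0)"
      have i: "?i * (E - E0) = 1" using that by simp
      have "(\<lambda>x. ?i * (\<gamma> E y x - \<gamma> E0 y x) + 0 * (\<gamma> E y x - \<gamma> E0 y x),
         \<lambda>x. ?i * (E * (\<gamma> E y x - \<gamma> E0 y x) + (E - E0) * \<gamma> E0 y x) + 0 * (E * (\<gamma> E y x - \<gamma> E0 y x) + (E - E0) * \<gamma> E0 y x)) \<in> dirichlet_op a b V"
        by (rule dirichlet_op_lincomb[OF \<gamma>_diff(1)[OF that(1) E(1) yI] \<gamma>_diff(1)[OF that(1) E(1) yI]])
      moreover have "?i * (E * (\<gamma> E y x - \<gamma> E0 y x) + (E - E0) * \<gamma> E0 y x) + 0 * (E * (\<gamma> E y x - \<gamma> E0 y x) + (E - E0) * \<gamma> E0 y x)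
          = E * D E x + \<gamma> E0 y x" for x
      proof -
        have "?i * (E * z + (E - E0) * g) + 0 * t = E * (?i * z) + (?i * (E - E0)) * g" for z g t by (simp add: algebra_simps)
        then show ?thesis unfolding i D_def by simp
      qed
      moreover have "?i * (\<gamma> E y x - \<gamma> E0 y x) + 0 * (\<gamma> E y x - \<gamma> E0 y x) = D E x" for x by (simp add: D_def)
      ultimately show ?thesis by simp
    qed
    have T12: "(\<lambda>x. D E1 x - D E2 x, \<lambda>x. E1 * (D E1 x - D E2 x) + (E1 - E2) * D E2 x) \<in> dirichlet_op a b V"
    proof -
      have "(\<lambda>x. 1 * D E1 x + (-1) * D E2 x, \<lambda>x. 1 * (E1 * D E1 x + \<gamma> E0 y x) + (-1) * (E2 * D E2 x + \<gamma> E0 y x)) \<in> dirichlet_op a b V"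
        by (rule dirichlet_op_lincomb[OF T[OF E(2,3)] T[OF E(4,5)]])
      moreover have "1 * (E1 * D E1 x + \<gamma> E0 y x) + (-1) * (E2 * D E2 x + \<gamma> E0 y x) = E1 * (D E1 x - D E2 x) + (E1 - E2) * D E2 x"
        "1 * D E1 x + (-1) * D E2 x = D E1 x - D E2 x" for x
        by (simp_all add: algebra_simps)
      ultimately show ?thesis by simp
    qed
    have D2: "D E2 \<in> L2 I" by (rule dirichlet_opD(3)[OF T[OF E(4,5)]])
    have "L2_norm I (D E2) \<le> C * B"
    proof -
      have "L2_norm I (D E2) \<le> C * L2_norm I (\<gamma> E0 y)" by (rule L2_norm_resolvent[OF E(4) T[OF E(4,5)]])
      also have "\<dots> \<le> C * B" using B(2)[OF E(1) y] C by (intro mult_left_mono) auto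
      finally show ?thesis .
    qed
    then have "K * L2_norm I (\<lambda>x. (E1 - E2) * D E2 x) \<le> K * (cmod (E1 - E2) * (C * B))"
      unfolding L2_norm_scale using K(1) by (intro mult_left_mono) auto
    moreover have "cmod (D E1 x - D E2 x) \<le> K * L2_norm I (\<lambda>x. (E1 - E2) * D E2 x)"
      using K(2)[OF E(2) T12 L2_scale[OF D2] x] by blast
    ultimately have "cmod (D E1 x - D E2 x) \<le> K * (\<bar>C\<bar> * B) * cmod (E1 - E2)" using C by (simp add: mult_ac)
    then show ?thesis by (simp add: D_def G[OF _ xI yI] E divide_inverse mult.commute)
  qed
  moreover have "0 \<le> K * (\<bar>C\<bar> * B)" using K(1) B(1) by simp
  ultimately show ?thesis by blast
qed

lemma holomorphic:
  assumes S: "open S" and xy: "x \<in> I" "y \<in> I"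
  shows "(\<lambda>E. G x y E) holomorphic_on S"
proof -
  have "compact {x, y}" "{x, y} \<subseteq> I" using xy by auto
  then obtain c d where cd: "c \<in> I" "d \<in> I" "c < d" "{x, y} \<subseteq> {c<..<d}"
    using compact_in_einterval[OF _ _ ab] by metis
  obtain K where K: "\<And>E0 E1 E2. E0 \<in> S \<Longrightarrow> E1 \<in> S \<Longrightarrow> E1 \<noteq> E0 \<Longrightarrow> E2 \<in> S \<Longrightarrow> E2 \<noteq> E0 \<Longrightarrow>
    cmod ((G x y E1 - G x y E0) / (E1 - E0) - (G x y E2 - G x y E0) / (E2 - E0)) \<le> K * cmod (E1 - E2)"
    using divided_difference_lipschitz[OF cd(1,2)] cd(4) by fastforce
  have "(\<lambda>E. G x y E) field_differentiable (at E0)" if E0: "E0 \<in> S" for E0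
  proof -
    obtain r where r: "r > 0" "ball E0 r \<subseteq> S" using S E0 openE by blast
    obtain l where l: "\<And>E. E \<in> ball E0 r - {E0} \<Longrightarrow> cmod ((G x y E - G x y E0) / (E - E0) - l) \<le> K * cmod (E - E0)"
      using lipschitz_limit[OF r(1), of E0 "\<lambda>E. (G x y E - G x y E0) / (E - E0)" K] K[OF E0] r(2) by blast
    have "((\<lambda>E. (G x y E - G x y E0) / (E - E0) - l) \<longlongrightarrow> 0) (at E0)"
    proof (rule Lim_null_comparison)
      show "\<forall>\<^sub>F E in at E0. cmod ((G x y E - G x y E0) / (E - E0) - l) \<le> K * cmod (E - E0)"
        unfolding eventually_at using r(1) l by (intro exI[of _ r]) (auto simp: dist_commute)
      have "((\<lambda>E. K * cmod (E - E0)) \<longlongrightarrow> K * cmod (E0 - E0)) (at E0)" by (intro tendsto_intros)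
      then show "((\<lambda>E. K * cmod (E - E0)) \<longlongrightarrow> 0) (at E0)" by simp
    qed
    then have "((\<lambda>E. (G x y E - G x y E0) / (E - E0)) \<longlongrightarrow> l) (at E0)" by (rule LIM_zero_cancel)
    then show ?thesis unfolding field_differentiable_def has_field_derivative_iff by blast
  qed
  then show ?thesis using S by (simp add: holomorphic_on_open field_differentiable_def)
qed

text \<open>At the centre no Weyl pair is available, so \<open>G x y z\<close> is known only through
  its action on test functions. The limit \<open>H\<close> of the kernels from the punctured disc
  exists by the Lipschitz bound. Both \<open>H x\<close> and \<open>G x\<close> at \<open>z\<close>
  are limits of the same smeared kernels, and continuity in \<open>y\<close> makes them
  equal.\<close>

lemma center_identification:
  assumes S: "S = ball z r - {z}" and r: "r > 0" and cd: "c \<in> I" "d \<in> I" "c < d"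
    and K0: "resolvent_kernel a b V z (\<lambda>x y. G x y z)" and KE: "\<And>E. E \<in> S \<Longrightarrow> resolvent_kernel a b V E (\<lambda>x y. G x y E)"
  shows "\<exists>K\<ge>0. \<forall>E\<in>S. \<forall>x\<in>{c<..<d}. \<forall>y\<in>{c<..<d}. cmod (G x y E - G x y z) \<le> K * cmod (E - z)"
proof -
  obtain K where K: "K \<ge> 0" "\<And>E E0 x y. E \<in> S \<Longrightarrow> E0 \<in> S \<Longrightarrow> x \<in> {c..d} \<Longrightarrow> y \<in> {c..d} \<Longrightarrow> cmod (G x y E - G x y E0) \<le> K * cmod (E - E0)"
    using lipschitz[OF cd(1,2)] by blast
  have "\<exists>l. \<forall>E\<in>S. cmod (G x y E - l) \<le> K * cmod (E - z)" if "x \<in> {c..d}" "y \<in> {c..d}" for x y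
    using lipschitz_limit[OF r, of z "\<lambda>E. G x y E" K] K(2)[OF _ _ that] unfolding S by blast
  then obtain H where H: "\<And>x y E. x \<in> {c..d} \<Longrightarrow> y \<in> {c..d} \<Longrightarrow> E \<in> S \<Longrightarrow> cmod (G x y E - H x y) \<le> K * cmod (E - z)"
    by metis
  obtain P where P: "P \<ge> 0" "\<And>E f g x. E \<in> S \<Longrightarrow> (f, \<lambda>x. E * f x + g x) \<in> dirichlet_op a b V \<Longrightarrow> g \<in> L2 I \<Longrightarrow> x \<in> {c..d} \<Longrightarrow>
    cmod (f x) \<le> P * L2_norm I g \<and> cmod (vderiv f x) \<le> P * L2_norm I g"
    using pointwise_resolvent[OF cd(1,2)] by blast
  obtain e where e: "\<And>n::nat. e n \<in> S" and elim: "e \<longlonglongrightarrow> z" unfolding S by (rule ball_sequence[OF r]) blast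
  have lim0: "(\<lambda>n. Q * cmod (e n - z)) \<longlonglongrightarrow> 0" for Q
  proof -
    have "(\<lambda>n. Q * cmod (e n - z)) \<longlonglongrightarrow> Q * cmod (z - z)" by (intro tendsto_intros elim)
    then show ?thesis by simp
  qed
  have sub: "{c..d} \<subseteq> I" by (rule einterval_Icc_subset[OF cd(1,2)])
  have cG: "continuous_on {c..d} (\<lambda>y. G x y E)" if "resolvent_kernel a b V E (\<lambda>x y. G x y E)" "x \<in> {c..d}" for x E
    by (rule continuous_on_slice[of I I "\<lambda>x y. G x y E"]) (use that sub in \<open>auto simp: resolvent_kernel_def\<close>)
  have HG: "H x y = G x y z" if x: "x \<in> {c<..<d}" and y: "y \<in> {c<..<d}" for x y
  proof -
    have xc: "x \<in> {c..d}" using x by auto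
    have xI: "x \<in> I" using xc sub by blast
    have "uniform_limit {c..d} (\<lambda>n y. G x y (e n)) (H x) sequentially"
      unfolding uniform_limit_iff
    proof (intro allI impI)
      fix \<epsilon> :: real assume "\<epsilon> > 0"
      then have "\<forall>\<^sub>F n in sequentially. K * cmod (e n - z) < \<epsilon>" using order_tendstoD(2)[OF lim0] by blast
      then show "\<forall>\<^sub>F n in sequentially. \<forall>y\<in>{c..d}. dist (G x y (e n)) (H x y) < \<epsilon>"
        by eventually_elim (use H[OF xc _ e] in \<open>fastforce simp: dist_norm intro: le_less_trans\<close>)
    qed
    then have cH: "continuous_on {c..d} (H x)"
      by (rule uniform_limit_theorem[rotated]) (use cG KE e xc in auto)
    have cG0: "continuous_on {c..d} (\<lambda>y. G x y z)" by (rule cG[OF K0 xc])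
    have sub': "einterval (ereal c) (ereal d) \<subseteq> {c..d}" by (auto simp: einterval_iff)
    \<comment> \<open>\<open>H x\<close> is controlled only on \<open>{c..d}\<close>, so the
      fundamental lemma is applied with that open interval in place of \<open>I\<close>.\<close>
    have "H x y - G x y z = 0"
    proof (rule fundamental_lemma_variations[of "ereal c" "ereal d" "\<lambda>y. H x y - G x y z" c d])
      show "continuous_on (einterval (ereal c) (ereal d)) (\<lambda>y. H x y - G x y z)"
        by (rule continuous_on_subset[OF _ sub']) (intro continuous_on_diff cH cG0)
      show "{c<..<d} \<subseteq> einterval (ereal c) (ereal d)" by (auto simp: einterval_iff)
      show "y \<in> {c<..<d}" by (rule y)
      fix \<eta> :: "real \<Rightarrow> complex" assume \<eta>: "continuous_on UNIV \<eta>" "\<And>s. s \<notin> {c<..<d} \<Longrightarrow> \<eta> s = 0"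
      have cs: "compactly_supported_in I \<eta>" by (rule compactly_supported_inI[OF sub \<eta>(2)])
      define g where "g E x = (LINT y:I|lborel. G x y E * \<eta> y)" for E x
      have gT: "(g E, \<lambda>x. E * g E x + \<eta> x) \<in> dirichlet_op a b V" if "resolvent_kernel a b V E (\<lambda>x y. G x y E)" for E
        unfolding g_def[abs_def] by (rule resolvent_kernelD[OF that \<eta>(1) cs])
      \<comment> \<open>The difference solves an equation at \<open>E\<close> with source
        \<open>(E - z) * g z\<close>. The estimate is thus the uniform one for energies in
        \<open>S\<close>, to which \<open>z\<close> does not belong.\<close>
      have gz: "cmod (g E x - g z x) \<le> P * (cmod (E - z) * L2_norm I (g z))" if E: "E \<in> S" for E
      proof -
        have "(\<lambda>x. 1 * g E x + (-1) * g z x, \<lambda>x. 1 * (E * g E x + \<eta> x) + (-1) * (z * g z x + \<eta> x)) \<in> dirichlet_op a b V"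
          by (rule dirichlet_op_lincomb[OF gT[OF KE[OF E]] gT[OF K0]])
        moreover have "1 * (E * g E x + \<eta> x) + (-1) * (z * g z x + \<eta> x) = E * (g E x - g z x) + (E - z) * g z x"
          "1 * g E x + (-1) * g z x = g E x - g z x" for x by (simp_all add: algebra_simps)
        ultimately have T: "(\<lambda>x. g E x - g z x, \<lambda>x. E * (g E x - g z x) + (E - z) * g z x) \<in> dirichlet_op a b V" by simp
        show ?thesis
          using P(2)[OF E T L2_scale[OF dirichlet_opD(3)[OF gT[OF K0]]] xc] unfolding L2_norm_scale by blast
      qed
      have supp: "(LINT s:I|lborel. f s * \<eta> s) = integral {c..d} (\<lambda>s. f s * \<eta> s)" if "continuous_on {c..d} f" for f
      proof -
        have "(LINT s:I|lborel. f s * \<eta> s) = (LINT s:{c..d}|lborel. f s * \<eta> s)"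
          by (rule set_lebesgue_integral_support[OF sub]) (use \<eta>(2) in auto)
        then show ?thesis
          using continuous_on_Icc_set_integrable(2)[of c d "\<lambda>s. f s * \<eta> s"] continuous_on_mult[OF that continuous_on_subset[OF \<eta>(1)]] by simp
      qed
      have c\<eta>: "continuous_on {c..d} \<eta>" using continuous_on_subset[OF \<eta>(1)] by blast
      define h where "h = integral {c..d} (\<lambda>s. H x s * \<eta> s)"
      have gh: "cmod (g E x - h) \<le> K * cmod (E - z) * integral {c..d} (\<lambda>s. cmod (\<eta> s))" if E: "E \<in> S" for E
      proof -
        note cE = cG[OF KE[OF E] xc]
        have "g E x - h = integral {c..d} (\<lambda>s. G x s E * \<eta> s - H x s * \<eta> s)"
          unfolding g_def h_def supp[OF cE]
          by (rule Henstock_Kurzweil_Integration.integral_diff[symmetric]; intro integrable_continuous_real continuous_on_mult cE cH c\<eta>)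
        also have "cmod \<dots> \<le> integral {c..d} (\<lambda>s. K * cmod (E - z) * cmod (\<eta> s))"
        proof (rule integral_norm_bound_integral)
          show "(\<lambda>s. G x s E * \<eta> s - H x s * \<eta> s) integrable_on {c..d}"
            by (intro integrable_continuous_real continuous_on_diff continuous_on_mult cE cH c\<eta>)
          show "(\<lambda>s. K * cmod (E - z) * cmod (\<eta> s)) integrable_on {c..d}"
            by (intro integrable_continuous_real continuous_on_mult continuous_on_const continuous_on_norm c\<eta>)
          fix s assume s: "s \<in> {c..d}"
          have "cmod (G x s E * \<eta> s - H x s * \<eta> s) = cmod (G x s E - H x s) * cmod (\<eta> s)"
            by (simp add: norm_mult flip: left_diff_distrib)
          also have "\<dots> \<le> K * cmod (E - z) * cmod (\<eta> s)" by (intro mult_right_mono H xc s E) simp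
          finally show "cmod (G x s E * \<eta> s - H x s * \<eta> s) \<le> K * cmod (E - z) * cmod (\<eta> s)" .
        qed
        also have "\<dots> = K * cmod (E - z) * integral {c..d} (\<lambda>s. cmod (\<eta> s))" by (rule integral_mult_right)
        finally show ?thesis .
      qed
      have "(\<lambda>n. g (e n) x - g z x) \<longlonglongrightarrow> 0"
        by (rule Lim_null_comparison[OF _ lim0[of "P * L2_norm I (g z)"]]) (use gz[OF e] in \<open>simp add: mult_ac\<close>)
      then have 1: "(\<lambda>n. g (e n) x) \<longlonglongrightarrow> g z x" by (rule LIM_zero_cancel)
      have "(\<lambda>n. g (e n) x - h) \<longlonglongrightarrow> 0"
        by (rule Lim_null_comparison[OF _ lim0[of "K * integral {c..d} (\<lambda>s. cmod (\<eta> s))"]]) (use gh[OF e] in \<open>simp add: mult_ac\<close>)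
      then have 2: "(\<lambda>n. g (e n) x) \<longlonglongrightarrow> h" by (rule LIM_zero_cancel)
      have "h = g z x" by (rule LIMSEQ_unique[OF 2 1])
      then have hz: "integral {c..d} (\<lambda>s. H x s * \<eta> s) = integral {c..d} (\<lambda>s. G x s z * \<eta> s)"
        unfolding h_def g_def supp[OF cG0] .
      have "(LINT s:einterval (ereal c) (ereal d)|lborel. (H x s - G x s z) * \<eta> s) = (LINT s:{c..d}|lborel. (H x s - G x s z) * \<eta> s)"
        by (rule set_lebesgue_integral_support[OF sub', symmetric]) (auto simp: einterval_iff intro!: \<eta>(2))
      also have "\<dots> = integral {c..d} (\<lambda>s. H x s * \<eta> s - G x s z * \<eta> s)"
        unfolding left_diff_distrib by (rule continuous_on_Icc_set_integrable(2)) (intro continuous_on_diff continuous_on_mult cH cG0 c\<eta>)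
      also have "\<dots> = integral {c..d} (\<lambda>s. H x s * \<eta> s) - integral {c..d} (\<lambda>s. G x s z * \<eta> s)"
        by (rule Henstock_Kurzweil_Integration.integral_diff; intro integrable_continuous_real continuous_on_mult cH cG0 c\<eta>)
      finally show "(LINT s:einterval (ereal c) (ereal d)|lborel. (H x s - G x s z) * \<eta> s) = 0" using hz by simp
    qed
    then show ?thesis by simp
  qed
  have "cmod (G x y E - G x y z) \<le> K * cmod (E - z)" if "E \<in> S" "x \<in> {c<..<d}" "y \<in> {c<..<d}" for E x y
    using H[of x y E] HG[OF that(2,3)] that by simp
  then show ?thesis using K(1) by blast
qed

end

section \<open>Kernels as distributions: dependence on a parameter\<close>

lemma kernel_dist_cong:
  assumes "\<And>x y. x \<in> I \<Longrightarrow> y \<in> I \<Longrightarrow> K x y = K' x y"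
  shows "kernel_dist I K \<phi> = kernel_dist I K' \<phi>"
  unfolding kernel_dist_def set_lebesgue_integral_def
  by (rule Bochner_Integration.integral_cong) (use assms in \<open>auto simp: indicator_def\<close>)

lemma kernel_dist_cmult: "kernel_dist I (\<lambda>x y. c * K x y) \<phi> = c * kernel_dist I K \<phi>"
  unfolding kernel_dist_def by (simp add: mult.assoc)

text \<open>Continuity is asked on the closed square only, because
  \<open>Lt_x w (Lt_y w \<phi>)\<close> contains \<open>w\<close>, which is continuous only on the
  open interval.\<close>

definition supported_test :: "real \<Rightarrow> real \<Rightarrow> (real \<Rightarrow> real \<Rightarrow> complex) \<Rightarrow> bool" where
  "supported_test c d \<phi> \<longleftrightarrow> continuous_on ({c..d} \<times> {c..d}) (\<lambda>p. \<phi> (fst p) (snd p)) \<and>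
     (\<forall>x y. (x, y) \<notin> {c<..<d} \<times> {c<..<d} \<longrightarrow> \<phi> x y = 0)"

lemma test_functions2_supported:
  assumes \<phi>: "\<phi> \<in> test_functions2 (einterval a b)" and ab: "a < b" and w: "continuous_on (einterval a b) w"
  shows "\<exists>c d. c \<in> einterval a b \<and> d \<in> einterval a b \<and> c < d \<and> supported_test c d \<phi> \<and> supported_test c d (Lt_x w (Lt_y w \<phi>))"
proof -
  obtain c d where cd: "c \<in> einterval a b" "d \<in> einterval a b" "c < d" and
    supp: "\<And>x y. (x, y) \<notin> {c<..<d} \<times> {c<..<d} \<Longrightarrow> \<phi> x y = 0 \<and> deriv_x \<phi> x y = 0 \<and> deriv_y \<phi> x y = 0 \<and> deriv_x (deriv_y \<phi>) x y = 0"
    using test_functions2_support[OF \<phi> ab] by blast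
  let ?Q = "{c..d}"
  have C: "\<And>n. Ck_plane n \<phi>" using \<phi> by (simp add: test_functions2_def)
  have contQ: "continuous_on (?Q \<times> ?Q) (\<lambda>p. \<theta> (fst p) (snd p))" if "\<And>n. Ck_plane n \<theta>" for \<theta>
    using continuous_on_subset[OF Ck_plane_continuous[OF that]] by (auto simp: case_prod_unfold)
  have cw: "continuous_on ?Q w" by (rule continuous_on_subset[OF w einterval_Icc_subset[OF cd(1,2)]])
  have w1: "continuous_on (?Q \<times> ?Q) (\<lambda>p. w (fst p))" "continuous_on (?Q \<times> ?Q) (\<lambda>p. w (snd p))"
    by (rule continuous_on_compose2[OF cw]; auto intro!: continuous_intros)+
  have "supported_test c d \<phi>" using contQ[OF C] supp by (simp add: supported_test_def)
  moreover have "supported_test c d (Lt_x w (Lt_y w \<phi>))"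
    unfolding supported_test_def Lt_x_Lt_y[OF C]
    by (intro conjI continuous_intros contQ C Ck_plane_deriv(1) Ck_plane_deriv(2) w1) (use supp in auto)
  ultimately show ?thesis using cd by blast
qed

lemma kernel_continuous_Icc:
  assumes "continuous_on (I \<times> I) (\<lambda>(x, y). K x y)" "{c..d} \<subseteq> I"
  shows "continuous_on ({c..d} \<times> {c..d}) (\<lambda>p. K (fst p) (snd p))"
  by (rule continuous_on_subset[of "I \<times> I"]) (use assms in \<open>auto simp: case_prod_unfold\<close>)

lemma kernel_dist_lipschitz:
  assumes \<phi>: "supported_test c d \<phi>" and sub: "{c..d} \<subseteq> I"
  shows "\<exists>B\<ge>0. \<forall>K K' \<kappa>. continuous_on (I \<times> I) (\<lambda>(x, y). K x y) \<longrightarrow> continuous_on (I \<times> I) (\<lambda>(x, y). K' x y) \<longrightarrow>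
     (\<forall>x\<in>{c<..<d}. \<forall>y\<in>{c<..<d}. cmod (K x y - K' x y) \<le> \<kappa>) \<longrightarrow> cmod (kernel_dist I K \<phi> - kernel_dist I K' \<phi>) \<le> \<kappa> * B"
proof -
  let ?Q = "{c..d} \<times> {c..d}"
  define B where "B = (LINT p:?Q|lborel. cmod (\<phi> (fst p) (snd p)))"
  have c\<phi>: "continuous_on ?Q (\<lambda>p. \<phi> (fst p) (snd p))" and supp: "\<And>x y. (x, y) \<notin> {c<..<d} \<times> {c<..<d} \<Longrightarrow> \<phi> x y = 0"
    using \<phi> by (simp_all add: supported_test_def)
  have sq: "kernel_dist I L \<phi> = (LINT p:?Q|lborel. L (fst p) (snd p) * \<phi> (fst p) (snd p))" for L
    by (rule kernel_dist_square[OF sub supp])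
  have "cmod (kernel_dist I K \<phi> - kernel_dist I K' \<phi>) \<le> \<kappa> * B"
    if K: "continuous_on (I \<times> I) (\<lambda>(x, y). K x y)" "continuous_on (I \<times> I) (\<lambda>(x, y). K' x y)"
      and \<kappa>: "\<And>x y. x \<in> {c<..<d} \<Longrightarrow> y \<in> {c<..<d} \<Longrightarrow> cmod (K x y - K' x y) \<le> \<kappa>" for K K' \<kappa>
  proof -
    note cK = kernel_continuous_Icc[OF K(1) sub] and cK' = kernel_continuous_Icc[OF K(2) sub]
    have i1: "set_integrable lborel ?Q (\<lambda>p. K (fst p) (snd p) * \<phi> (fst p) (snd p))"
      and i2: "set_integrable lborel ?Q (\<lambda>p. K' (fst p) (snd p) * \<phi> (fst p) (snd p))"
      by (intro continuous_on_square_set_integrable continuous_on_mult cK cK' c\<phi>)+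
    have i3: "set_integrable lborel ?Q (\<lambda>p. \<phi> (fst p) (snd p))" by (rule continuous_on_square_set_integrable[OF c\<phi>])
    define \<delta> where "\<delta> p = K (fst p) (snd p) * \<phi> (fst p) (snd p) - K' (fst p) (snd p) * \<phi> (fst p) (snd p)" for p
    define \<beta> where "\<beta> p = cmod (\<phi> (fst p) (snd p))" for p
    have i\<delta>: "set_integrable lborel ?Q \<delta>" unfolding \<delta>_def[abs_def] by (rule set_integral_diff(1)[OF i1 i2])
    have i\<beta>: "set_integrable lborel ?Q \<beta>" unfolding \<beta>_def[abs_def] by (rule set_integrable_norm[OF i3])
    have eq: "kernel_dist I K \<phi> - kernel_dist I K' \<phi> = (LINT p:?Q|lborel. \<delta> p)"
      unfolding sq \<delta>_def by (rule set_integral_diff(2)[OF i1 i2, symmetric])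
    have le: "cmod (\<delta> p) \<le> \<kappa> * \<beta> p" for p
    proof (cases "(fst p, snd p) \<in> {c<..<d} \<times> {c<..<d}")
      case True
      then have "cmod (K (fst p) (snd p) - K' (fst p) (snd p)) \<le> \<kappa>" by (intro \<kappa>) auto
      then show ?thesis unfolding \<delta>_def \<beta>_def by (simp add: norm_mult mult_right_mono flip: left_diff_distrib)
    next
      case False
      then show ?thesis using supp[OF False] by (simp add: \<delta>_def \<beta>_def)
    qed
    have "cmod (LINT p:?Q|lborel. \<delta> p) \<le> (LINT p:?Q|lborel. cmod (\<delta> p))"
      by (rule set_integral_norm_bound[OF i\<delta>])
    moreover have "(LINT p:?Q|lborel. cmod (\<delta> p)) \<le> (LINT p:?Q|lborel. \<kappa> * \<beta> p)"
      by (rule set_integral_mono[OF set_integrable_norm[OF i\<delta>] set_integrable_mult_right[OF i\<beta>] le])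
    moreover have "(LINT p:?Q|lborel. \<kappa> * \<beta> p) = \<kappa> * B" unfolding B_def \<beta>_def by (rule set_integral_mult_right)
    ultimately show ?thesis unfolding eq by linarith
  qed
  moreover have "0 \<le> B" unfolding B_def set_lebesgue_integral_def by (rule Bochner_Integration.integral_nonneg) simp
  ultimately show ?thesis by blast
qed

text \<open>Dominated convergence: the Lipschitz bound majorizes the divided differences by
  \<open>K\<close>, uniformly on the support of the test function. The limit integrand is measurable
  as a pointwise limit.\<close>

lemma kernel_dist_deriv_limit:
  fixes G :: "real \<Rightarrow> real \<Rightarrow> complex \<Rightarrow> complex"
  assumes \<phi>: "supported_test c d \<phi>" and sub: "{c..d} \<subseteq> I" and U: "open U" "z \<in> U"
    and hol: "\<And>x y. x \<in> I \<Longrightarrow> y \<in> I \<Longrightarrow> (\<lambda>E. G x y E) holomorphic_on U"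
    and cont: "\<And>E. E \<in> U \<Longrightarrow> continuous_on (I \<times> I) (\<lambda>(x, y). G x y E)"
    and lip: "\<And>E x y. E \<in> U \<Longrightarrow> x \<in> {c..d} \<Longrightarrow> y \<in> {c..d} \<Longrightarrow> cmod (G x y E - G x y z) \<le> K * cmod (E - z)"
    and e: "\<And>n. e n \<in> U - {z}" "e \<longlonglongrightarrow> z"
  shows "(\<lambda>n. (kernel_dist I (\<lambda>x y. G x y (e n)) \<phi> - kernel_dist I (\<lambda>x y. G x y z) \<phi>) / (e n - z))
     \<longlonglongrightarrow> kernel_dist I (\<lambda>x y. deriv (\<lambda>E. G x y E) z) \<phi>"
proof -
  let ?Q = "{c..d} \<times> {c..d}"
  have c\<phi>: "continuous_on ?Q (\<lambda>p. \<phi> (fst p) (snd p))" and supp: "\<And>x y. (x, y) \<notin> {c<..<d} \<times> {c<..<d} \<Longrightarrow> \<phi> x y = 0"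
    using \<phi> by (simp_all add: supported_test_def)
  have sq: "kernel_dist I L \<phi> = (LINT p:?Q|lborel. L (fst p) (snd p) * \<phi> (fst p) (snd p))" for L
    by (rule kernel_dist_square[OF sub supp])
  define s where "s n p = indicator ?Q p *\<^sub>R ((G (fst p) (snd p) (e n) - G (fst p) (snd p) z) / (e n - z) * \<phi> (fst p) (snd p))" for n p
  define l where "l p = indicator ?Q p *\<^sub>R (deriv (\<lambda>E. G (fst p) (snd p) E) z * \<phi> (fst p) (snd p))" for p
  have eU: "e n \<in> U" "e n \<noteq> z" for n using e(1)[of n] by auto
  have cG: "continuous_on ?Q (\<lambda>p. G (fst p) (snd p) E)" if "E \<in> U" for E
    by (rule kernel_continuous_Icc[OF cont[OF that] sub])
  have int: "set_integrable lborel ?Q (\<lambda>p. G (fst p) (snd p) E * \<phi> (fst p) (snd p))" if "E \<in> U" for E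
    by (intro continuous_on_square_set_integrable continuous_on_mult cG[OF that] c\<phi>)
  have s_int: "integrable lborel (s n)" for n
  proof -
    have "set_integrable lborel ?Q (\<lambda>p. (G (fst p) (snd p) (e n) - G (fst p) (snd p) z) / (e n - z) * \<phi> (fst p) (snd p))"
      by (intro continuous_on_square_set_integrable continuous_on_mult continuous_on_divide continuous_on_diff continuous_on_const cG eU U c\<phi>)
        (use eU in simp)
    then show ?thesis unfolding s_def[abs_def] set_integrable_def .
  qed
  have s_lim: "(\<lambda>n. s n p) \<longlonglongrightarrow> l p" for p
  proof (cases "p \<in> ?Q")
    case True
    then have p: "fst p \<in> I" "snd p \<in> I" using sub by auto
    have "((\<lambda>E. G (fst p) (snd p) E) has_field_derivative deriv (\<lambda>E. G (fst p) (snd p) E) z) (at z)"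
      by (rule holomorphic_derivI[OF hol[OF p] U])
    then have "((\<lambda>E. (G (fst p) (snd p) E - G (fst p) (snd p) z) / (E - z)) \<longlongrightarrow> deriv (\<lambda>E. G (fst p) (snd p) E) z) (at z)"
      by (simp add: has_field_derivative_iff)
    moreover have "filterlim e (at z) sequentially" using e(2) eU(2) by (auto simp: filterlim_at)
    ultimately have "(\<lambda>n. (G (fst p) (snd p) (e n) - G (fst p) (snd p) z) / (e n - z)) \<longlonglongrightarrow> deriv (\<lambda>E. G (fst p) (snd p) E) z"
      by (rule filterlim_compose)
    then show ?thesis unfolding s_def l_def by (intro tendsto_intros)
  qed (simp add: s_def l_def)
  have "(\<lambda>n. integral\<^sup>L lborel (s n)) \<longlonglongrightarrow> integral\<^sup>L lborel l"
  proof (rule integral_dominated_convergence[where w="\<lambda>p. indicator ?Q p *\<^sub>R (K * cmod (\<phi> (fst p) (snd p)))"])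
    show sm: "s n \<in> borel_measurable lborel" for n using s_int by auto
    show "l \<in> borel_measurable lborel" by (rule borel_measurable_LIMSEQ_metric[OF sm]) (rule s_lim)
    show "integrable lborel (\<lambda>p. indicator ?Q p *\<^sub>R (K * cmod (\<phi> (fst p) (snd p))))"
      using set_integrable_mult_right[OF set_integrable_norm[OF continuous_on_square_set_integrable[OF c\<phi>]], of K]
      by (simp add: set_integrable_def)
    show "AE p in lborel. (\<lambda>n. s n p) \<longlonglongrightarrow> l p" using s_lim by simp
    show "AE p in lborel. norm (s n p) \<le> indicator ?Q p *\<^sub>R (K * cmod (\<phi> (fst p) (snd p)))" for n
    proof (rule AE_I2)
      fix p :: "real \<times> real"
      show "norm (s n p) \<le> indicator ?Q p *\<^sub>R (K * cmod (\<phi> (fst p) (snd p)))"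
      proof (cases "p \<in> ?Q")
        case True
        then have "cmod (G (fst p) (snd p) (e n) - G (fst p) (snd p) z) \<le> K * cmod (e n - z)" by (intro lip eU) auto
        then have "cmod ((G (fst p) (snd p) (e n) - G (fst p) (snd p) z) / (e n - z)) \<le> K"
          using eU(2)[of n] by (simp add: norm_divide divide_le_eq)
        then show ?thesis using True by (simp add: s_def norm_mult mult_right_mono del: times_divide_eq_left)
      qed (simp add: s_def)
    qed
  qed
  moreover have "integral\<^sup>L lborel (s n) = (kernel_dist I (\<lambda>x y. G x y (e n)) \<phi> - kernel_dist I (\<lambda>x y. G x y z) \<phi>) / (e n - z)" for n
  proof -
    have "integral\<^sup>L lborel (s n) = (LINT p:?Q|lborel. (G (fst p) (snd p) (e n) * \<phi> (fst p) (snd p) - G (fst p) (snd p) z * \<phi> (fst p) (snd p)) / (e n - z))"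
      unfolding set_lebesgue_integral_def s_def[abs_def]
      by (rule Bochner_Integration.integral_cong) (auto simp: diff_divide_distrib left_diff_distrib)
    also have "\<dots> = (LINT p:?Q|lborel. G (fst p) (snd p) (e n) * \<phi> (fst p) (snd p) - G (fst p) (snd p) z * \<phi> (fst p) (snd p)) / (e n - z)"
      by simp
    also have "(LINT p:?Q|lborel. G (fst p) (snd p) (e n) * \<phi> (fst p) (snd p) - G (fst p) (snd p) z * \<phi> (fst p) (snd p))
        = kernel_dist I (\<lambda>x y. G x y (e n)) \<phi> - kernel_dist I (\<lambda>x y. G x y z) \<phi>"
      unfolding sq by (rule set_integral_diff(2)[OF int[OF eU(1)] int[OF U(2)]])
    finally show ?thesis .
  qed
  moreover have "integral\<^sup>L lborel l = kernel_dist I (\<lambda>x y. deriv (\<lambda>E. G x y E) z) \<phi>"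
    unfolding sq set_lebesgue_integral_def l_def[abs_def] ..
  ultimately show ?thesis by simp
qed

text \<open>\<open>(E - z) * f E\<close>, completed by the value \<open>l\<close>, has a removable
  singularity at \<open>z\<close>, so \<open>f\<close> is a holomorphic function with nonzero value
  at \<open>z\<close> divided by \<open>E - z\<close>.\<close>

lemma has_simple_poleI:
  assumes r: "r > 0" and f: "f holomorphic_on ball z r - {z}" and l: "((\<lambda>E. (E - z) * f E) \<longlongrightarrow> l) (at z)" "l \<noteq> 0"
  shows "has_simple_pole f z"
proof -
  define g where "g E = (if E = z then l else (E - z) * f E)" for E
  have "(g \<longlongrightarrow> g z) (at z)"
    using l(1) by (simp add: g_def cong: LIM_cong)
  then have lim: "(g \<longlongrightarrow> g z) (at z within ball z r)" by (rule tendsto_within_subset) simp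
  have "(\<lambda>E. (E - z) * f E) holomorphic_on ball z r - {z}" by (intro holomorphic_intros f)
  then have "g holomorphic_on ball z r - {z}" by (rule holomorphic_transform) (simp add: g_def)
  then have g: "g holomorphic_on ball z r"
    by (rule no_isolated_singularity'[where K="{z}" and S="ball z r" and f=g, rotated]) (use lim in auto)
  have fg: "f E = g E / (E - z)" if "E \<noteq> z" for E using that by (simp add: g_def)
  have "isolated_singularity_at f z"
    unfolding isolated_singularity_at_def
    using r f analytic_on_open[of "ball z r - {z}" f] open_delete[OF open_ball] by blast
  moreover have "is_pole f z"
  proof -
    have "isCont g z"
      using holomorphic_on_imp_continuous_on[OF g] r by (simp add: continuous_on_eq_continuous_at)
    then have "is_pole (\<lambda>E. g E / (E - z)) z"
      by (rule is_pole_divide) (use l(2) in \<open>auto simp: g_def filterlim_at eventually_at_filter intro!: tendsto_eq_intros\<close>)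
    then show ?thesis
      by (rule is_pole_transform) (use fg in \<open>auto simp: eventually_at_filter\<close>)
  qed
  moreover have "zorder f z = -1"
    by (rule zorder_eqI[OF open_ball _ g]) (use r l(2) fg in \<open>auto simp: g_def power_int_minus divide_inverse\<close>)
  ultimately show ?thesis by (simp add: has_simple_pole_def)
qed

text \<open>\<open>N\<close> is an initial segment, \<open>En\<close> increases and the continuum
  starts at 0 above all levels. Thus the part of the spectrum above \<alpha>, if there is any, has a
  least point: \<open>En 1\<close> or 0 if the lowest level is \<alpha>, and \<open>En 0\<close> or
  0 otherwise.\<close>

lemma spectral_gap:
  assumes sp: "spectral_problem a b V cont N En \<psi> \<eta>" and z: "(0 \<in> N \<and> \<alpha> = En 0) \<or> below_spec \<alpha> (spec a b V)"
  shows "\<exists>r>0. \<forall>E\<in>ball (complex_of_real \<alpha>) r. E \<in> spec a b V \<longrightarrow> E = of_real \<alpha>"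
proof -
  have spec: "spec a b V = complex_of_real ` (En ` N \<union> (if cont then {0..} else {}))"
    and neg: "\<And>n. cont \<Longrightarrow> n \<in> N \<Longrightarrow> En n < 0"
    and N: "\<And>n m. n \<in> N \<Longrightarrow> m < n \<Longrightarrow> m \<in> N" and mono: "strict_mono_on N En"
    using sp by (auto simp: spectral_problem_def discrete_eigensystem_def)
  have "\<exists>\<beta>>\<alpha>. \<forall>t\<in>En ` N \<union> (if cont then {0..} else {}). t = \<alpha> \<or> \<beta> \<le> t"
  proof (cases "0 \<in> N \<and> \<alpha> = En 0")
    case True
    have ge: "En 1 \<le> En n" if "n \<in> N" "n \<noteq> 0" for n
      using strict_mono_onD[OF mono, of 1 n] N[OF that(1), of 1] that by (cases "n = 1") auto
    show ?thesis
    proof (cases "1 \<in> N")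
      case True1: True
      have "\<alpha> < En 1" using strict_mono_onD[OF mono, of 0 1] True True1 by simp
      moreover have "\<forall>t\<in>En ` N \<union> (if cont then {0..} else {}). t = \<alpha> \<or> En 1 \<le> t"
        using ge True neg[OF _ True1] by (force split: if_splits)
      ultimately show ?thesis by blast
    next
      case False
      then have "N = {0}" using N[of _ 1] True by (metis One_nat_def insertI1 less_one linorder_neqE_nat singletonD subsetI subset_antisym subset_singleton_iff empty_iff insert_iff)
      \<comment> \<open>With a continuum the next spectral point is its threshold 0; without one
        nothing lies above \<alpha>, and \<open>\<alpha> + 1\<close> is an arbitrary choice.\<close>
      then show ?thesis using True neg[of 0]
        by (intro exI[of _ "if cont then 0 else \<alpha> + 1"]) auto
    qed
  next
    case False
    then have b: "below_spec \<alpha> (spec a b V)" using z by blast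
    then have lt: "\<And>t. t \<in> En ` N \<union> (if cont then {0..} else {}) \<Longrightarrow> \<alpha> < t"
      unfolding below_spec_def spec by auto
    show ?thesis
    proof (cases "0 \<in> N")
      case True
      have ge: "En 0 \<le> En n" if "n \<in> N" for n
        using strict_mono_onD[OF mono True that] by (cases "n = 0") auto
      have "\<forall>t\<in>En ` N \<union> (if cont then {0..} else {}). t = \<alpha> \<or> En 0 \<le> t"
        using ge neg[OF _ True] by (force split: if_splits)
      then show ?thesis using lt[of "En 0"] True by blast
    next
      case False
      then have "N = {}" using N by (metis ex_in_conv gr0I)
      then show ?thesis using lt[of 0]
        by (intro exI[of _ "if cont then 0 else \<alpha> + 1"]) auto
    qed
  qed
  then obtain \<beta> where \<beta>: "\<beta> > \<alpha>" "\<And>t. t \<in> En ` N \<union> (if cont then {0..} else {}) \<Longrightarrow> t = \<alpha> \<or> \<beta> \<le> t" by blast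
  have "E = of_real \<alpha>" if E: "E \<in> ball (complex_of_real \<alpha>) (\<beta> - \<alpha>)" "E \<in> spec a b V" for E
  proof -
    obtain t where t: "E = of_real t" "t \<in> En ` N \<union> (if cont then {0..} else {})" using E(2) spec by auto
    have "\<bar>\<alpha> - t\<bar> < \<beta> - \<alpha>" using E(1) unfolding t(1) mem_ball dist_of_real by (simp add: dist_real_def)
    then show ?thesis using \<beta>(2)[OF t(2)] t(1) by auto
  qed
  then show ?thesis using \<beta>(1) by (intro exI[of _ "\<beta> - \<alpha>"]) auto
qed

text \<open>The radius \<open>1 / (4 * C)\<close> is the one for which
  \<open>resolvent_bound_nearby\<close> applies. Only the bound at \<open>z\<close> is used, so
  \<open>z\<close> may lie outside \<open>S\<close>; this matters for the partner at \<alpha>, whose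
  Weyl pairs are known only off the centre.\<close>

lemma green_family_exists:
  assumes ab: "a < b" and V: "continuous_on (einterval a b) V" and z: "z \<notin> spec a b V" and G: "green_function a b V G"
  shows "\<exists>r C M. r > 0 \<and> (\<forall>S \<subseteq> ball z r. S \<inter> spec a b V = {} \<longrightarrow> (\<forall>E\<in>S. \<exists>F F' R R'. weyl_pair a b V E F F' R R') \<longrightarrow>
     (\<exists>F F' R R'. green_family a b V S C M G F F' R R'))"
proof -
  obtain C where C: "resolvent_bound a b V z C" using resolvent_bound_exists[OF z] by blast
  have C0: "C > 0" by (rule resolvent_bound_pos[OF C])
  define r where "r = 1 / (4 * C)"
  have r: "r > 0" using C0 by (simp add: r_def)
  have "\<exists>F F' R R'. green_family a b V S (4 * C) (cmod z + r) G F F' R R'"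
    if S: "S \<subseteq> ball z r" "S \<inter> spec a b V = {}" "\<forall>E\<in>S. \<exists>F F' R R'. weyl_pair a b V E F F' R R'" for S
  proof -
    obtain F F' R R' where W: "\<And>E. E \<in> S \<Longrightarrow> weyl_pair a b V E (F E) (F' E) (R E) (R' E)"
      using S(3) by metis
    have "green_family a b V S (4 * C) (cmod z + r) G F F' R R'"
    proof
      fix E assume E: "E \<in> S"
      then have d: "cmod (E - z) < r" using S(1) by (auto simp: dist_norm norm_minus_commute)
      then have "4 * C * cmod (E - z) \<le> 1" using C0 by (simp add: r_def field_simps)
      then show bd: "resolvent_bound a b V E (4 * C)" by (rule resolvent_bound_nearby[OF C])
      show "cmod E \<le> cmod z + r" using d norm_triangle_ineq[of "E - z" z] by simp
      fix x y assume "x \<in> einterval a b" "y \<in> einterval a b"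
      then show "G x y E = weyl_kernel (F E) (R E) x y"
        using resolvent_kernel_eq_weyl_kernel[OF V ab W[OF E] green_function_resolvent_kernel[OF G] bd] E S(2) by blast
    qed (use ab V W in auto)
    then show ?thesis by blast
  qed
  then show ?thesis using r by blast
qed

text \<open>If \<open>F\<close> vanished to the left of \<open>m\<close>, so would its derivative,
  and the Wronskian could not be -1 there.\<close>

lemma weyl_pair_nonzero_near_ends:
  assumes w: "weyl_pair a b V E F F' R R'" and m: "m \<in> einterval a b"
  shows "\<exists>x\<in>einterval a b. x < m \<and> F x \<noteq> 0" "\<exists>x\<in>einterval a b. m < x \<and> R x \<noteq> 0"
proof -
  note W = weyl_pairD[OF w]
  show "\<exists>x\<in>einterval a b. x < m \<and> F x \<noteq> 0"
  proof (rule ccontr)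
    assume n: "\<not> ?thesis"
    obtain z where z: "z \<in> einterval a b" "z < m" using einterval_less_ex[OF m] by blast
    have "vderiv F z = vderiv (\<lambda>_. 0) z"
      by (rule vderiv_cong_open[of "einterval a b \<inter> {..<m}"]) (use n z in auto)
    moreover have "vderiv F z = F' z" using W(1) z(1) by (auto simp: schroedinger_sol_def intro: vderivI)
    ultimately have "F' z = 0" by (simp add: vderivI)
    moreover have "F z = 0" using n z by blast
    ultimately show False using W(5)[OF z(1)] by simp
  qed
  show "\<exists>x\<in>einterval a b. m < x \<and> R x \<noteq> 0"
  proof (rule ccontr)
    assume n: "\<not> ?thesis"
    obtain z where z: "z \<in> einterval a b" "m < z" using einterval_greater_ex[OF m] by blast
    have "vderiv R z = vderiv (\<lambda>_. 0) z"
      by (rule vderiv_cong_open[of "einterval a b \<inter> {m<..}"]) (use n z in auto)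
    moreover have "vderiv R z = R' z" using W(2) z(1) by (auto simp: schroedinger_sol_def intro: vderivI)
    ultimately have "R' z = 0" by (simp add: vderivI)
    moreover have "R z = 0" using n z by blast
    ultimately show False using W(5)[OF z(1)] by simp
  qed
qed

section \<open>The numerator of the partner kernel at the factorization energy\<close>

context susy
begin

text \<open>At \<open>E = \<alpha>\<close> the function \<open>L F\<close> is a multiple of
  \<open>1 / u\<close>, so a single zero makes it vanish identically. Then \<open>F = c u\<close>,
  and \<open>c\<close> is the product of \<open>F\<close> and \<open>1 / u\<close>, which both tend
  to 0 at \<open>a\<close>; so \<open>F\<close> would be 0. At \<open>b\<close> the same holds for
  \<open>R\<close>.\<close>

lemma L_nonzero_at_alpha:
  assumes W: "weyl_pair a b V (of_real \<alpha>) F F' R R'"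
    and v: "vanishes_left a (\<lambda>x. complex_of_real (1 / u x))" "vanishes_right b (\<lambda>x. complex_of_real (1 / u x))"
    and x: "x \<in> I"
  shows "L F F' x \<noteq> 0" "L R R' x \<noteq> 0"
proof -
  note w = weyl_pairD[OF W]
  obtain z where z: "z \<in> I" using einterval_nonempty[OF ab] by blast
  show "L F F' x \<noteq> 0"
  proof
    assume 0: "L F F' x = 0"
    obtain k where k: "\<And>s. s \<in> I \<Longrightarrow> L F F' s = k / of_real (u s)" by (rule L_at_alpha[OF w(1)]) blast
    have "k = 0" using k[OF x] 0 u(3)[OF x] by simp
    then have "\<And>s. s \<in> I \<Longrightarrow> L F F' s = 0" using k by simp
    then obtain c where c: "\<And>s. s \<in> I \<Longrightarrow> F s = c * of_real (u s)" by (rule L_zero_imp_multiple[OF w(1)]) blast+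
    have l: "((\<lambda>s. F (real_of_ereal s) * complex_of_real (1 / u (real_of_ereal s))) \<longlongrightarrow> 0) (at_right a)"
      using tendsto_mult[OF w(3)[unfolded adm_left_def vanishes_left_def comp_def, THEN conjunct1] v(1)[unfolded vanishes_left_def comp_def]]
      by (simp only: mult_zero_left)
    have "eventually (\<lambda>s. F (real_of_ereal s) * complex_of_real (1 / u (real_of_ereal s)) = c) (at_right a)"
    proof (rule eventually_at_right_ereal[OF z, where P="\<lambda>s. F s * complex_of_real (1 / u s) = c"])
      fix s assume "s \<in> einterval a (ereal z)"
      then have "s \<in> I" using einterval_half_subset(1)[OF z] by blast
      then show "F s * complex_of_real (1 / u s) = c" using c u(3) by simp
    qed
    then have "((\<lambda>_. c) \<longlongrightarrow> 0) (at_right a)" by (rule Lim_transform_eventually[OF l])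
    then have "c = 0" using tendsto_unique[OF at_right_ereal_nontrivial[OF ab] _ tendsto_const] by metis
    then show False using weyl_pair_nonzero_near_ends(1)[OF W z] c by auto
  qed
  show "L R R' x \<noteq> 0"
  proof
    assume 0: "L R R' x = 0"
    obtain k where k: "\<And>s. s \<in> I \<Longrightarrow> L R R' s = k / of_real (u s)" by (rule L_at_alpha[OF w(2)]) blast
    have "k = 0" using k[OF x] 0 u(3)[OF x] by simp
    then have "\<And>s. s \<in> I \<Longrightarrow> L R R' s = 0" using k by simp
    then obtain c where c: "\<And>s. s \<in> I \<Longrightarrow> R s = c * of_real (u s)" by (rule L_zero_imp_multiple[OF w(2)]) blast+
    have l: "((\<lambda>s. R (real_of_ereal s) * complex_of_real (1 / u (real_of_ereal s))) \<longlongrightarrow> 0) (at_left b)"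
      using tendsto_mult[OF w(4)[unfolded adm_right_def vanishes_right_def comp_def, THEN conjunct1] v(2)[unfolded vanishes_right_def comp_def]]
      by (simp only: mult_zero_left)
    have "eventually (\<lambda>s. R (real_of_ereal s) * complex_of_real (1 / u (real_of_ereal s)) = c) (at_left b)"
    proof (rule eventually_at_left_ereal[OF z, where P="\<lambda>s. R s * complex_of_real (1 / u s) = c"])
      fix s assume "s \<in> einterval (ereal z) b"
      then have "s \<in> I" using einterval_half_subset(2)[OF z] by blast
      then show "R s * complex_of_real (1 / u s) = c" using c u(3) by simp
    qed
    then have "((\<lambda>_. c) \<longlongrightarrow> 0) (at_left b)" by (rule Lim_transform_eventually[OF l])
    then have "c = 0" using tendsto_unique[OF at_left_ereal_nontrivial[OF ab] _ tendsto_const] by metis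
    then show False using weyl_pair_nonzero_near_ends(2)[OF W z] c by auto
  qed
qed

text \<open>The numerator \<open>L F(m) L R(n)\<close> is continuous in \<open>E\<close>: with auxiliary points \<open>x\<^sub>0 < m\<close>, \<open>n < y\<^sub>0\<close> it is the
  product of \<open>L\<^sub>x G\<^sub>0(m, y\<^sub>0)\<close> and \<open>L\<^sub>y G\<^sub>0(x\<^sub>0, n)\<close> divided by \<open>G\<^sub>0(x\<^sub>0, y\<^sub>0)\<close>, in which the normalization of
  the Weyl solutions cancels.\<close>

lemma numerator_continuous:
  assumes fam: "green_family a b V S C M G F F' R R'" and S: "open S" "of_real \<alpha> \<in> S" and mn: "m \<in> I" "n \<in> I" "m \<le> n"
  shows "((\<lambda>E. L (F E) (F' E) m * L (R E) (R' E) n) \<longlongrightarrow> L (F (of_real \<alpha>)) (F' (of_real \<alpha>)) m * L (R (of_real \<alpha>)) (R' (of_real \<alpha>)) n)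
    (at (of_real \<alpha>))"
proof -
  interpret GF: green_family a b V S C M G F F' R R' by (rule fam)
  let ?\<alpha> = "complex_of_real \<alpha>"
  obtain x0 where x0: "x0 \<in> I" "x0 < m" "F ?\<alpha> x0 \<noteq> 0" using weyl_pair_nonzero_near_ends(1)[OF GF.weyl[OF S(2)] mn(1)] by blast
  obtain y0 where y0: "y0 \<in> I" "n < y0" "R ?\<alpha> y0 \<noteq> 0" using weyl_pair_nonzero_near_ends(2)[OF GF.weyl[OF S(2)] mn(2)] by blast
  obtain K where K: "\<And>E E0 x y. E \<in> S \<Longrightarrow> E0 \<in> S \<Longrightarrow> x \<in> {x0..y0} \<Longrightarrow> y \<in> {x0..y0} \<Longrightarrow>
    cmod (G x y E - G x y E0) \<le> K * cmod (E - E0) \<and> cmod (GF.\<gamma>' E y x - GF.\<gamma>' E0 y x) \<le> K * cmod (E - E0)"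
    using GF.lipschitz[OF x0(1) y0(1)] by blast
  have ord: "x0 \<le> m" "m < y0" "x0 < n" "n \<le> y0" using x0 y0 mn by auto
  have evS: "eventually (\<lambda>E. E \<in> S) (at ?\<alpha>)" using S by (rule eventually_at_in_open')
  have lim: "(f \<longlongrightarrow> f ?\<alpha>) (at ?\<alpha>)" if "\<And>E. E \<in> S \<Longrightarrow> cmod (f E - f ?\<alpha>) \<le> K * cmod (E - ?\<alpha>)" for f :: "complex \<Rightarrow> complex"
  proof -
    have "((\<lambda>E. f E - f ?\<alpha>) \<longlongrightarrow> 0) (at ?\<alpha>)"
    proof (rule Lim_null_comparison)
      show "\<forall>\<^sub>F E in at ?\<alpha>. cmod (f E - f ?\<alpha>) \<le> K * cmod (E - ?\<alpha>)" using evS by eventually_elim (rule that)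
      have "((\<lambda>E. K * cmod (E - ?\<alpha>)) \<longlongrightarrow> K * cmod (?\<alpha> - ?\<alpha>)) (at ?\<alpha>)" by (intro tendsto_intros)
      then show "((\<lambda>E. K * cmod (E - ?\<alpha>)) \<longlongrightarrow> 0) (at ?\<alpha>)" by simp
    qed
    then show ?thesis by (rule LIM_zero_cancel)
  qed
  have limG: "((\<lambda>E. G x y E) \<longlongrightarrow> G x y ?\<alpha>) (at ?\<alpha>)" and lim\<gamma>: "((\<lambda>E. GF.\<gamma>' E y x) \<longlongrightarrow> GF.\<gamma>' ?\<alpha> y x) (at ?\<alpha>)"
    if "x \<in> {x0..y0}" "y \<in> {x0..y0}" for x y
    using lim[of "\<lambda>E. G x y E"] lim[of "\<lambda>E. GF.\<gamma>' E y x"] K[OF _ S(2) that] by blast+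
  \<comment> \<open>Since \<open>m < y0\<close> and \<open>x0 < n\<close>, both derivatives are
    taken off the diagonal, where \<open>\<gamma>'\<close> is the derivative of the kernel.\<close>
  define A where "A E = - GF.\<gamma>' E y0 m + of_real (w m) * G m y0 E" for E
  define B where "B E = - GF.\<gamma>' E x0 n + of_real (w n) * G n x0 E" for E
  have A: "A E = L (F E) (F' E) m * R E y0" if "E \<in> S" for E
    using ord GF.G[OF that mn(1) y0(1)] by (simp add: A_def L_def GF.\<gamma>'_def weyl_kernel_simps algebra_simps)
  have B: "B E = F E x0 * L (R E) (R' E) n" if "E \<in> S" for E
    using ord GF.G[OF that mn(2) x0(1)] by (simp add: B_def L_def GF.\<gamma>'_def weyl_kernel_simps algebra_simps)
  have D: "G x0 y0 E = F E x0 * R E y0" if "E \<in> S" for E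
    using ord GF.G[OF that x0(1) y0(1)] mn(3) by (simp add: weyl_kernel_simps)
  have limA: "(A \<longlongrightarrow> A ?\<alpha>) (at ?\<alpha>)" unfolding A_def[abs_def] by (intro tendsto_intros limG lim\<gamma>) (use ord mn in auto)
  have limB: "(B \<longlongrightarrow> B ?\<alpha>) (at ?\<alpha>)" unfolding B_def[abs_def] by (intro tendsto_intros limG lim\<gamma>) (use ord mn in auto)
  have limD: "((\<lambda>E. G x0 y0 E) \<longlongrightarrow> G x0 y0 ?\<alpha>) (at ?\<alpha>)" by (rule limG) (use ord mn in auto)
  have D0: "G x0 y0 ?\<alpha> \<noteq> 0" using D[OF S(2)] x0(3) y0(3) by simp
  have eq: "A E * B E / G x0 y0 E = L (F E) (F' E) m * L (R E) (R' E) n" if "E \<in> S" "G x0 y0 E \<noteq> 0" for E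
    using that(2) unfolding A[OF that(1)] B[OF that(1)] D[OF that(1)] by (simp add: field_simps)
  have l: "((\<lambda>E. A E * B E / G x0 y0 E) \<longlongrightarrow> A ?\<alpha> * B ?\<alpha> / G x0 y0 ?\<alpha>) (at ?\<alpha>)"
    by (intro tendsto_intros limA limB limD D0)
  have ev: "eventually (\<lambda>E. A E * B E / G x0 y0 E = L (F E) (F' E) m * L (R E) (R' E) n) (at ?\<alpha>)"
    using evS tendsto_imp_eventually_ne[OF limD D0] by eventually_elim (rule eq)
  show ?thesis unfolding eq[OF S(2) D0, symmetric] by (rule Lim_transform_eventually[OF l ev])
qed

end

section \<open>Green functions of supersymmetric partners\<close>

lemma green_function_continuous:
  assumes "green_function a b V G" "E \<notin> spec a b V"
  shows "continuous_on (einterval a b \<times> einterval a b) (\<lambda>(x, y). G x y E)"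
  using green_function_resolvent_kernel[OF assms] by (simp add: resolvent_kernel_def)

locale susy_green = susy a b V u \<alpha> for a b V u \<alpha> +
  fixes cont :: bool and N :: "nat set" and En :: "nat \<Rightarrow> real"
    and \<psi> :: "nat \<Rightarrow> real \<Rightarrow> complex" and \<eta> :: "real \<Rightarrow> real \<Rightarrow> complex"
    and G0 G1 :: "real \<Rightarrow> real \<Rightarrow> complex \<Rightarrow> complex"
  assumes sp: "spectral_problem a b V cont N En \<psi> \<eta>"
    and pres: "preserves_boundary_conditions a b V \<alpha> w"
    and types: "deletes_ground_state a b V N En \<psi> \<alpha> u \<or> creates_ground_state a b V \<alpha> u \<or> isospectral a b V \<alpha> u"
    and G0: "green_function a b V G0" and G1: "green_function a b V1 G1"
begin

abbreviation z0 :: complex where "z0 \<equiv> of_real \<alpha>"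

lemma below_specD: "below_spec \<alpha> (spec a b V) \<Longrightarrow> z0 \<notin> spec a b V"
  by (auto simp: below_spec_def)

text \<open>In all three types the partner has no spectrum beyond that of \<open>h\<^sub>0\<close>
  and the point \<alpha>.\<close>

lemma partner_resolvent_set: "E \<notin> spec a b V \<Longrightarrow> E \<noteq> z0 \<Longrightarrow> E \<notin> spec a b V1"
  using types unfolding deletes_ground_state_def creates_ground_state_def isospectral_def by blast

lemma isolated: "\<exists>r>0. \<forall>E\<in>ball z0 r. E \<in> spec a b V \<longrightarrow> E = z0"
proof (rule spectral_gap[OF sp])
  show "(0 \<in> N \<and> \<alpha> = En 0) \<or> below_spec \<alpha> (spec a b V)"
    using types unfolding deletes_ground_state_def creates_ground_state_def isospectral_def by blast
qed

section \<open>Both Green functions in terms of Weyl pairs\<close>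

lemma weyl_pair_ex:
  assumes "E \<notin> spec a b V" shows "\<exists>F F' R R'. weyl_pair a b V E F F' R R'"
proof -
  have esa: "essentially_self_adjoint (einterval a b) (dirichlet_op a b V)" using sp by (simp add: spectral_problem_def)
  obtain C where "resolvent_bound a b V E C" using resolvent_bound_exists[OF assms] by blast
  then show ?thesis
    by (rule weyl_pair_exists[OF V ab esa green_function_resolvent_kernel[OF G0 assms]]) blast
qed

lemma weyl_pair_partner_ex:
  assumes "E \<notin> spec a b V" "E \<noteq> z0" shows "\<exists>F F' R R'. weyl_pair a b V1 E F F' R R'"
  using weyl_pair_ex[OF assms(1)] weyl_pair_partner[OF pres assms(2)] by blast

lemma G0_eq:
  assumes "E \<notin> spec a b V" "weyl_pair a b V E F F' R R'" "x \<in> I" "y \<in> I"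
  shows "G0 x y E = weyl_kernel F R x y"
proof -
  obtain C where "resolvent_bound a b V E C" using resolvent_bound_exists[OF assms(1)] by blast
  from resolvent_kernel_eq_weyl_kernel[OF V ab assms(2) green_function_resolvent_kernel[OF G0 assms(1)] this assms(3,4)] show ?thesis .
qed

lemma G1_eq:
  assumes E: "E \<notin> spec a b V" "E \<noteq> z0" and W: "weyl_pair a b V E F F' R R'" and x: "x \<in> I" "y \<in> I"
  shows "G1 x y E = inverse (E - z0) * weyl_kernel (L F F') (L R R') x y"
proof -
  obtain C where "resolvent_bound a b V1 E C" using resolvent_bound_exists[OF partner_resolvent_set[OF E]] by blast
  from resolvent_kernel_eq_weyl_kernel[OF V1_continuous ab weyl_pair_partner[OF pres E(2) W]
      green_function_resolvent_kernel[OF G1 partner_resolvent_set[OF E]] this x]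
  show ?thesis by (simp add: weyl_kernel_def)
qed

lemma green_function_formula:
  assumes E: "E \<notin> spec a b V" "E \<noteq> z0" and \<phi>: "\<phi> \<in> test_functions2 I"
  shows "kernel_dist I (\<lambda>x y. G1 x y E) \<phi> = 1 / (E - z0) * (LL_dist I w (\<lambda>x y. G0 x y E) \<phi> - delta_dist I \<phi>)"
proof -
  obtain F F' R R' where W: "weyl_pair a b V E F F' R R'" using weyl_pair_ex[OF E(1)] by blast
  note w = weyl_pairD[OF W]
  have "LL_dist I w (\<lambda>x y. G0 x y E) \<phi> = LL_dist I w (weyl_kernel F R) \<phi>"
    unfolding LL_dist_def by (rule kernel_dist_cong) (rule G0_eq[OF E(1) W])
  also have "\<dots> = kernel_dist I (weyl_kernel (L F F') (L R R')) \<phi> + delta_dist I \<phi>"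
    by (rule LL_dist_weyl_kernel[OF ab _ schroedinger_sol_continuous(2)[OF w(1)] _ schroedinger_sol_continuous(2)[OF w(2)] w_continuous w(5) \<phi> L_def[of F F'] L_def[of R R']])
      (use w(1,2) in \<open>auto simp: schroedinger_sol_def\<close>)
  finally have "LL_dist I w (\<lambda>x y. G0 x y E) \<phi> - delta_dist I \<phi> = kernel_dist I (weyl_kernel (L F F') (L R R')) \<phi>" by simp
  moreover have "kernel_dist I (\<lambda>x y. G1 x y E) \<phi> = kernel_dist I (\<lambda>x y. inverse (E - z0) * weyl_kernel (L F F') (L R R') x y) \<phi>"
    by (rule kernel_dist_cong) (rule G1_eq[OF E W])
  ultimately show ?thesis unfolding kernel_dist_cmult by (simp add: divide_inverse)
qed

lemma family_G0:
  assumes "z \<notin> spec a b V"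
  shows "\<exists>r C M. r > 0 \<and> (\<forall>S \<subseteq> ball z r. S \<inter> spec a b V = {} \<longrightarrow> (\<exists>F F' R R'. green_family a b V S C M G0 F F' R R'))"
proof -
  obtain r C M where r: "r > 0" and *: "\<And>S. S \<subseteq> ball z r \<Longrightarrow> S \<inter> spec a b V = {} \<Longrightarrow> (\<forall>E\<in>S. \<exists>F F' R R'. weyl_pair a b V E F F' R R') \<Longrightarrow>
     \<exists>F F' R R'. green_family a b V S C M G0 F F' R R'"
    using green_family_exists[OF ab V assms G0] by blast
  show ?thesis
  proof (rule exI[of _ r], rule exI[of _ C], rule exI[of _ M], intro conjI r allI impI)
    fix S assume S: "S \<subseteq> ball z r" "S \<inter> spec a b V = {}"
    show "\<exists>F F' R R'. green_family a b V S C M G0 F F' R R'"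
      by (rule *[OF S]) (use weyl_pair_ex S(2) in blast)
  qed
qed

text \<open>The sets must avoid \<alpha> and the spectrum of \<open>h\<^sub>0\<close>, since Weyl
  pairs of the partner are images of those of \<open>h\<^sub>0\<close> under \<open>L\<close>. The
  centre \<open>z\<close> only has to lie in the resolvent set of the partner.\<close>

lemma family_G1:
  assumes "z \<notin> spec a b V1"
  shows "\<exists>r C M. r > 0 \<and> (\<forall>S \<subseteq> ball z r. S \<inter> spec a b V = {} \<longrightarrow> z0 \<notin> S \<longrightarrow> (\<exists>F F' R R'. green_family a b V1 S C M G1 F F' R R'))"
proof -
  obtain r C M where r: "r > 0" and *: "\<And>S. S \<subseteq> ball z r \<Longrightarrow> S \<inter> spec a b V1 = {} \<Longrightarrow> (\<forall>E\<in>S. \<exists>F F' R R'. weyl_pair a b V1 E F F' R R') \<Longrightarrow>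
     \<exists>F F' R R'. green_family a b V1 S C M G1 F F' R R'"
    using green_family_exists[OF ab V1_continuous assms G1] by blast
  show ?thesis
  proof (rule exI[of _ r], rule exI[of _ C], rule exI[of _ M], intro conjI r allI impI)
    fix S assume S: "S \<subseteq> ball z r" "S \<inter> spec a b V = {}" "z0 \<notin> S"
    have E: "E \<notin> spec a b V \<and> E \<noteq> z0" if "E \<in> S" for E using S that by blast
    show "\<exists>F F' R R'. green_family a b V1 S C M G1 F F' R R'"
    proof (rule *[OF S(1)])
      show "S \<inter> spec a b V1 = {}" using E partner_resolvent_set by blast
      show "\<forall>E\<in>S. \<exists>F F' R R'. weyl_pair a b V1 E F F' R R'" using E weyl_pair_partner_ex by blast
    qed
  qed
qed

text \<open>As \<alpha> is in the resolvent set of the partner, one resolvent constant serves a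
  punctured disc around it. The Lipschitz bound extends over the centre, so \<alpha> is a removable
  singularity with the correct value. One radius is shared by all three claims.\<close>

lemma G1_regular:
  assumes z0: "z0 \<notin> spec a b V1"
  shows "\<exists>r>0. (\<forall>E\<in>ball z0 r - {z0}. E \<notin> spec a b V) \<and>
    (\<forall>x\<in>I. \<forall>y\<in>I. (\<lambda>E. G1 x y E) holomorphic_on ball z0 r) \<and>
    (\<forall>c\<in>I. \<forall>d\<in>I. c < d \<longrightarrow> (\<exists>K\<ge>0. \<forall>E\<in>ball z0 r. \<forall>E'\<in>ball z0 r. \<forall>x\<in>{c<..<d}. \<forall>y\<in>{c<..<d}.
       cmod (G1 x y E - G1 x y E') \<le> K * cmod (E - E')))"
proof -
  obtain r1 where r1: "r1 > 0" "\<And>E. E \<in> ball z0 r1 \<Longrightarrow> E \<in> spec a b V \<Longrightarrow> E = z0" using isolated by blast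
  obtain r2 C M where r2: "r2 > 0" and fam: "\<And>S. S \<subseteq> ball z0 r2 \<Longrightarrow> S \<inter> spec a b V = {} \<Longrightarrow> z0 \<notin> S \<Longrightarrow>
     \<exists>F F' R R'. green_family a b V1 S C M G1 F F' R R'"
    using family_G1[OF z0] by blast
  define r where "r = min r1 r2"
  have r: "r > 0" using r1(1) r2 by (simp add: r_def)
  define S where "S = ball z0 r - {z0}"
  have sub: "S \<subseteq> ball z0 r1" "S \<subseteq> ball z0 r2" by (auto simp: S_def r_def)
  have ns: "E \<notin> spec a b V" if "E \<in> S" for E using r1(2)[of E] sub(1) that by (auto simp: S_def)
  have S: "S \<inter> spec a b V = {}" "z0 \<notin> S" using ns by (blast, simp add: S_def)
  obtain F F' R R' where F: "green_family a b V1 S C M G1 F F' R R'"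
    using fam[OF sub(2) S] by blast
  have K0: "resolvent_kernel a b V1 z0 (\<lambda>x y. G1 x y z0)" by (rule green_function_resolvent_kernel[OF G1 z0])
  have KE: "resolvent_kernel a b V1 E (\<lambda>x y. G1 x y E)" if "E \<in> S" for E
    by (rule green_function_resolvent_kernel[OF G1 partner_resolvent_set[OF ns[OF that]]]) (use that in \<open>auto simp: S_def\<close>)
  have lip: "\<exists>K\<ge>0. \<forall>E\<in>ball z0 r. \<forall>E'\<in>ball z0 r. \<forall>x\<in>{c<..<d}. \<forall>y\<in>{c<..<d}. cmod (G1 x y E - G1 x y E') \<le> K * cmod (E - E')"
    if cd: "c \<in> I" "d \<in> I" "c < d" for c d
  proof -
    obtain K1 where K1: "K1 \<ge> 0" "\<And>E x y. E \<in> S \<Longrightarrow> x \<in> {c<..<d} \<Longrightarrow> y \<in> {c<..<d} \<Longrightarrow> cmod (G1 x y E - G1 x y z0) \<le> K1 * cmod (E - z0)"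
      using green_family.center_identification[OF F S_def r cd K0 KE] by blast
    obtain K2 where K2: "K2 \<ge> 0" "\<And>E E' x y. E \<in> S \<Longrightarrow> E' \<in> S \<Longrightarrow> x \<in> {c..d} \<Longrightarrow> y \<in> {c..d} \<Longrightarrow> cmod (G1 x y E - G1 x y E') \<le> K2 * cmod (E - E')"
      using green_family.lipschitz[OF F cd(1,2)] by blast
    have mono: "K1 * cmod t \<le> max K1 K2 * cmod t" "K2 * cmod t \<le> max K1 K2 * cmod t" for t
      by (intro mult_right_mono; simp)+
    have "cmod (G1 x y E - G1 x y E') \<le> max K1 K2 * cmod (E - E')"
      if E: "E \<in> ball z0 r" "E' \<in> ball z0 r" and x: "x \<in> {c<..<d}" "y \<in> {c<..<d}" for E E' x y
    proof -
      consider "E \<in> S" "E' \<in> S" | "E \<in> S" "E' = z0" | "E = z0" "E' \<in> S" | "E = z0" "E' = z0"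
        using E by (auto simp: S_def)
      then show ?thesis
      proof cases
        case 1
        then show ?thesis using K2(2)[OF 1, of x y] x mono(2)[of "E - E'"] by fastforce
      next
        case 2
        then show ?thesis using K1(2)[OF 2(1) x] mono(1)[of "E - z0"] by simp
      next
        case 3
        then show ?thesis using K1(2)[OF 3(2) x] mono(1)[of "E' - z0"] by (simp add: norm_minus_commute)
      qed simp
    qed
    then show ?thesis using K1(1) by (intro exI[of _ "max K1 K2"]) auto
  qed
  have hol: "(\<lambda>E. G1 x y E) holomorphic_on ball z0 r" if xy: "x \<in> I" "y \<in> I" for x y
  proof (rule no_isolated_singularity[where K="{z0}" and S="ball z0 r"])
    have "compact {x, y}" "{x, y} \<subseteq> I" using xy by auto
    then obtain c d where cd: "c \<in> I" "d \<in> I" "c < d" "{x, y} \<subseteq> {c<..<d}"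
      using compact_in_einterval[OF _ _ ab] by metis
    obtain K where K: "K \<ge> 0" "\<And>E E' x y. E \<in> ball z0 r \<Longrightarrow> E' \<in> ball z0 r \<Longrightarrow> x \<in> {c<..<d} \<Longrightarrow> y \<in> {c<..<d} \<Longrightarrow> cmod (G1 x y E - G1 x y E') \<le> K * cmod (E - E')"
      using lip[OF cd(1-3)] by blast
    have "K-lipschitz_on (ball z0 r) (\<lambda>E. G1 x y E)"
      by (rule lipschitz_onI) (use K cd(4) in \<open>auto simp: dist_norm\<close>)
    then show "continuous_on (ball z0 r) (\<lambda>E. G1 x y E)" by (rule lipschitz_on_continuous_on)
    show "(\<lambda>E. G1 x y E) holomorphic_on ball z0 r - {z0}"
      using green_family.holomorphic[OF F _ xy] by (simp add: S_def open_delete)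
  qed auto
  show ?thesis using r ns lip hol unfolding S_def by blast
qed

lemma G1_analytic:
  assumes "z0 \<notin> spec a b V1" "x \<in> I" "y \<in> I"
  shows "(\<lambda>E. G1 x y E) analytic_on {z0}"
  using G1_regular[OF assms(1)] assms(2,3) unfolding analytic_at by (meson centre_in_ball open_ball)

text \<open>\<open>(E - \<alpha>) * G1 x y E\<close> is the numerator \<open>?N E\<close>, which
  tends to the nonzero value \<open>?N z0\<close>; this is possible because \<alpha> lies outside
  the spectrum of \<open>h\<^sub>0\<close>, so that Weyl pairs of \<open>h\<^sub>0\<close> exist on
  a full disc.\<close>

lemma G1_simple_pole:
  assumes cr: "creates_ground_state a b V \<alpha> u" and xy: "x \<in> I" "y \<in> I"
  shows "has_simple_pole (\<lambda>E. G1 x y E) z0"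
proof -
  have z0: "z0 \<notin> spec a b V" using cr below_specD by (simp add: creates_ground_state_def)
  have v: "vanishes_left a (\<lambda>x. complex_of_real (1 / u x))" "vanishes_right b (\<lambda>x. complex_of_real (1 / u x))"
    using cr dirichlet_opD(5,6) by (auto simp: creates_ground_state_def)
  obtain r1 where r1: "r1 > 0" "\<And>E. E \<in> ball z0 r1 \<Longrightarrow> E \<in> spec a b V \<Longrightarrow> E = z0" using isolated by blast
  obtain r2 C M where r2: "r2 > 0" and fam: "\<And>S. S \<subseteq> ball z0 r2 \<Longrightarrow> S \<inter> spec a b V = {} \<Longrightarrow>
     \<exists>F F' R R'. green_family a b V S C M G0 F F' R R'"
    using family_G0[OF z0] by blast
  define r where "r = min r1 r2"
  have r: "r > 0" using r1(1) r2 by (simp add: r_def)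
  have ns: "E \<notin> spec a b V" if "E \<in> ball z0 r" for E using r1(2)[of E] z0 that by (auto simp: r_def)
  have "ball z0 r \<subseteq> ball z0 r2" by (auto simp: r_def)
  then obtain F F' R R' where F: "green_family a b V (ball z0 r) C M G0 F F' R R'"
    using fam[of "ball z0 r"] ns by blast
  note W = green_family.weyl[OF F]
  define m n where "m = min x y" and "n = max x y"
  have mn: "m \<in> I" "n \<in> I" "m \<le> n" using xy by (auto simp: m_def n_def min_def max_def)
  let ?N = "\<lambda>E. L (F E) (F' E) m * L (R E) (R' E) n"
  have lim: "(?N \<longlongrightarrow> ?N z0) (at z0)" by (rule numerator_continuous[OF F _ _ mn]) (use r in auto)
  have W0: "weyl_pair a b V z0 (F z0) (F' z0) (R z0) (R' z0)" by (rule W) (use r in auto)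
  have N0: "?N z0 \<noteq> 0" using L_nonzero_at_alpha[OF W0 v] mn by simp
  have "(E - z0) * G1 x y E = ?N E" if "E \<in> ball z0 r" "E \<noteq> z0" for E
    using G1_eq[OF ns[OF that(1)] that(2) W[OF that(1)] xy] that(2) by (simp add: weyl_kernel_def m_def n_def field_simps)
  moreover have "eventually (\<lambda>E. E \<in> ball z0 r - {z0}) (at z0)" by (rule eventually_at_in_open) (use r in auto)
  ultimately have ev: "eventually (\<lambda>E. ?N E = (E - z0) * G1 x y E) (at z0)" by (auto elim: eventually_mono)
  have "((\<lambda>E. (E - z0) * G1 x y E) \<longlongrightarrow> ?N z0) (at z0)" by (rule Lim_transform_eventually[OF lim ev])
  moreover have "(\<lambda>E. G1 x y E) holomorphic_on ball z0 r - {z0}"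
  proof -
    \<comment> \<open>Holomorphy is shown near each point separately: \<alpha> belongs to the
      spectrum of the partner, so no resolvent bound at \<alpha> is available to give one constant
      on the punctured disc.\<close>
    have "(\<lambda>E. G1 x y E) field_differentiable (at E)" if E: "E \<in> ball z0 r - {z0}" for E
    proof -
      have "E \<notin> spec a b V1" using partner_resolvent_set ns E by blast
      then obtain r3 C M where r3: "r3 > 0" and fam1: "\<And>S. S \<subseteq> ball E r3 \<Longrightarrow> S \<inter> spec a b V = {} \<Longrightarrow> z0 \<notin> S \<Longrightarrow>
          \<exists>F F' R R'. green_family a b V1 S C M G1 F F' R R'"
        using family_G1 by blast
      define T where "T = ball E r3 \<inter> (ball z0 r - {z0})"
      have T: "open T" "E \<in> T" using E r3 by (auto simp: T_def intro!: open_Int open_delete)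
      have Ts: "T \<subseteq> ball E r3" "T \<inter> spec a b V = {}" "z0 \<notin> T" using ns by (auto simp: T_def)
      obtain F F' R R' where "green_family a b V1 T C M G1 F F' R R'"
        using fam1[OF Ts] by blast
      from green_family.holomorphic[OF this T(1) xy] show ?thesis
        by (rule holomorphic_on_imp_differentiable_at[OF _ T])
    qed
    then show ?thesis by (simp add: holomorphic_on_def field_differentiable_at_within)
  qed
  ultimately show ?thesis using has_simple_poleI[OF r _ _ N0] by blast
qed

text \<open>One sequence is enough, since the limit is only used to identify other limits along the
  same sequence.\<close>

lemma LL_dist_deriv_limit:
  assumes \<phi>: "\<phi> \<in> test_functions2 I" and U: "open U" "z \<in> U" "U \<inter> spec a b V = {}"
  shows "\<exists>e. (\<forall>n::nat. e n \<in> U - {z}) \<and> e \<longlonglongrightarrow> z \<and>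
    (\<lambda>n. (LL_dist I w (\<lambda>x y. G0 x y (e n)) \<phi> - LL_dist I w (\<lambda>x y. G0 x y z) \<phi>) / (e n - z))
      \<longlonglongrightarrow> LL_dist I w (\<lambda>x y. deriv (\<lambda>E. G0 x y E) z) \<phi>"
proof -
  have z: "z \<notin> spec a b V" using U by blast
  obtain r C M where r: "r > 0" and fam: "\<And>S. S \<subseteq> ball z r \<Longrightarrow> S \<inter> spec a b V = {} \<Longrightarrow>
     \<exists>F F' R R'. green_family a b V S C M G0 F F' R R'"
    using family_G0[OF z] by blast
  define T where "T = ball z r \<inter> U"
  have T: "open T" "z \<in> T" "T \<subseteq> ball z r" "T \<inter> spec a b V = {}" using U r by (auto simp: T_def)
  obtain F F' R R' where F: "green_family a b V T C M G0 F F' R R'" using fam[OF T(3,4)] by blast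
  obtain c d where cd: "c \<in> I" "d \<in> I" "c < d" and test: "supported_test c d (Lt_x w (Lt_y w \<phi>))"
    using test_functions2_supported[OF \<phi> ab w_continuous] by blast
  obtain K where K: "\<And>E E' x y. E \<in> T \<Longrightarrow> E' \<in> T \<Longrightarrow> x \<in> {c..d} \<Longrightarrow> y \<in> {c..d} \<Longrightarrow> cmod (G0 x y E - G0 x y E') \<le> K * cmod (E - E')"
    using green_family.lipschitz[OF F cd(1,2)] by blast
  obtain r3 where r3: "r3 > 0" "ball z r3 \<subseteq> T" using T(1,2) openE by blast
  obtain e where e: "\<And>n::nat. e n \<in> ball z r3 - {z}" "e \<longlonglongrightarrow> z" by (rule ball_sequence[OF r3(1)]) blast
  have eT: "e n \<in> T - {z}" for n using e(1)[of n] r3(2) by blast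
  have "(\<lambda>n. (LL_dist I w (\<lambda>x y. G0 x y (e n)) \<phi> - LL_dist I w (\<lambda>x y. G0 x y z) \<phi>) / (e n - z))
      \<longlonglongrightarrow> LL_dist I w (\<lambda>x y. deriv (\<lambda>E. G0 x y E) z) \<phi>"
    unfolding LL_dist_def
  proof (rule kernel_dist_deriv_limit[OF test einterval_Icc_subset[OF cd(1,2)] T(1,2) _ _ _ eT e(2)])
    show "(\<lambda>E. G0 x y E) holomorphic_on T" if "x \<in> I" "y \<in> I" for x y
      by (rule green_family.holomorphic[OF F T(1) that])
    show "continuous_on (I \<times> I) (\<lambda>(x, y). G0 x y E)" if "E \<in> T" for E
      by (rule green_function_continuous[OF G0]) (use that T(4) in blast)
    show "cmod (G0 x y E - G0 x y z) \<le> K * cmod (E - z)" if "E \<in> T" "x \<in> {c..d}" "y \<in> {c..d}" for E x y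
      by (rule K[OF that(1) T(2) that(2,3)])
  qed
  moreover have "\<forall>n. e n \<in> U - {z}" using eT by (auto simp: T_def)
  ultimately show ?thesis using e(2) by blast
qed

lemma G1_smeared_lipschitz:
  assumes z0: "z0 \<notin> spec a b V1" and \<phi>: "\<phi> \<in> test_functions2 I"
  shows "\<exists>r K. r > 0 \<and> K \<ge> 0 \<and> (\<forall>E\<in>ball z0 r - {z0}. E \<notin> spec a b V) \<and>
    (\<forall>E\<in>ball z0 r. \<forall>E'\<in>ball z0 r. cmod (kernel_dist I (\<lambda>x y. G1 x y E) \<phi> - kernel_dist I (\<lambda>x y. G1 x y E') \<phi>) \<le> K * cmod (E - E'))"
proof -
  obtain c d where cd: "c \<in> I" "d \<in> I" "c < d" and test: "supported_test c d \<phi>"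
    using test_functions2_supported[OF \<phi> ab w_continuous] by blast
  obtain r where r: "r > 0" "\<forall>E\<in>ball z0 r - {z0}. E \<notin> spec a b V" and
    lip: "\<forall>c\<in>I. \<forall>d\<in>I. c < d \<longrightarrow> (\<exists>K\<ge>0. \<forall>E\<in>ball z0 r. \<forall>E'\<in>ball z0 r. \<forall>x\<in>{c<..<d}. \<forall>y\<in>{c<..<d}. cmod (G1 x y E - G1 x y E') \<le> K * cmod (E - E'))"
    using G1_regular[OF z0] by (elim exE conjE)
  obtain K where K: "K \<ge> 0" "\<And>E E' x y. E \<in> ball z0 r \<Longrightarrow> E' \<in> ball z0 r \<Longrightarrow> x \<in> {c<..<d} \<Longrightarrow> y \<in> {c<..<d} \<Longrightarrow>
      cmod (G1 x y E - G1 x y E') \<le> K * cmod (E - E')"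
    using lip[rule_format, OF cd] by blast
  obtain B where B: "B \<ge> 0" "\<And>K K' \<kappa>. continuous_on (I \<times> I) (\<lambda>(x, y). K x y) \<Longrightarrow> continuous_on (I \<times> I) (\<lambda>(x, y). K' x y) \<Longrightarrow>
     (\<forall>x\<in>{c<..<d}. \<forall>y\<in>{c<..<d}. cmod (K x y - K' x y) \<le> \<kappa>) \<Longrightarrow> cmod (kernel_dist I K \<phi> - kernel_dist I K' \<phi>) \<le> \<kappa> * B"
    using kernel_dist_lipschitz[OF test einterval_Icc_subset[OF cd(1,2)]] by blast
  have cont: "continuous_on (I \<times> I) (\<lambda>(x, y). G1 x y E)" if "E \<in> ball z0 r" for E
    by (rule green_function_continuous[OF G1]) (use that r(2) z0 partner_resolvent_set[of E] in blast)
  have "cmod (kernel_dist I (\<lambda>x y. G1 x y E) \<phi> - kernel_dist I (\<lambda>x y. G1 x y E') \<phi>) \<le> (K * B) * cmod (E - E')"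
    if E: "E \<in> ball z0 r" "E' \<in> ball z0 r" for E E'
  proof -
    have "cmod (kernel_dist I (\<lambda>x y. G1 x y E) \<phi> - kernel_dist I (\<lambda>x y. G1 x y E') \<phi>) \<le> K * cmod (E - E') * B"
      by (rule B(2)[OF cont[OF E(1)] cont[OF E(2)]]) (use K(2)[OF E] in blast)
    then show ?thesis by (simp add: mult_ac)
  qed
  moreover have "0 \<le> K * B" using K(1) B(1) by simp
  ultimately show ?thesis using r by blast
qed

lemma LL_dist_G0:
  assumes "E \<notin> spec a b V" "E \<noteq> z0" "\<phi> \<in> test_functions2 I"
  shows "LL_dist I w (\<lambda>x y. G0 x y E) \<phi> = delta_dist I \<phi> + (E - z0) * kernel_dist I (\<lambda>x y. G1 x y E) \<phi>"
  unfolding green_function_formula[OF assms] using assms(2) by simp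

text \<open>With \<open>k\<close> and \<open>l\<close> the smeared \<open>G1\<close> and
  \<open>L\<^sub>x L\<^sub>y G0\<close>, the relation
  \<open>l(E) = \<delta> + (E - \<alpha>) k(E)\<close> and continuity give
  \<open>l(\<alpha>) = \<delta>\<close>. The divided difference of \<open>l\<close> at \<alpha> is
  then exactly \<open>k(E)\<close>, whose limit is \<open>k(\<alpha>)\<close>.\<close>

lemma isospectral_derivative:
  assumes iso: "isospectral a b V \<alpha> u" and \<phi>: "\<phi> \<in> test_functions2 I"
  shows "kernel_dist I (\<lambda>x y. G1 x y z0) \<phi> = LL_dist I w (\<lambda>x y. deriv (\<lambda>E. G0 x y E) z0) \<phi>"
proof -
  have z: "z0 \<notin> spec a b V" and z1: "z0 \<notin> spec a b V1"
    using iso below_specD by (auto simp: isospectral_def)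
  obtain r K where r: "r > 0" "\<And>E. E \<in> ball z0 r - {z0} \<Longrightarrow> E \<notin> spec a b V"
    and K: "\<And>E E'. E \<in> ball z0 r \<Longrightarrow> E' \<in> ball z0 r \<Longrightarrow> cmod (kernel_dist I (\<lambda>x y. G1 x y E) \<phi> - kernel_dist I (\<lambda>x y. G1 x y E') \<phi>) \<le> K * cmod (E - E')"
    using G1_smeared_lipschitz[OF z1 \<phi>] by blast
  define k where "k E = kernel_dist I (\<lambda>x y. G1 x y E) \<phi>" for E
  define l where "l E = LL_dist I w (\<lambda>x y. G0 x y E) \<phi>" for E
  have "ball z0 r \<inter> spec a b V = {}" using r(2) z by blast
  then obtain e where e: "\<And>n::nat. e n \<in> ball z0 r - {z0}" "e \<longlonglongrightarrow> z0"
    and q: "(\<lambda>n. (l (e n) - l z0) / (e n - z0)) \<longlonglongrightarrow> LL_dist I w (\<lambda>x y. deriv (\<lambda>E. G0 x y E) z0) \<phi>"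
    using LL_dist_deriv_limit[OF \<phi> open_ball, of z0 z0 r] r(1) unfolding l_def by auto
  have en: "e n \<noteq> z0" for n using e(1)[of n] by blast
  have d0: "(\<lambda>n. e n - z0) \<longlonglongrightarrow> 0" using e(2) by (rule LIM_zero)
  have "(\<lambda>n. k (e n) - k z0) \<longlonglongrightarrow> 0"
  proof (rule Lim_null_comparison)
    show "\<forall>\<^sub>F n in sequentially. cmod (k (e n) - k z0) \<le> K * cmod (e n - z0)"
      using K[of "e _" z0] e(1) r(1) by (simp add: k_def)
    show "(\<lambda>n. K * cmod (e n - z0)) \<longlonglongrightarrow> 0"
      using tendsto_mult_right_zero[OF tendsto_norm_zero[OF d0]] .
  qed
  then have k: "(\<lambda>n. k (e n)) \<longlonglongrightarrow> k z0" by (rule LIM_zero_cancel)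
  have le: "l (e n) = delta_dist I \<phi> + (e n - z0) * k (e n)" for n
    unfolding l_def k_def by (rule LL_dist_G0[OF r(2)[OF e(1)] en \<phi>])
  have "(\<lambda>n. l (e n)) \<longlonglongrightarrow> delta_dist I \<phi> + 0 * k z0"
    unfolding le by (intro tendsto_intros d0 k)
  \<comment> \<open>Convergence of the divided differences gives continuity of \<open>l\<close> at
    \<open>z0\<close> along the sequence.\<close>
  moreover have "(\<lambda>n. l z0 + (e n - z0) * ((l (e n) - l z0) / (e n - z0)))
      \<longlonglongrightarrow> l z0 + 0 * LL_dist I w (\<lambda>x y. deriv (\<lambda>E. G0 x y E) z0) \<phi>"
    by (intro tendsto_intros d0 q)
  moreover have "(\<lambda>n. l z0 + (e n - z0) * ((l (e n) - l z0) / (e n - z0))) = (\<lambda>n. l (e n))"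
    using en by simp
  ultimately have "l z0 = delta_dist I \<phi>" using LIMSEQ_unique by fastforce
  then have "(l (e n) - l z0) / (e n - z0) = k (e n)" for n using le[of n] en[of n] by simp
  then have "(\<lambda>n. k (e n)) \<longlonglongrightarrow> LL_dist I w (\<lambda>x y. deriv (\<lambda>E. G0 x y E) z0) \<phi>" using q by simp
  from LIMSEQ_unique[OF k this] show ?thesis by (simp add: k_def)
qed

text \<open>With \<open>k(E)\<close> and \<open>l(E)\<close> the smeared \<open>G\<^sub>1\<close> and \<open>L\<^sub>x L\<^sub>y G\<^sub>0\<close>, the relation \<open>l(E) = \<delta> + (E - \<alpha>) k(E)\<close> and the Lipschitz
  continuity of \<open>k\<close> give \<open>l'(E) = k(E) + O(E - \<alpha>)\<close>.\<close>

lemma deleted_derivative_limit: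
  assumes del: "deletes_ground_state a b V N En \<psi> \<alpha> u" and \<phi>: "\<phi> \<in> test_functions2 I"
  shows "((\<lambda>E. LL_dist I w (\<lambda>x y. deriv (\<lambda>E'. G0 x y E') E) \<phi>) \<longlongrightarrow> kernel_dist I (\<lambda>x y. G1 x y z0) \<phi>) (at z0)"
proof -
  have z1: "z0 \<notin> spec a b V1" using del by (auto simp: deletes_ground_state_def)
  obtain r K where r: "r > 0" "\<And>E. E \<in> ball z0 r - {z0} \<Longrightarrow> E \<notin> spec a b V" and K0: "K \<ge> 0"
    and K: "\<And>E E'. E \<in> ball z0 r \<Longrightarrow> E' \<in> ball z0 r \<Longrightarrow> cmod (kernel_dist I (\<lambda>x y. G1 x y E) \<phi> - kernel_dist I (\<lambda>x y. G1 x y E') \<phi>) \<le> K * cmod (E - E')"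
    using G1_smeared_lipschitz[OF z1 \<phi>] by blast
  define k where "k E = kernel_dist I (\<lambda>x y. G1 x y E) \<phi>" for E
  define l where "l E = LL_dist I w (\<lambda>x y. G0 x y E) \<phi>" for E
  define p where "p E = LL_dist I w (\<lambda>x y. deriv (\<lambda>E'. G0 x y E') E) \<phi>" for E
  have bd: "cmod (p E - k z0) \<le> 2 * K * cmod (E - z0)" if E: "E \<in> ball z0 r - {z0}" for E
  proof -
    have "(ball z0 r - {z0}) \<inter> spec a b V = {}" using r(2) by blast
    then obtain e where e: "\<And>n::nat. e n \<in> ball z0 r - {z0} - {E}" "e \<longlonglongrightarrow> E"
      and q: "(\<lambda>n. (l (e n) - l E) / (e n - E)) \<longlonglongrightarrow> p E"
      using LL_dist_deriv_limit[OF \<phi> open_delete[OF open_ball] E] unfolding l_def p_def by auto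
    have le: "l E' = delta_dist I \<phi> + (E' - z0) * k E'" if "E' \<in> ball z0 r - {z0}" for E'
      unfolding l_def k_def by (rule LL_dist_G0[OF r(2)[OF that] _ \<phi>]) (use that in blast)
    \<comment> \<open>The increment of the product \<open>(E - \<alpha>) k(E)\<close> is split so
      that one part is \<open>k (e n)\<close> times the increment of the energy and the other
      carries the small factor \<open>E - \<alpha>\<close>. As \<open>e n\<close> tends to
      \<open>E\<close>, both terms of the bound become \<open>K * cmod (E - z0)\<close>, whence the
      factor 2.\<close>
    have bound: "cmod ((l (e n) - l E) / (e n - E) - k z0) \<le> K * cmod (e n - z0) + K * cmod (E - z0)" for n
    proof -
      have en: "e n \<in> ball z0 r - {z0}" "e n \<noteq> E" using e(1)[of n] by auto
      have "l (e n) - l E = (e n - E) * k (e n) + (E - z0) * (k (e n) - k E)"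
        unfolding le[OF en(1)] le[OF E] by (simp add: algebra_simps)
      then have "(l (e n) - l E) / (e n - E) - k z0 = (k (e n) - k z0) + (E - z0) * ((k (e n) - k E) / (e n - E))"
        using en(2) by (simp add: add_divide_distrib)
      then have "cmod ((l (e n) - l E) / (e n - E) - k z0) \<le> cmod (k (e n) - k z0) + cmod (E - z0) * cmod ((k (e n) - k E) / (e n - E))"
        by (metis norm_triangle_ineq norm_mult)
      also have "\<dots> \<le> K * cmod (e n - z0) + cmod (E - z0) * K"
      proof (intro add_mono mult_left_mono)
        show "cmod (k (e n) - k z0) \<le> K * cmod (e n - z0)" unfolding k_def by (rule K) (use en r in auto)
        have "cmod (k (e n) - k E) \<le> K * cmod (e n - E)" unfolding k_def by (rule K) (use en E in auto)
        then show "cmod ((k (e n) - k E) / (e n - E)) \<le> K" using en(2) by (simp add: norm_divide divide_le_eq)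
      qed simp
      finally show ?thesis by (simp add: mult.commute)
    qed
    have "cmod (p E - k z0) \<le> K * cmod (E - z0) + K * cmod (E - z0)"
    proof (rule tendsto_le[OF sequentially_bot])
      show "(\<lambda>n. K * cmod (e n - z0) + K * cmod (E - z0)) \<longlonglongrightarrow> K * cmod (E - z0) + K * cmod (E - z0)" by (intro tendsto_intros e(2))
      show "(\<lambda>n. cmod ((l (e n) - l E) / (e n - E) - k z0)) \<longlonglongrightarrow> cmod (p E - k z0)" by (intro tendsto_intros q)
    qed (use bound in simp)
    then show ?thesis by simp
  qed
  have "((\<lambda>E. p E - k z0) \<longlongrightarrow> 0) (at z0)"
  proof (rule Lim_null_comparison)
    have "eventually (\<lambda>E. E \<in> ball z0 r - {z0}) (at z0)" by (rule eventually_at_in_open) (use r in auto)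
    then show "\<forall>\<^sub>F E in at z0. cmod (p E - k z0) \<le> 2 * K * cmod (E - z0)" by eventually_elim (rule bd)
    have "((\<lambda>E. 2 * K * cmod (E - z0)) \<longlongrightarrow> 2 * K * cmod (z0 - z0)) (at z0)" by (intro tendsto_intros)
    then show "((\<lambda>E. 2 * K * cmod (E - z0)) \<longlongrightarrow> 0) (at z0)" by simp
  qed
  then show ?thesis unfolding p_def k_def by (rule LIM_zero_cancel)
qed

end


theorem theorem1:
  fixes a b :: ereal and V0 V1 u w :: "real \<Rightarrow> real" and \<alpha> :: real
    and cont :: bool and N :: "nat set" and En :: "nat \<Rightarrow> real"
    and \<psi> :: "nat \<Rightarrow> real \<Rightarrow> complex" and \<eta> :: "real \<Rightarrow> real \<Rightarrow> complex"
    and G0 G1 :: "real \<Rightarrow> real \<Rightarrow> complex \<Rightarrow> complex"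
  assumes "spectral_problem a b V0 cont N En \<psi> \<eta>"
    and "susy_transformation a b V0 N En \<alpha> u"
    and "w = superpotential u" and "V1 = partner V0 u"
    and "deletes_ground_state a b V0 N En \<psi> \<alpha> u \<or> creates_ground_state a b V0 \<alpha> u \<or>
         isospectral a b V0 \<alpha> u"
    and "green_function a b V0 G0"
    and "green_function a b V1 G1"
  shows
    "(\<forall>E. E \<notin> spec a b V0 \<longrightarrow> E \<noteq> complex_of_real \<alpha> \<longrightarrow>
       (\<forall>\<phi>\<in>test_functions2 (einterval a b).
          kernel_dist (einterval a b) (\<lambda>x y. G1 x y E) \<phi> =
            1 / (E - complex_of_real \<alpha>) *
              (LL_dist (einterval a b) w (\<lambda>x y. G0 x y E) \<phi> - delta_dist (einterval a b) \<phi>))) \<and>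
     (creates_ground_state a b V0 \<alpha> u \<longrightarrow>
       (\<forall>x\<in>einterval a b. \<forall>y\<in>einterval a b.
          has_simple_pole (\<lambda>E. G1 x y E) (complex_of_real \<alpha>))) \<and>
     (deletes_ground_state a b V0 N En \<psi> \<alpha> u \<or> isospectral a b V0 \<alpha> u \<longrightarrow>
       (\<forall>x\<in>einterval a b. \<forall>y\<in>einterval a b.
          (\<lambda>E. G1 x y E) analytic_on {complex_of_real \<alpha>})) \<and>
     (isospectral a b V0 \<alpha> u \<longrightarrow>
       (\<forall>\<phi>\<in>test_functions2 (einterval a b).
          kernel_dist (einterval a b) (\<lambda>x y. G1 x y (complex_of_real \<alpha>)) \<phi> =
            LL_dist (einterval a b) w
              (\<lambda>x y. deriv (\<lambda>E. G0 x y E) (complex_of_real \<alpha>)) \<phi>)) \<and>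
     (deletes_ground_state a b V0 N En \<psi> \<alpha> u \<longrightarrow>
       (\<forall>\<phi>\<in>test_functions2 (einterval a b).
          ((\<lambda>E. LL_dist (einterval a b) w (\<lambda>x y. deriv (\<lambda>E'. G0 x y E') E) \<phi>)
             \<longlongrightarrow> kernel_dist (einterval a b) (\<lambda>x y. G1 x y (complex_of_real \<alpha>)) \<phi>)
            (at (complex_of_real \<alpha>))))"
proof -
  have cont0: "a < b" "continuous_on (einterval a b) V0" using assms(1) by (simp_all add: spectral_problem_def)
  interpret P: susy_green a b V0 u \<alpha> cont N En \<psi> \<eta> G0 G1
    by unfold_locales
      (use assms(2,4-7) assms(1) cont0 in \<open>simp_all add: susy_transformation_def\<close>)
  let ?I = "einterval a b" and ?\<alpha> = "complex_of_real \<alpha>"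
  have reg: "?\<alpha> \<notin> spec a b (partner V0 u)" if "deletes_ground_state a b V0 N En \<psi> \<alpha> u \<or> isospectral a b V0 \<alpha> u"
    using that P.below_specD unfolding deletes_ground_state_def isospectral_def by blast
  show ?thesis
    unfolding assms(3)
  proof (intro conjI impI allI ballI)
    show "kernel_dist ?I (\<lambda>x y. G1 x y E) \<phi> =
        1 / (E - ?\<alpha>) * (LL_dist ?I (superpotential u) (\<lambda>x y. G0 x y E) \<phi> - delta_dist ?I \<phi>)"
      if "E \<notin> spec a b V0" "E \<noteq> ?\<alpha>" "\<phi> \<in> test_functions2 ?I" for E \<phi>
      by (rule P.green_function_formula[OF that])
    show "has_simple_pole (\<lambda>E. G1 x y E) ?\<alpha>"
      if "creates_ground_state a b V0 \<alpha> u" "x \<in> ?I" "y \<in> ?I" for x y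
      by (rule P.G1_simple_pole[OF that])
    show "(\<lambda>E. G1 x y E) analytic_on {?\<alpha>}"
      if "deletes_ground_state a b V0 N En \<psi> \<alpha> u \<or> isospectral a b V0 \<alpha> u" "x \<in> ?I" "y \<in> ?I" for x y
      by (rule P.G1_analytic[OF reg[OF that(1)] that(2,3)])
    show "kernel_dist ?I (\<lambda>x y. G1 x y ?\<alpha>) \<phi> =
        LL_dist ?I (superpotential u) (\<lambda>x y. deriv (\<lambda>E. G0 x y E) ?\<alpha>) \<phi>"
      if "isospectral a b V0 \<alpha> u" "\<phi> \<in> test_functions2 ?I" for \<phi>
      by (rule P.isospectral_derivative[OF that])
    show "((\<lambda>E. LL_dist ?I (superpotential u) (\<lambda>x y. deriv (\<lambda>E'. G0 x y E') E) \<phi>)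
        \<longlongrightarrow> kernel_dist ?I (\<lambda>x y. G1 x y ?\<alpha>) \<phi>) (at ?\<alpha>)"
      if "deletes_ground_state a b V0 N En \<psi> \<alpha> u" "\<phi> \<in> test_functions2 ?I" for \<phi>
      by (rule P.deleted_derivative_limit[OF that])
  qed
qed

end
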